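(* Let $N$ be a smooth manifold and let $g_n$ be a sequence of Riemannian metrics on $N$ that converge smoothly to a Riemannian metric $g$. For $n=1,2,\dots$, let $Z_n\subset N\times[0,\infty)$ be a weak set flow for the metric $g_n$ such that the sequence $Z_n$ Kuratowski-converges to $Z\subset N\times[0,\infty)$. Then $Z$ is a weak set flow for the metric $g$.
   Context: Kuratowski convergence. In a metric space $(Q,d)$, a sequence of closed sets $Z_n\subset Q$ Kuratowski-converges to $Z\subset Q$ if $Z=\{x:\limsup_n d(x,Z_n)=0\}=\{x:\liminf_n d(x,Z_n)=0\}$. Here $Q=N\times[0,\infty)$ with $d((x_1,t_1),(x_2,t_2))=\max\{\mathrm{dist}_g(x_1,x_2),|t_1-t_2|^{1/2}\}$ (the notion depends only on the topology). Smooth barriers (with respect to a given Riemannian metric on $N$). Let $a<b$. A family $t\in[a,b]\mapsto K(t)$ of closed subsets of $N$ is a smooth barrier if it is a smooth one-parameter family of closed regions with smooth boundary; that is, there is a smooth $f:N\times[a,b]\to\mathbf{R}$ with $K(t)=\{x: f(x,t)\le 0\}$ and spatial gradient $\nabla f(x,t)\ne 0$ whenever $f(x,t)=0$. It is compact if $\bigcup_{t\in[a,b]}K(t)$ is a compact subset of $N$. For $x\in\partial K(t)$: $\nu_K=\nabla f/|\nabla f|$ is the unit normal to $\partial K(t)$ pointing out of $K(t)$; $\mathrm{H}_K=-\mathrm{Div}(\nabla f/|\nabla f|)$ is the dot product of $\nu_K$ with the mean curvature vector of $\partial K(t)$; $\mathbf{v}_K=-\frac{1}{|\nabla f|}\frac{\partial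 f}{\partial t}$ is the normal velocity of $\tau\mapsto\partial K(\tau)$ in the direction $\nu_K$; and $\Phi_K=\mathbf{v}_K-\mathrm{H}_K$. Weak set flows (with respect to that metric). Let $Z$ be a closed subset of $N\times[0,\infty)$ and $Z(t)=\{x\in N:(x,t)\in Z\}$. $Z$ is a weak set flow (with starting time $0$) if: whenever $t\in[a,b]\mapsto K(t)$ is a smooth compact barrier with $a\ge 0$ such that $K(t)\cap Z(t)=\emptyset$ for all $t\in[a,b)$, and $p\in K(b)\cap Z(b)$, then $p\in\partial K(b)$ and $\Phi_K(p,b)\ge 0$. *)

theory Defs
  imports "HOL-Analysis.Analysis"
begin

text \<open>\<open>iter_deriv [v1, ..., vk] f\<close> is the iterated directional derivative of \<open>f\<close> along
  \<open>vk\<close>, then ..., then \<open>v1\<close>.\<close>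

primrec iter_deriv ::
  "'a::real_normed_vector list \<Rightarrow> ('a \<Rightarrow> 'b::real_normed_vector) \<Rightarrow> 'a \<Rightarrow> 'b" where
  "iter_deriv [] f = f"
| "iter_deriv (v # vs) f = (\<lambda>x. frechet_derivative (iter_deriv vs f) (at x) v)"

text \<open>Smoothness on an arbitrary subset means that \<open>f\<close> has, near each point, a
  \<open>C\<^sup>\<infinity>\<close> extension to an open set.  For open \<open>S\<close> this is ordinary
  \<open>C\<^sup>\<infinity>\<close> smoothness; for \<open>S = V \<times> [a,b]\<close> with \<open>V\<close> open it is smoothness up to
  the boundary times \<open>a\<close> and \<open>b\<close>.\<close>

definition smooth_on ::
  "'a::real_normed_vector set \<Rightarrow> ('a \<Rightarrow> 'b::real_normed_vector) \<Rightarrow> bool" where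
  "smooth_on S f \<longleftrightarrow>
     (\<forall>x\<in>S. \<exists>W F. open W \<and> x \<in> W \<and>
        (\<forall>vs. \<forall>y\<in>W. iter_deriv vs F differentiable (at y)) \<and>
        (\<forall>y\<in>W \<inter> S. F y = f y))"

text \<open>The manifold is a whole type \<open>'a\<close>, assumed Hausdorff and second countable by means of
  type classes; its dimension is \<open>CARD('n)\<close>.  A chart is a pair of its domain and its
  coordinate map (whose values off the domain are irrelevant).\<close>

type_synonym ('a, 'n) chart = "'a set \<times> ('a \<Rightarrow> real ^ 'n)"

abbreviation chart_dom :: "('a, 'n::finite) chart \<Rightarrow> 'a set" where
  "chart_dom c \<equiv> fst c"

abbreviation coord :: "('a, 'n::finite) chart \<Rightarrow> 'a \<Rightarrow> real ^ 'n" where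
  "coord c \<equiv> snd c"

abbreviation chart_img :: "('a, 'n::finite) chart \<Rightarrow> (real ^ 'n) set" where
  "chart_img c \<equiv> coord c ` chart_dom c"

definition chart_inv :: "('a, 'n::finite) chart \<Rightarrow> real ^ 'n \<Rightarrow> 'a" where
  "chart_inv c = inv_into (chart_dom c) (coord c)"

definition smooth_atlas ::
  "('a::{t2_space, second_countable_topology}, 'n::finite) chart set \<Rightarrow> bool" where
  "smooth_atlas A \<longleftrightarrow>
     (\<forall>c\<in>A. open (chart_dom c) \<and> open (chart_img c) \<and>
        homeomorphism (chart_dom c) (chart_img c) (coord c) (chart_inv c)) \<and>
     (\<Union>c\<in>A. chart_dom c) = UNIV \<and>
     (\<forall>c\<in>A. \<forall>c'\<in>A.
        smooth_on (coord c ` (chart_dom c \<inter> chart_dom c')) (coord c' \<circ> chart_inv c))"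

text \<open>A metric is given by its coordinate expressions: \<open>g c z v w\<close> is the inner product, at
  the point with coordinates \<open>z\<close> in the chart \<open>c\<close>, of the tangent vectors with components
  \<open>v\<close> and \<open>w\<close>.  The last conjunct is the transformation law of a covariant 2-tensor.\<close>

type_synonym 'n coord_metric = "real ^ 'n \<Rightarrow> real ^ 'n \<Rightarrow> real ^ 'n \<Rightarrow> real"

type_synonym ('a, 'n) metric_field = "('a, 'n) chart \<Rightarrow> 'n coord_metric"

definition riemannian_metric ::
  "('a::{t2_space, second_countable_topology}, 'n::finite) chart set
     \<Rightarrow> ('a, 'n) metric_field \<Rightarrow> bool" where
  "riemannian_metric A g \<longleftrightarrow>
     (\<forall>c\<in>A. \<forall>z\<in>chart_img c.
        bilinear (g c z) \<and> (\<forall>v w. g c z v w = g c z w v) \<and>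
        (\<forall>v. v \<noteq> 0 \<longrightarrow> g c z v v > 0)) \<and>
     (\<forall>c\<in>A. \<forall>v w. smooth_on (chart_img c) (\<lambda>z. g c z v w)) \<and>
     (\<forall>c\<in>A. \<forall>c'\<in>A. \<forall>x\<in>chart_dom c \<inter> chart_dom c'. \<forall>v w.
        (let D = frechet_derivative (coord c' \<circ> chart_inv c) (at (coord c x))
         in g c' (coord c' x) (D v) (D w) = g c (coord c x) v w))"

text \<open>Smooth convergence: in every chart, all derivatives (of every order) of the components
  converge uniformly on compact sets.\<close>

definition metrics_converge_smoothly ::
  "('a::{t2_space, second_countable_topology}, 'n::finite) chart set
     \<Rightarrow> (nat \<Rightarrow> ('a, 'n) metric_field) \<Rightarrow> ('a, 'n) metric_field \<Rightarrow> bool" where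
  "metrics_converge_smoothly A gs g \<longleftrightarrow>
     (\<forall>c\<in>A. \<forall>v w vs. \<forall>C. compact C \<and> C \<subseteq> chart_img c \<longrightarrow>
        uniform_limit C (\<lambda>n. iter_deriv vs (\<lambda>z. gs n c z v w))
          (iter_deriv vs (\<lambda>z. g c z v w)) sequentially)"

definition piecewise_C1_curve ::
  "('a::{t2_space, second_countable_topology}, 'n::finite) chart set
     \<Rightarrow> (real \<Rightarrow> 'a) \<Rightarrow> bool" where
  "piecewise_C1_curve A \<gamma> \<longleftrightarrow>
     path \<gamma> \<and>
     (\<forall>c\<in>A. \<forall>s t. 0 \<le> s \<and> s \<le> t \<and> t \<le> 1 \<and> \<gamma> ` {s..t} \<subseteq> chart_dom c \<longrightarrow>
        (coord c \<circ> \<gamma>) piecewise_C1_differentiable_on {s..t})"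

text \<open>By the transformation law of \<open>g\<close> the speed does not depend on the chosen chart.\<close>

definition speed ::
  "('a::{t2_space, second_countable_topology}, 'n::finite) chart set
     \<Rightarrow> ('a, 'n) metric_field \<Rightarrow> (real \<Rightarrow> 'a) \<Rightarrow> real \<Rightarrow> real" where
  "speed A g \<gamma> s =
     (let c = (SOME c. c \<in> A \<and> \<gamma> s \<in> chart_dom c);
          v = vector_derivative (coord c \<circ> \<gamma>) (at s)
      in sqrt (g c (coord c (\<gamma> s)) v v))"

text \<open>The library's piecewise \<open>C\<^sup>1\<close> curves may have unbounded derivative near the
  exceptional points, so the length is an extended nonnegative Lebesgue integral.\<close>

definition curve_length ::
  "('a::{t2_space, second_countable_topology}, 'n::finite) chart set
     \<Rightarrow> ('a, 'n) metric_field \<Rightarrow> (real \<Rightarrow> 'a) \<Rightarrow> ennreal" where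
  "curve_length A g \<gamma> = (\<integral>\<^sup>+ s\<in>{0..1}. ennreal (speed A g \<gamma> s) \<partial>lborel)"

text \<open>The distance is infinite between different components.\<close>

definition riemannian_dist ::
  "('a::{t2_space, second_countable_topology}, 'n::finite) chart set
     \<Rightarrow> ('a, 'n) metric_field \<Rightarrow> 'a \<Rightarrow> 'a \<Rightarrow> ennreal" where
  "riemannian_dist A g x y =
     (INF \<gamma>\<in>{\<gamma>. piecewise_C1_curve A \<gamma> \<and> pathstart \<gamma> = x \<and> pathfinish \<gamma> = y}.
        curve_length A g \<gamma>)"

definition parabolic_dist ::
  "('a::{t2_space, second_countable_topology}, 'n::finite) chart set
     \<Rightarrow> ('a, 'n) metric_field \<Rightarrow> 'a \<times> real \<Rightarrow> 'a \<times> real \<Rightarrow> ennreal" where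
  "parabolic_dist A g p q =
     max (riemannian_dist A g (fst p) (fst q)) (ennreal (sqrt \<bar>snd p - snd q\<bar>))"

text \<open>The distance to a set is an infimum in \<open>ennreal\<close>, so the distance to the empty
  set is infinite (unlike \<open>infdist\<close>, which is then 0).\<close>

definition kuratowski_converges ::
  "'q set \<Rightarrow> ('q \<Rightarrow> 'q \<Rightarrow> ennreal) \<Rightarrow> (nat \<Rightarrow> 'q set) \<Rightarrow> 'q set \<Rightarrow> bool" where
  "kuratowski_converges Q d Zs Z \<longleftrightarrow>
     Z = {x \<in> Q. limsup (\<lambda>n. INF z\<in>Zs n. d x z) = 0} \<and>
     Z = {x \<in> Q. liminf (\<lambda>n. INF z\<in>Zs n. d x z) = 0}"

text \<open>In the following operators \<open>G\<close> is the coordinate expression of the metric in one chart, \<open>u\<close> a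
  function and \<open>X\<close> a vector field in the same coordinates.\<close>

definition rgrad :: "'n::finite coord_metric \<Rightarrow> (real ^ 'n \<Rightarrow> real) \<Rightarrow> real ^ 'n \<Rightarrow> real ^ 'n" where
  "rgrad G u z = (THE w. \<forall>v. G z w v = frechet_derivative u (at z) v)"

definition rnorm :: "'n::finite coord_metric \<Rightarrow> real ^ 'n \<Rightarrow> real ^ 'n \<Rightarrow> real" where
  "rnorm G z v = sqrt (G z v v)"

definition vol_density :: "'n::finite coord_metric \<Rightarrow> real ^ 'n \<Rightarrow> real" where
  "vol_density G z = sqrt (det (\<chi> i j. G z (axis i 1) (axis j 1)))"

text \<open>Divergence with respect to the Riemannian volume:
  \<open>Div X = (1 / \<surd>det G) \<Sum>\<^sub>i \<partial>\<^sub>i (\<surd>det G X\<^sup>i)\<close>\<close>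

definition rdiv :: "'n::finite coord_metric \<Rightarrow> (real ^ 'n \<Rightarrow> real ^ 'n) \<Rightarrow> real ^ 'n \<Rightarrow> real" where
  "rdiv G X z =
     (\<Sum>i\<in>UNIV. frechet_derivative (\<lambda>y. vol_density G y * X y $ i) (at z) (axis i 1))
       / vol_density G z"

definition unit_normal ::
  "'n::finite coord_metric \<Rightarrow> (real ^ 'n \<Rightarrow> real) \<Rightarrow> real ^ 'n \<Rightarrow> real ^ 'n" where
  "unit_normal G u z = rgrad G u z /\<^sub>R rnorm G z (rgrad G u z)"

definition in_chart ::
  "('a, 'n::finite) chart \<Rightarrow> ('a \<Rightarrow> real \<Rightarrow> real) \<Rightarrow> real \<Rightarrow> real ^ 'n \<Rightarrow> real" where
  "in_chart c f t z = f (chart_inv c z) t"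

definition smooth_barrier ::
  "('a::{t2_space, second_countable_topology}, 'n::finite) chart set
     \<Rightarrow> ('a, 'n) metric_field \<Rightarrow> real \<Rightarrow> real \<Rightarrow> ('a \<Rightarrow> real \<Rightarrow> real)
     \<Rightarrow> (real \<Rightarrow> 'a set) \<Rightarrow> bool" where
  "smooth_barrier A g a b f K \<longleftrightarrow>
     a < b \<and>
     (\<forall>c\<in>A. smooth_on (chart_img c \<times> {a..b}) (\<lambda>(z, t). in_chart c f t z)) \<and>
     (\<forall>t\<in>{a..b}. K t = {x. f x t \<le> 0}) \<and>
     (\<forall>c\<in>A. \<forall>x\<in>chart_dom c. \<forall>t\<in>{a..b}.
        f x t = 0 \<longrightarrow> rgrad (g c) (in_chart c f t) (coord c x) \<noteq> 0)"

definition compact_barrier ::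
  "real \<Rightarrow> real \<Rightarrow> (real \<Rightarrow> 'a::topological_space set) \<Rightarrow> bool" where
  "compact_barrier a b K \<longleftrightarrow> compact (\<Union>t\<in>{a..b}. K t)"

text \<open>The following quantities at \<open>x \<in> \<partial>K(t)\<close> are computed in a chart \<open>c\<close> around
  \<open>x\<close>; they depend neither on \<open>c\<close> nor on the defining function \<open>f\<close> of \<open>K\<close>.
  At \<open>t = a\<close> and \<open>t = b\<close> the time derivative is one-sided.\<close>

definition barrier_H ::
  "('a, 'n::finite) metric_field \<Rightarrow> ('a, 'n) chart \<Rightarrow> ('a \<Rightarrow> real \<Rightarrow> real)
     \<Rightarrow> 'a \<Rightarrow> real \<Rightarrow> real" where
  "barrier_H g c f x t = - rdiv (g c) (unit_normal (g c) (in_chart c f t)) (coord c x)"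

definition barrier_v ::
  "('a, 'n::finite) metric_field \<Rightarrow> ('a, 'n) chart \<Rightarrow> real \<Rightarrow> real
     \<Rightarrow> ('a \<Rightarrow> real \<Rightarrow> real) \<Rightarrow> 'a \<Rightarrow> real \<Rightarrow> real" where
  "barrier_v g c a b f x t =
     - (1 / rnorm (g c) (coord c x) (rgrad (g c) (in_chart c f t) (coord c x)))
       * vector_derivative (f x) (at t within {a..b})"

definition barrier_Phi ::
  "('a, 'n::finite) metric_field \<Rightarrow> ('a, 'n) chart \<Rightarrow> real \<Rightarrow> real
     \<Rightarrow> ('a \<Rightarrow> real \<Rightarrow> real) \<Rightarrow> 'a \<Rightarrow> real \<Rightarrow> real" where
  "barrier_Phi g c a b f x t = barrier_v g c a b f x t - barrier_H g c f x t"

definition time_slice :: "('a \<times> real) set \<Rightarrow> real \<Rightarrow> 'a set" where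
  "time_slice Z t = {x. (x, t) \<in> Z}"

definition weak_set_flow ::
  "('a::{t2_space, second_countable_topology}, 'n::finite) chart set
     \<Rightarrow> ('a, 'n) metric_field \<Rightarrow> ('a \<times> real) set \<Rightarrow> bool" where
  "weak_set_flow A g Z \<longleftrightarrow>
     closed Z \<and> Z \<subseteq> UNIV \<times> {0..} \<and>
     (\<forall>a b f K p.
        0 \<le> a \<and> smooth_barrier A g a b f K \<and> compact_barrier a b K \<and>
        (\<forall>t\<in>{a..<b}. K t \<inter> time_slice Z t = {}) \<and>
        p \<in> K b \<inter> time_slice Z b \<longrightarrow>
          p \<in> frontier (K b) \<and>
          (\<forall>c\<in>A. p \<in> chart_dom c \<longrightarrow> barrier_Phi g c a b f p b \<ge> 0))"

end

theory Submission
  imports Defs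
begin

text \<open>
The proof tests the limit flow with compact barriers that live in a single chart.

On the topological side, the Riemannian distance induces the topology of the manifold: a curve that
leaves a coordinate ball has length at least a constant times the radius, and a coordinate segment has
length at most a constant times its Euclidean length.  Hence Kuratowski convergence says that an open
set that meets \<open>Z\<close> meets \<open>Zs n\<close> for all large \<open>n\<close> (\<open>kuratowski_limit_meets_open\<close>), and a compact
set that misses \<open>Z\<close> misses \<open>Zs n\<close> for all large \<open>n\<close> (\<open>kuratowski_limit_avoids_compact\<close>).

The heart of the matter is \<open>limit_avoids_interior\<close>.  Let \<open>\<psi>\<close> be a smooth function of position and time
in a chart such that the sets \<open>{\<psi> \<le> 0}\<close> stay in a compact part of the chart for times in
\<open>[a, b]\<close>, the spatial gradient does not vanish on \<open>{\<psi> = 0}\<close>, the set \<open>{\<psi> \<le> 0}\<close> misses \<open>Z\<close> at time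
\<open>a\<close>, and \<open>\<Phi> < 0\<close> at the points of \<open>{\<psi> = 0}\<close> that belong to \<open>Z\<close>.  Then \<open>Z\<close> does not reach
\<open>{\<psi> < 0}\<close> at any time strictly between \<open>a\<close> and \<open>b\<close>.  Otherwise \<open>Zs n\<close> reaches \<open>{\<psi> < 0}\<close> for large \<open>n\<close>,
too, although it misses \<open>{\<psi> \<le> 0}\<close> at time \<open>a\<close>.  At the first time of contact the weak set
flow property of \<open>Zs n\<close> gives a point with \<open>\<psi> = 0\<close> where \<open>\<Phi> \<ge> 0\<close> for the metric \<open>gs n\<close>.  A limit point of these
points belongs to \<open>Z\<close>, and there \<open>\<Phi> \<ge> 0\<close> for \<open>g\<close>, because \<open>\<Phi>\<close> depends continuously on the
metric, its first derivatives and the derivatives of \<open>\<psi>\<close> up to second order (\<open>level_Phi_tendsto\<close>).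

This is applied twice.  A coordinate ball that shrinks fast enough has \<open>\<Phi> < 0\<close> on its whole boundary;
therefore every point of \<open>Z\<close> at a positive time is a limit of points of \<open>Z\<close> at earlier times
(\<open>limit_has_past\<close>).  So a barrier \<open>K\<close> that is disjoint from \<open>Z\<close> before time \<open>b\<close> can contain points of \<open>Z\<close> at
time \<open>b\<close> only in its boundary.  Suppose that \<open>\<Phi> < 0\<close> at such a point, with coordinates
\<open>z\<^sub>0\<close>.  A local defining function \<open>F\<close> of the barrier extends smoothly beyond the time \<open>b\<close>, and is replaced
by \<open>F + M |z - z\<^sub>0|\<^sup>4 - \<kappa>\<close> (\<open>strict_touching_impossible\<close>).  The quartic term does not change the derivatives
at \<open>z\<^sub>0\<close> up to second order, so \<open>\<Phi> < 0\<close> persists near \<open>z\<^sub>0\<close>; for large \<open>M\<close> it confines the sublevel set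
to a small ball, and it separates the barrier at time \<open>b\<close> from all points of \<open>Z\<close> other than \<open>z\<^sub>0\<close>.  The small constant \<open>\<kappa>\<close> moves
\<open>z\<^sub>0\<close> into the interior of the barrier, which contradicts \<open>limit_avoids_interior\<close>.
\<close>

section \<open>Smooth functions and iterated derivatives\<close>

text \<open>Products, quotients and composites of smooth functions are smooth by induction on the order \<open>k\<close>:
their first derivatives are again sums of products and composites, of functions that are
differentiable up to order \<open>k\<close>.  The induction step is \<open>C_upto_SucI\<close>.\<close>

definition C_upto ::
  "nat \<Rightarrow> 'a::real_normed_vector set \<Rightarrow> ('a \<Rightarrow> 'b::real_normed_vector) \<Rightarrow> bool" where
  "C_upto k W F \<longleftrightarrow> (\<forall>vs. length vs \<le> k \<longrightarrow> (\<forall>y\<in>W. iter_deriv vs F differentiable (at y)))"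

definition C_infty ::
  "'a::real_normed_vector set \<Rightarrow> ('a \<Rightarrow> 'b::real_normed_vector) \<Rightarrow> bool" where
  "C_infty W F \<longleftrightarrow> (\<forall>vs. \<forall>y\<in>W. iter_deriv vs F differentiable (at y))"

lemma C_infty_iff: "C_infty W F \<longleftrightarrow> (\<forall>k. C_upto k W F)"
  unfolding C_infty_def C_upto_def by auto

lemma iter_deriv_append:
  "iter_deriv (vs @ ws) f = iter_deriv vs (iter_deriv ws f)"
  by (induction vs) auto

lemma iter_deriv_cong_open:
  assumes "open W" "\<And>y. y \<in> W \<Longrightarrow> f y = g y" "y \<in> W"
  shows "iter_deriv vs f y = iter_deriv vs g y"
  using assms(3)
proof (induction vs arbitrary: y)
  case Nil
  then show ?case using assms(2) by simp
next
  case (Cons v vs)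
  have eq: "\<forall>z\<in>W. iter_deriv vs f z = iter_deriv vs g z"
    using Cons.IH by blast
  have "(iter_deriv vs f has_derivative D) (at y) \<longleftrightarrow> (iter_deriv vs g has_derivative D) (at y)" for D
    using eq has_derivative_transform_within_open[OF _ assms(1) Cons.prems, of "iter_deriv vs f" D _ "iter_deriv vs g"]
      has_derivative_transform_within_open[OF _ assms(1) Cons.prems, of "iter_deriv vs g" D _ "iter_deriv vs f"]
    by auto
  then show ?case by (simp add: frechet_derivative_def)
qed

lemma C_upto_cong:
  assumes "open W" "\<And>y. y \<in> W \<Longrightarrow> f y = g y" "C_upto k W f"
  shows "C_upto k W g"
  unfolding C_upto_def
proof (intro allI impI ballI)
  fix vs :: "'a list" and y assume "length vs \<le> k" "y \<in> W"
  then obtain D where "(iter_deriv vs f has_derivative D) (at y)"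
    using assms(3) by (auto simp: C_upto_def differentiable_def)
  then have "(iter_deriv vs g has_derivative D) (at y)"
    by (rule has_derivative_transform_within_open[OF _ assms(1) \<open>y \<in> W\<close>])
       (rule iter_deriv_cong_open[OF assms(1,2)])
  then show "iter_deriv vs g differentiable (at y)"
    by (auto simp: differentiable_def)
qed

lemma C_upto_0: "C_upto 0 W F \<longleftrightarrow> (\<forall>y\<in>W. F differentiable (at y))"
  unfolding C_upto_def by auto

text \<open>In \<open>iter_deriv vs F\<close> the first derivative to be taken is the one along the last entry of \<open>vs\<close>, so
splitting the list at its end peels one derivative off \<open>F\<close>.\<close>

lemma C_upto_Suc:
  "C_upto (Suc k) W F \<longleftrightarrow> (\<forall>y\<in>W. F differentiable (at y)) \<and>
     (\<forall>v. C_upto k W (\<lambda>x. frechet_derivative F (at x) v))" (is "?L \<longleftrightarrow> ?R")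
proof
  assume L: ?L
  show ?R
  proof (intro conjI allI)
    show "\<forall>y\<in>W. F differentiable (at y)"
      using L[unfolded C_upto_def, rule_format, of "[]"] by simp
    fix v
    show "C_upto k W (\<lambda>x. frechet_derivative F (at x) v)"
      unfolding C_upto_def
    proof (intro allI impI)
      fix vs :: "'a list" assume "length vs \<le> k"
      then have "length (vs @ [v]) \<le> Suc k" by simp
      then show "\<forall>y\<in>W. iter_deriv vs (\<lambda>x. frechet_derivative F (at x) v) differentiable (at y)"
        using L[unfolded C_upto_def, rule_format, of "vs @ [v]"] by (simp add: iter_deriv_append)
    qed
  qed
next
  assume R: ?R
  show ?L
    unfolding C_upto_def
  proof (intro allI impI)
    fix vs :: "'a list" assume l: "length vs \<le> Suc k"
    show "\<forall>y\<in>W. iter_deriv vs F differentiable (at y)"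
    proof (cases vs rule: rev_cases)
      case Nil
      then show ?thesis using R by simp
    next
      case (snoc us v)
      then show ?thesis
        using R l unfolding C_upto_def by (auto simp: iter_deriv_append)
    qed
  qed
qed

lemma C_upto_SucI:
  assumes "open W" "\<And>y. y \<in> W \<Longrightarrow> (F has_derivative F' y) (at y)"
    "\<And>v. C_upto k W (\<lambda>y. F' y v)"
  shows "C_upto (Suc k) W F"
  unfolding C_upto_Suc
proof (intro conjI ballI allI)
  fix y assume "y \<in> W" then show "F differentiable (at y)"
    using assms(2) differentiable_def by blast
next
  fix v
  show "C_upto k W (\<lambda>x. frechet_derivative F (at x) v)"
    by (rule C_upto_cong[OF assms(1) _ assms(3)[of v]])
       (simp add: frechet_derivative_at[OF assms(2), symmetric])
qed

lemma C_upto_SucD: "C_upto (Suc k) W F \<Longrightarrow> C_upto k W F"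
  unfolding C_upto_def by auto

lemma C_upto_differentiable: "C_upto k W F \<Longrightarrow> y \<in> W \<Longrightarrow> F differentiable (at y)"
  unfolding C_upto_def by (drule spec[of _ "[]"]) simp

lemma C_upto_has_derivative:
  "C_upto k W F \<Longrightarrow> y \<in> W \<Longrightarrow> (F has_derivative frechet_derivative F (at y)) (at y)"
  using C_upto_differentiable frechet_derivative_works by blast

lemma C_upto_subset: "C_upto k W F \<Longrightarrow> V \<subseteq> W \<Longrightarrow> C_upto k V F"
  unfolding C_upto_def by auto

lemma C_upto_const: "open W \<Longrightarrow> C_upto k W (\<lambda>x. c)"
proof (induction k arbitrary: c)
  case 0 then show ?case by (simp add: C_upto_0)
next
  case (Suc k)
  show ?case
    by (rule C_upto_SucI[OF Suc.prems, where F' = "\<lambda>_ _. 0"]) (simp_all add: Suc.IH Suc.prems)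
qed

lemma C_upto_linear_comp:
  assumes L: "bounded_linear L" and "open W" "C_upto k W f"
  shows "C_upto k W (\<lambda>x. L (f x))"
  using assms(3)
proof (induction k arbitrary: f)
  case 0
  then show ?case unfolding C_upto_0
    using differentiable_compose[OF bounded_linear_imp_differentiable[OF L]] by blast
next
  case (Suc k)
  show ?case
  proof (rule C_upto_SucI[OF assms(2)])
    fix y assume "y \<in> W"
    then show "((\<lambda>x. L (f x)) has_derivative (\<lambda>v. L (frechet_derivative f (at y) v))) (at y)"
      by (intro bounded_linear.has_derivative[OF L] C_upto_has_derivative[OF Suc.prems])
  next
    show "C_upto k W (\<lambda>y. L (frechet_derivative f (at y) v))" for v
      using Suc.prems by (intro Suc.IH) (simp add: C_upto_Suc)
  qed
qed

lemma C_upto_id: assumes "open W" shows "C_upto k W (\<lambda>x. x)"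
proof (cases k)
  case 0 then show ?thesis by (simp add: C_upto_0)
next
  case (Suc n)
  show ?thesis unfolding Suc
    by (rule C_upto_SucI[OF assms, where F' = "\<lambda>_ v. v"]) (auto intro: C_upto_const assms)
qed

lemma C_upto_linear: "bounded_linear L \<Longrightarrow> open W \<Longrightarrow> C_upto k W L"
  using C_upto_linear_comp[OF _ _ C_upto_id] by blast

lemma C_upto_add:
  assumes "open W" "C_upto k W f" "C_upto k W g"
  shows "C_upto k W (\<lambda>x. f x + g x)"
  using assms(2,3)
proof (induction k arbitrary: f g)
  case 0
  then show ?case by (simp add: C_upto_0)
next
  case (Suc k)
  show ?case
  proof (rule C_upto_SucI[OF assms(1)])
    fix y assume "y \<in> W"
    then show "((\<lambda>x. f x + g x) has_derivative
        (\<lambda>v. frechet_derivative f (at y) v + frechet_derivative g (at y) v)) (at y)"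
      by (intro has_derivative_add C_upto_has_derivative[OF Suc.prems(1)]
          C_upto_has_derivative[OF Suc.prems(2)])
  next
    show "C_upto k W (\<lambda>y. frechet_derivative f (at y) v + frechet_derivative g (at y) v)" for v
      using Suc.prems by (intro Suc.IH) (auto simp: C_upto_Suc)
  qed
qed

lemma C_upto_sum:
  assumes "open W" "\<And>i. i \<in> I \<Longrightarrow> C_upto k W (f i)"
  shows "C_upto k W (\<lambda>x. \<Sum>i\<in>I. f i x)"
  using assms(2)
  by (induction I rule: infinite_finite_induct) (auto intro: C_upto_const C_upto_add assms(1))

lemma C_upto_scaleR:
  fixes f :: "'a::real_normed_vector \<Rightarrow> real" and g :: "'a \<Rightarrow> 'b::real_normed_vector"
  assumes "open W" "C_upto k W f" "C_upto k W g"
  shows "C_upto k W (\<lambda>x. f x *\<^sub>R g x)"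
  using assms(2,3)
proof (induction k arbitrary: f g)
  case 0
  then show ?case by (simp add: C_upto_0)
next
  case (Suc k)
  show ?case
  proof (rule C_upto_SucI[OF assms(1)])
    fix y assume y: "y \<in> W"
    show "((\<lambda>x. f x *\<^sub>R g x) has_derivative
        (\<lambda>v. f y *\<^sub>R frechet_derivative g (at y) v + frechet_derivative f (at y) v *\<^sub>R g y)) (at y)"
      using has_derivative_scaleR[OF C_upto_has_derivative[OF Suc.prems(1) y]
         C_upto_has_derivative[OF Suc.prems(2) y]] .
  next
    show "C_upto k W (\<lambda>y. f y *\<^sub>R frechet_derivative g (at y) v + frechet_derivative f (at y) v *\<^sub>R g y)" for v
      using Suc.prems C_upto_SucD[OF Suc.prems(1)] C_upto_SucD[OF Suc.prems(2)]
      by (intro C_upto_add Suc.IH assms(1)) (auto simp: C_upto_Suc)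
  qed
qed

lemma C_upto_mult:
  fixes f g :: "'a::real_normed_vector \<Rightarrow> real"
  assumes "open W" "C_upto k W f" "C_upto k W g"
  shows "C_upto k W (\<lambda>x. f x * g x)"
  using C_upto_scaleR[OF assms] by simp

lemma C_upto_diff:
  assumes "open W" "C_upto k W f" "C_upto k W g"
  shows "C_upto k W (\<lambda>x. f x - g x)"
  using C_upto_add[OF assms(1,2) C_upto_linear_comp[OF bounded_linear_minus[OF bounded_linear_ident] assms(1,3)]]
  by simp

lemma C_upto_prod:
  fixes f :: "'i \<Rightarrow> 'a::real_normed_vector \<Rightarrow> real"
  assumes "open W" "\<And>i. i \<in> I \<Longrightarrow> C_upto k W (f i)"
  shows "C_upto k W (\<lambda>x. \<Prod>i\<in>I. f i x)"
  using assms(2)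
  by (induction I rule: infinite_finite_induct) (auto intro: C_upto_const C_upto_mult assms(1))

lemma C_upto_componentwise:
  fixes f :: "'a::real_normed_vector \<Rightarrow> 'b::euclidean_space"
  assumes "open W" "\<And>b. b \<in> Basis \<Longrightarrow> C_upto k W (\<lambda>x. f x \<bullet> b)"
  shows "C_upto k W f"
proof -
  have "C_upto k W (\<lambda>x. \<Sum>b\<in>Basis. (f x \<bullet> b) *\<^sub>R b)"
    by (intro C_upto_sum C_upto_scaleR C_upto_const assms)
  then show ?thesis by (simp add: euclidean_representation)
qed

lemma C_upto_Pair:
  assumes "open W" "C_upto k W f" "C_upto k W g"
  shows "C_upto k W (\<lambda>x. (f x, g x))"
proof -
  have "bounded_linear (\<lambda>x::'b. (x, 0::'c))" "bounded_linear (\<lambda>y::'c. (0::'b, y))"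
    by (auto intro!: bounded_linear_Pair bounded_linear_ident bounded_linear_zero)
  from C_upto_add[OF assms(1) C_upto_linear_comp[OF this(1) assms(1,2)] C_upto_linear_comp[OF this(2) assms(1,3)]]
  show ?thesis by simp
qed

text \<open>The chain rule is expanded in a basis of the middle space: the derivative of \<open>g \<circ> f\<close> becomes a
sum of products of components of the derivative of \<open>f\<close> with composites \<open>(\<partial>\<^sub>b g) \<circ> f\<close>, and the
induction hypothesis applies to the latter.\<close>

lemma C_upto_compose:
  fixes g :: "'b::euclidean_space \<Rightarrow> real" and f :: "'a::real_normed_vector \<Rightarrow> 'b"
  assumes "open W" "C_upto k W f" "C_upto k U g" "f ` W \<subseteq> U"
  shows "C_upto k W (\<lambda>x. g (f x))"
  using assms(2,3)
proof (induction k arbitrary: g)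
  case 0
  have "g differentiable (at (f y))" "f differentiable (at y)" if "y \<in> W" for y
    using 0 that assms(4) by (auto simp: C_upto_0)
  then show ?case
    unfolding C_upto_0 using differentiable_chain_at unfolding comp_def by blast
next
  case (Suc k)
  show ?case
  proof (rule C_upto_SucI[OF assms(1)])
    fix y assume y: "y \<in> W"
    then have fy: "f y \<in> U" using assms(4) by auto
    let ?g' = "frechet_derivative g (at (f y))" and ?f' = "frechet_derivative f (at y)"
    have der: "((\<lambda>x. g (f x)) has_derivative (\<lambda>v. ?g' (?f' v))) (at y)"
      using diff_chain_at[OF C_upto_has_derivative[OF Suc.prems(1) y]
          C_upto_has_derivative[OF Suc.prems(2) fy]] by (simp add: comp_def)
    have eq: "?g' w = (\<Sum>b\<in>Basis. (w \<bullet> b) * ?g' b)" for w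
    proof -
      have lin: "linear ?g'"
        using linear_frechet_derivative[OF C_upto_differentiable[OF Suc.prems(2) fy]] .
      have "?g' w = ?g' (\<Sum>b\<in>Basis. (w \<bullet> b) *\<^sub>R b)"
        by (simp only: euclidean_representation)
      also have "\<dots> = (\<Sum>b\<in>Basis. (w \<bullet> b) * ?g' b)"
        by (simp only: linear_sum[OF lin] linear_scale[OF lin] real_scaleR_def)
      finally show ?thesis .
    qed
    show "((\<lambda>x. g (f x)) has_derivative
       (\<lambda>v. \<Sum>b\<in>Basis. (?f' v \<bullet> b) * ?g' b)) (at y)"
      by (rule has_derivative_eq_rhs[OF der]) (rule ext, rule eq)
  next
    show "C_upto k W (\<lambda>y. \<Sum>b\<in>Basis. (frechet_derivative f (at y) v \<bullet> b) *
         frechet_derivative g (at (f y)) b)" for v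
    proof (intro C_upto_sum C_upto_mult assms(1))
      fix b :: 'b
      show "C_upto k W (\<lambda>x. frechet_derivative f (at x) v \<bullet> b)"
        using Suc.prems(1)
        by (intro C_upto_linear_comp[OF bounded_linear_inner_left assms(1)]) (simp add: C_upto_Suc)
      show "C_upto k W (\<lambda>x. frechet_derivative g (at (f x)) b)"
        using Suc.prems C_upto_SucD[OF Suc.prems(1)]
        by (intro Suc.IH[of "\<lambda>z. frechet_derivative g (at z) b"]) (auto simp: C_upto_Suc)
    qed
  qed
qed

lemma C_upto_inverse: "C_upto k {x::real. x \<noteq> 0} inverse"
proof (induction k)
  case 0
  show ?case unfolding C_upto_0 by auto
next
  case (Suc k)
  have o: "open {x::real. x \<noteq> 0}" by (simp add: open_Collect_neq continuous_on_id continuous_on_const)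
  show ?case
  proof (rule C_upto_SucI[OF o])
    fix y :: real assume "y \<in> {x. x \<noteq> 0}"
    then show "(inverse has_derivative (\<lambda>v. - v * (inverse y * inverse y))) (at y)"
      by (auto intro!: derivative_eq_intros)
  next
    show "C_upto k {x::real. x \<noteq> 0} (\<lambda>y. - v * (inverse y * inverse y))" for v
      by (intro C_upto_mult C_upto_const o Suc)
  qed
qed

lemma C_upto_sqrt: "C_upto k {0::real<..} sqrt"
proof (induction k)
  case 0
  show ?case unfolding C_upto_0
  proof
    fix y :: real assume "y \<in> {0<..}"
    then show "sqrt differentiable (at y)"
      using DERIV_real_sqrt[of y] by (auto simp: differentiable_def has_field_derivative_def)
  qed
next
  case (Suc k)
  show ?case
  proof (rule C_upto_SucI)
    fix y :: real assume "y \<in> {0<..}"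
    then show "(sqrt has_derivative (\<lambda>v. v * (inverse (sqrt y) * (1/2)))) (at y)"
      using DERIV_real_sqrt[of y]
      by (auto simp: has_field_derivative_def field_simps elim!: has_derivative_eq_rhs)
  next
    have "C_upto k {0<..} (\<lambda>y. inverse (sqrt y))"
      by (rule C_upto_compose[OF _ Suc C_upto_inverse]) auto
    then show "C_upto k {0<..} (\<lambda>y. v * (inverse (sqrt y) * (1/2)))" for v
      by (intro C_upto_mult C_upto_const) auto
  qed auto
qed

text \<open>For \<open>m = 0\<close> this is the classical function \<open>exp (- 1 / s)\<close>, extended by \<open>0\<close>; the powers of
\<open>1 / s\<close> arise from its derivatives.\<close>

definition flat_exp :: "nat \<Rightarrow> real \<Rightarrow> real" where
  "flat_exp m s = (if s > 0 then inverse s ^ m * exp (- inverse s) else 0)"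

text \<open>The derivative is again a combination of members of the family, hence every member is smooth.  At
\<open>0\<close> this holds because the exponential function dominates all powers.\<close>

lemma flat_exp_deriv:
  "(flat_exp m has_real_derivative flat_exp (m+2) s - real m * flat_exp (m+1) s) (at s)"
proof -
  consider "s > 0" | "s < 0" | "s = 0" by linarith
  then show ?thesis
  proof cases
    case 1
    have "((\<lambda>s. inverse s ^ m * exp (- inverse s)) has_real_derivative
        inverse s ^ m * (exp (- inverse s) * (inverse s * inverse s)) +
        real m * inverse s ^ (m - 1) * (- (inverse s * inverse s)) * exp (- inverse s)) (at s)"
      using 1 by (auto intro!: derivative_eq_intros)
    also have "inverse s ^ m * (exp (- inverse s) * (inverse s * inverse s)) +
        real m * inverse s ^ (m - 1) * (- (inverse s * inverse s)) * exp (- inverse s) =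
        flat_exp (m+2) s - real m * flat_exp (m+1) s"
      using 1 by (cases m) (simp_all add: flat_exp_def algebra_simps)
    finally have "((\<lambda>s. inverse s ^ m * exp (- inverse s)) has_real_derivative
        flat_exp (m+2) s - real m * flat_exp (m+1) s) (at s)" .
    then show ?thesis
      by (rule DERIV_cong_ev[THEN iffD1, rotated -1])
         (use 1 eventually_nhds_in_open[of "{0<..}" s] in
           \<open>auto simp: flat_exp_def elim!: eventually_mono\<close>)
  next
    case 2
    have "((\<lambda>s. 0) has_real_derivative flat_exp (m+2) s - real m * flat_exp (m+1) s) (at s)"
      using 2 by (auto simp: flat_exp_def)
    then show ?thesis
      by (rule DERIV_cong_ev[THEN iffD1, rotated -1])
         (use 2 eventually_nhds_in_open[of "{..<0}" s] in
           \<open>auto simp: flat_exp_def elim!: eventually_mono\<close>)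
  next
    case 3
    have "((\<lambda>x::real. x ^ (m + 1) / exp x) \<longlongrightarrow> 0) at_top"
      by (rule tendsto_power_div_exp_0)
    then have "((\<lambda>s::real. inverse s ^ (m + 1) / exp (inverse s)) \<longlongrightarrow> 0) (at_right 0)"
      using filterlim_inverse_at_top_right by (rule filterlim_compose)
    then have "((\<lambda>s. flat_exp m s / s) \<longlongrightarrow> 0) (at_right 0)"
      by (rule tendsto_cong[THEN iffD1, rotated])
         (rule eventually_at_rightI[of 0 1], auto simp: flat_exp_def exp_minus field_simps)
    moreover have "((\<lambda>s. flat_exp m s / s) \<longlongrightarrow> 0) (at_left 0)"
      by (rule tendsto_cong[THEN iffD1, rotated, OF tendsto_const])
         (rule eventually_at_leftI[of "-1" 0], auto simp: flat_exp_def)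
    ultimately have "((\<lambda>s. flat_exp m s / s) \<longlongrightarrow> 0) (at 0)"
      by (simp add: filterlim_at_split)
    then show ?thesis
      using 3 by (simp add: DERIV_def flat_exp_def)
  qed
qed

lemma C_upto_flat_exp: "C_upto k UNIV (flat_exp m)"
proof (induction k arbitrary: m)
  case 0
  show ?case unfolding C_upto_0
    using flat_exp_deriv by (auto simp: differentiable_def has_field_derivative_def)
next
  case (Suc k)
  show ?case
  proof (rule C_upto_SucI[OF open_UNIV])
    show "(flat_exp m has_derivative (\<lambda>v. (flat_exp (m+2) s - real m * flat_exp (m+1) s) * v)) (at s)" for s
      using flat_exp_deriv[of m s] by (simp add: has_field_derivative_def)
  next
    show "C_upto k UNIV (\<lambda>s. (flat_exp (m+2) s - real m * flat_exp (m+1) s) * v)" for v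
      by (intro C_upto_mult C_upto_diff C_upto_const Suc open_UNIV)
  qed
qed

text \<open>Composition with \<open>E\<close> does not change a function where its values are at most \<open>\<theta>/2\<close>, makes it constant where
they are at least \<open>\<theta>\<close>, and preserves its sublevel set at height \<open>0\<close>.  This extends functions from
a chart to the manifold.  The function \<open>E\<close> is a weighted mean of \<open>s\<close> and \<open>1\<close>, with weights
that vanish to infinite order at the ends of the interval from \<open>\<theta>/2\<close> to \<open>\<theta>\<close>; it is positive
for \<open>s > 0\<close> because \<open>s\<close> and \<open>1\<close> are.\<close>

lemma smooth_truncation:
  assumes "0 < \<theta>"
  obtains E :: "real \<Rightarrow> real" where "C_infty UNIV E"
    "\<And>s. s \<le> \<theta>/2 \<Longrightarrow> E s = s" "\<And>s. \<theta> \<le> s \<Longrightarrow> E s = 1" "\<And>s. E s \<le> 0 \<longleftrightarrow> s \<le> 0"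
proof -
  define l where "l s = flat_exp 0 (s - \<theta>/2)" for s
  define r where "r s = flat_exp 0 (\<theta> - s)" for s
  define E where "E s = (l s + s * r s) * inverse (l s + r s)" for s
  have pos: "flat_exp 0 s > 0 \<longleftrightarrow> s > 0" "flat_exp 0 s \<ge> 0" "flat_exp 0 s = 0 \<longleftrightarrow> s \<le> 0" for s
    by (auto simp: flat_exp_def)
  have D: "l s + r s > 0" for s
    using assms pos[of "s - \<theta>/2"] pos[of "\<theta> - s"] unfolding l_def r_def by (cases "s < \<theta>") linarith+
  have "C_upto k UNIV E" for k
  proof -
    have ll: "C_upto k UNIV l"
      unfolding l_def by (rule C_upto_compose[OF _ _ C_upto_flat_exp])
         (auto intro!: C_upto_diff C_upto_id C_upto_const)
    have rr: "C_upto k UNIV r"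
      unfolding r_def by (rule C_upto_compose[OF _ _ C_upto_flat_exp])
         (auto intro!: C_upto_diff C_upto_id C_upto_const)
    have "C_upto k UNIV (\<lambda>s. inverse (l s + r s))"
      by (rule C_upto_compose[OF _ _ C_upto_inverse])
         (use D in \<open>auto intro!: C_upto_add ll rr, metis less_irrefl\<close>)
    then show ?thesis
      unfolding E_def by (intro C_upto_mult C_upto_add ll rr C_upto_id open_UNIV)
  qed
  then have 1: "C_infty UNIV E" by (simp add: C_infty_iff)
  have 2: "E s = s" if "s \<le> \<theta>/2" for s
    using that D[of s] pos[of "s - \<theta>/2"] by (simp add: E_def l_def field_simps)
  have 3: "E s = 1" if "\<theta> \<le> s" for s
    using that D[of s] pos[of "\<theta> - s"] by (simp add: E_def r_def field_simps)
  have 4: "E s \<le> 0 \<longleftrightarrow> s \<le> 0" for s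
  proof (cases "s \<le> \<theta>/2")
    case True then show ?thesis using 2 by simp
  next
    case False
    then have "l s > 0" "r s \<ge> 0" "s > 0" using pos assms unfolding l_def r_def by auto
    then have "E s > 0" using D[of s] unfolding E_def by (intro mult_pos_pos add_pos_nonneg) auto
    then show ?thesis using \<open>s > 0\<close> by auto
  qed
  show ?thesis using that 1 2 3 4 by blast
qed

lemma smooth_on_open_imp_C_infty:
  fixes f :: "'a::real_normed_vector \<Rightarrow> 'b::real_normed_vector"
  assumes "open S" "smooth_on S f"
  shows "C_infty S f"
  unfolding C_infty_def
proof (intro allI ballI)
  fix vs :: "'a list" and x assume "x \<in> S"
  then obtain W F where "open W \<and> x \<in> W \<and>
      (\<forall>vs. \<forall>y\<in>W. iter_deriv vs F differentiable (at y)) \<and> (\<forall>y\<in>W \<inter> S. F y = f y)"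
    by (rule bspec[OF assms(2)[unfolded smooth_on_def], elim_format]) (elim exE)
  then have W: "open W" "x \<in> W" "\<And>vs y. y \<in> W \<Longrightarrow> iter_deriv vs F differentiable (at y)"
    "\<And>y. y \<in> W \<inter> S \<Longrightarrow> F y = f y"
    by simp_all
  have "C_upto (length vs) (W \<inter> S) F"
    using W(3) by (auto simp: C_upto_def)
  then have "C_upto (length vs) (W \<inter> S) f"
    by (rule C_upto_cong[rotated 2]) (use W assms(1) in auto)
  then show "iter_deriv vs f differentiable (at x)"
    using W(2) \<open>x \<in> S\<close> by (auto simp: C_upto_def)
qed

lemma C_infty_differentiable: "C_infty W F \<Longrightarrow> y \<in> W \<Longrightarrow> iter_deriv vs F differentiable (at y)"
  by (auto simp: C_infty_def)

lemma C_infty_iter_deriv: "C_infty W F \<Longrightarrow> C_infty W (iter_deriv vs F)"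
  unfolding C_infty_def by (simp add: iter_deriv_append[symmetric])

lemma C_infty_continuous_on: "C_infty W F \<Longrightarrow> continuous_on W (iter_deriv vs F)"
  by (meson C_infty_differentiable continuous_at_imp_continuous_on differentiable_imp_continuous_within)

lemma C_infty_continuous_on0: "C_infty W F \<Longrightarrow> continuous_on W F"
  using C_infty_continuous_on[of W F "[]"] by simp

lemma C_infty_has_derivative:
  "C_infty W F \<Longrightarrow> y \<in> W \<Longrightarrow> (F has_derivative frechet_derivative F (at y)) (at y)"
  using C_infty_differentiable[of W F y "[]"] frechet_derivative_works by auto

lemma iter_deriv_add:
  assumes "open W" "C_infty W f" "C_infty W g" "y \<in> W"
  shows "iter_deriv vs (\<lambda>x. f x + g x) y = iter_deriv vs f y + iter_deriv vs g y"
  using assms(4)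
proof (induction vs arbitrary: y)
  case (Cons v vs)
  have "((\<lambda>x. iter_deriv vs f x + iter_deriv vs g x) has_derivative
     (\<lambda>v. iter_deriv (v # vs) f y + iter_deriv (v # vs) g y)) (at y)"
    using C_infty_has_derivative[OF C_infty_iter_deriv[OF assms(2)] Cons.prems]
      C_infty_has_derivative[OF C_infty_iter_deriv[OF assms(3)] Cons.prems]
    by (auto intro: has_derivative_add)
  then have "(iter_deriv vs (\<lambda>x. f x + g x) has_derivative
     (\<lambda>v. iter_deriv (v # vs) f y + iter_deriv (v # vs) g y)) (at y)"
    by (rule has_derivative_transform_within_open[OF _ assms(1) Cons.prems]) (simp add: Cons.IH)
  from frechet_derivative_at[OF this, symmetric] show ?case by simp
qed simp

lemma C_infty_add: "open W \<Longrightarrow> C_infty W f \<Longrightarrow> C_infty W g \<Longrightarrow> C_infty W (\<lambda>x. f x + g x)"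
  by (simp add: C_infty_iff C_upto_add)

lemma C_infty_subset: "C_infty W F \<Longrightarrow> V \<subseteq> W \<Longrightarrow> C_infty V F"
  by (auto simp: C_infty_def)

lemma C_infty_slice_has_derivative:
  assumes "C_infty W F" "(z, b) \<in> W"
  shows "((\<lambda>y. F (y, b)) has_derivative (\<lambda>v. frechet_derivative F (at (z, b)) (v, 0))) (at z)"
proof -
  have "((\<lambda>y. (y, b)) has_derivative (\<lambda>v. (v, 0))) (at z)" by (auto intro!: derivative_eq_intros)
  from has_derivative_compose[OF this C_infty_has_derivative[OF assms]] show ?thesis .
qed

lemma linear_axis_expansion:
  fixes h :: "real ^ 'n \<Rightarrow> real"
  assumes "linear h"
  shows "h v = (\<Sum>i\<in>UNIV. v $ i * h (axis i 1))"
proof -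
  have "v = (\<Sum>i\<in>UNIV. v $ i *\<^sub>R axis i 1)"
    by (simp add: basis_expansion[symmetric] scalar_mult_eq_scaleR[symmetric])
  then have "h v = h (\<Sum>i\<in>UNIV. v $ i *\<^sub>R axis i 1)" by simp
  also have "\<dots> = (\<Sum>i\<in>UNIV. v $ i * h (axis i 1))"
    by (simp only: linear_sum[OF assms] linear_scale[OF assms] real_scaleR_def)
  finally show ?thesis .
qed

lemma compact_closed_preimage:
  fixes h :: "'b::t2_space \<Rightarrow> 'c::topological_space"
  assumes "compact X" "continuous_on X h" "closed S"
  shows "compact (X \<inter> h -` S)"
proof -
  have "closed (X \<inter> h -` S)"
    by (rule continuous_closed_preimage[OF assms(2) compact_imp_closed[OF assms(1)] assms(3)])
  then have "compact (X \<inter> (X \<inter> h -` S))" by (rule compact_Int_closed[OF assms(1)])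
  then show ?thesis by (simp add: Int_absorb1 Int_assoc[symmetric])
qed

text \<open>The usual way to obtain uniform constants below: a statement about the limit case of some
parameters is expressed as positivity of a maximum \<open>h\<close> of continuous functions on a compact set, and the
lower bound shows that it persists near the limit case.\<close>

lemma compact_positive_bound:
  fixes h :: "'b::topological_space \<Rightarrow> real"
  assumes "compact X" "continuous_on X h" "\<And>x. x \<in> X \<Longrightarrow> h x > 0"
  obtains \<epsilon> where "\<epsilon> > 0" "\<And>x. x \<in> X \<Longrightarrow> \<epsilon> \<le> h x"
proof (cases "X = {}")
  case True then show ?thesis using that[of 1] by auto
next
  case False
  then obtain x where "x \<in> X" "\<forall>y\<in>X. h x \<le> h y"
    using continuous_attains_inf[OF assms(1) _ assms(2)] by blast
  then show ?thesis using that[of "h x"] assms(3) by auto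
qed

section \<open>Charts and Riemannian metrics\<close>

locale manifold =
  fixes A :: "('a::{t2_space, second_countable_topology}, 'n::finite) chart set"
  assumes atlas: "smooth_atlas A"
begin

lemma open_chart_dom: "c \<in> A \<Longrightarrow> open (chart_dom c)"
  and open_chart_img: "c \<in> A \<Longrightarrow> open (chart_img c)"
  and chart_homeo: "c \<in> A \<Longrightarrow> homeomorphism (chart_dom c) (chart_img c) (coord c) (chart_inv c)"
  using atlas by (simp_all add: smooth_atlas_def)

lemma chart_cover: obtains c where "c \<in> A" "x \<in> chart_dom c"
proof -
  have "x \<in> (\<Union>c\<in>A. chart_dom c)" using atlas by (simp add: smooth_atlas_def)
  then show ?thesis using that by blast
qed

lemma chart_inv_coord [simp]: "c \<in> A \<Longrightarrow> x \<in> chart_dom c \<Longrightarrow> chart_inv c (coord c x) = x"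
  and coord_chart_inv [simp]: "c \<in> A \<Longrightarrow> z \<in> chart_img c \<Longrightarrow> coord c (chart_inv c z) = z"
  and continuous_on_coord: "c \<in> A \<Longrightarrow> continuous_on (chart_dom c) (coord c)"
  and continuous_on_chart_inv: "c \<in> A \<Longrightarrow> continuous_on (chart_img c) (chart_inv c)"
  using chart_homeo[of c] by (auto simp: homeomorphism_def)

lemma chart_inv_in_dom [simp]: "c \<in> A \<Longrightarrow> z \<in> chart_img c \<Longrightarrow> chart_inv c z \<in> chart_dom c"
  using chart_homeo[of c] by (auto simp: homeomorphism_def)

lemma open_coord_image:
  assumes "c \<in> A" "open U" shows "open (coord c ` (U \<inter> chart_dom c))"
proof -
  have "openin (top_of_set (chart_img c)) (coord c ` (U \<inter> chart_dom c))"
    by (rule homeomorphism_imp_open_map[OF chart_homeo[OF assms(1)]])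
       (use assms in \<open>auto simp: openin_open\<close>)
  then show ?thesis using open_chart_img[OF assms(1)] openin_open_trans by blast
qed

lemma open_chart_inv_image:
  assumes "c \<in> A" "open V" "V \<subseteq> chart_img c" shows "open (chart_inv c ` V)"
proof -
  have "homeomorphism (chart_img c) (chart_dom c) (chart_inv c) (coord c)"
    using chart_homeo[OF assms(1)] homeomorphism_sym by blast
  then have "openin (top_of_set (chart_dom c)) (chart_inv c ` V)"
    by (rule homeomorphism_imp_open_map)
       (use assms in \<open>auto simp: openin_open\<close>)
  then show ?thesis using open_chart_dom[OF assms(1)] openin_open_trans by blast
qed

lemma compact_chart_inv_image:
  assumes "c \<in> A" "compact B" "B \<subseteq> chart_img c" shows "compact (chart_inv c ` B)"
  by (rule compact_continuous_image[OF continuous_on_subset[OF continuous_on_chart_inv]]) fact+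

lemma open_transition_dom:
  "c \<in> A \<Longrightarrow> c' \<in> A \<Longrightarrow> open (coord c ` (chart_dom c \<inter> chart_dom c'))"
  using open_coord_image[of c "chart_dom c'"] open_chart_dom by (simp add: Int_commute)

lemma transition_C_infty:
  assumes "c \<in> A" "c' \<in> A"
  shows "C_infty (coord c ` (chart_dom c \<inter> chart_dom c')) (coord c' \<circ> chart_inv c)"
  by (rule smooth_on_open_imp_C_infty[OF open_transition_dom[OF assms]])
     (use atlas assms in \<open>unfold smooth_atlas_def, blast\<close>)

lemma in_transition_dom:
  "c \<in> A \<Longrightarrow> z \<in> coord c ` (chart_dom c \<inter> chart_dom c') \<longleftrightarrow>
     z \<in> chart_img c \<and> chart_inv c z \<in> chart_dom c'"
  by auto

end

definition metric_matrix :: "'n::finite coord_metric \<Rightarrow> real ^ 'n \<Rightarrow> real ^ 'n ^ 'n" where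
  "metric_matrix G z = (\<chi> i j. G z (axis i 1) (axis j 1))"

lemma bilinear_metric_matrix:
  fixes G :: "'n::finite coord_metric"
  assumes "bilinear (G z)"
  shows "G z v w = (\<Sum>i\<in>UNIV. \<Sum>j\<in>UNIV. v $ i * (w $ j * metric_matrix G z $ i $ j))"
proof -
  have l1: "linear (\<lambda>v. G z v w)" for w using assms by (simp add: bilinear_def)
  have l2: "linear (\<lambda>w. G z v w)" for v using assms by (simp add: bilinear_def)
  have "G z v w = (\<Sum>i\<in>UNIV. v $ i * G z (axis i 1) w)"
    by (rule linear_axis_expansion[OF l1])
  also have "\<dots> = (\<Sum>i\<in>UNIV. v $ i * (\<Sum>j\<in>UNIV. w $ j * G z (axis i 1) (axis j 1)))"
    by (intro sum.cong refl arg_cong2[where f = "(*)"] linear_axis_expansion[OF l2])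
  finally show ?thesis by (simp add: metric_matrix_def sum_distrib_left)
qed

locale riemannian = manifold A
  for A :: "('a::{t2_space, second_countable_topology}, 'n::finite) chart set" +
  fixes g :: "('a, 'n) metric_field"
  assumes metric: "riemannian_metric A g"
begin

lemma metric_bilinear: "c \<in> A \<Longrightarrow> z \<in> chart_img c \<Longrightarrow> bilinear (g c z)"
  and metric_sym: "c \<in> A \<Longrightarrow> z \<in> chart_img c \<Longrightarrow> g c z v w = g c z w v"
  and metric_pos: "c \<in> A \<Longrightarrow> z \<in> chart_img c \<Longrightarrow> v \<noteq> 0 \<Longrightarrow> g c z v v > 0"
  using metric unfolding riemannian_metric_def by blast+

lemma metric_C_infty: "c \<in> A \<Longrightarrow> C_infty (chart_img c) (\<lambda>z. g c z v w)"
  using metric open_chart_img smooth_on_open_imp_C_infty unfolding riemannian_metric_def by blast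

lemma metric_transform:
  assumes "c \<in> A" "c' \<in> A" "x \<in> chart_dom c \<inter> chart_dom c'"
  shows "g c' (coord c' x)
      (frechet_derivative (coord c' \<circ> chart_inv c) (at (coord c x)) v)
      (frechet_derivative (coord c' \<circ> chart_inv c) (at (coord c x)) w) = g c (coord c x) v w"
  using metric assms unfolding riemannian_metric_def Let_def by blast

lemma metric_scale: "c \<in> A \<Longrightarrow> z \<in> chart_img c \<Longrightarrow> g c z (r *\<^sub>R v) (r *\<^sub>R v) = r\<^sup>2 * g c z v v"
  using metric_bilinear[of c z] by (simp add: bilinear_lmul bilinear_rmul power2_eq_square)

lemma metric_zero: "c \<in> A \<Longrightarrow> z \<in> chart_img c \<Longrightarrow> g c z 0 0 = 0"
  using metric_bilinear[of c z] by (simp add: bilinear_lzero)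

lemma metric_continuous:
  assumes "c \<in> A"
  shows "continuous_on (chart_img c \<times> UNIV) (\<lambda>p. g c (fst p) (snd p) (snd p))"
proof -
  have "continuous_on (chart_img c \<times> UNIV) (\<lambda>p. g c (fst p) (axis i 1) (axis j 1))" for i j
    by (rule continuous_on_compose2[OF C_infty_continuous_on0[OF metric_C_infty[OF assms]]])
       (auto intro!: continuous_intros)
  then have "continuous_on (chart_img c \<times> UNIV)
     (\<lambda>p. \<Sum>i\<in>UNIV. \<Sum>j\<in>UNIV. snd p $ i * (snd p $ j * metric_matrix (g c) (fst p) $ i $ j))"
    by (auto intro!: continuous_intros simp: metric_matrix_def)
  moreover have "(\<Sum>i\<in>UNIV. \<Sum>j\<in>UNIV. snd p $ i * (snd p $ j * metric_matrix (g c) (fst p) $ i $ j))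
      = g c (fst p) (snd p) (snd p)" if "p \<in> chart_img c \<times> UNIV" for p
  proof -
    have "fst p \<in> chart_img c" using that by (metis mem_Times_iff)
    from bilinear_metric_matrix[where G = "g c", OF metric_bilinear[OF assms this]]
    show ?thesis by (rule sym)
  qed
  ultimately show ?thesis
    by (rule continuous_on_cong[THEN iffD1, OF refl, rotated])
qed

text \<open>By homogeneity it suffices to bound the length of Euclidean unit vectors, and these form a compact
set over \<open>B\<close>.\<close>

lemma metric_bounds:
  assumes "c \<in> A" "compact B" "B \<subseteq> chart_img c"
  obtains m M where "0 < m" "0 \<le> M"
    "\<And>z v. z \<in> B \<Longrightarrow> m * norm v \<le> sqrt (g c z v v)"
    "\<And>z v. z \<in> B \<Longrightarrow> sqrt (g c z v v) \<le> M * norm v"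
proof -
  define h where "h p = sqrt (g c (fst p) (snd p) (snd p))" for p
  let ?X = "B \<times> sphere (0 :: real ^ 'n) 1"
  have X: "compact ?X" using assms(2) by (simp add: compact_Times)
  have h: "continuous_on ?X h"
    unfolding h_def using assms(3)
    by (intro continuous_on_real_sqrt continuous_on_subset[OF metric_continuous[OF assms(1)]]) auto
  have "h p > 0" if "p \<in> ?X" for p
    unfolding h_def using that assms(3) by (auto intro!: metric_pos[OF assms(1)])
  with X h obtain m where m: "m > 0" "\<And>p. p \<in> ?X \<Longrightarrow> m \<le> h p"
    using compact_positive_bound by blast
  have "bounded (h ` ?X)" using X h compact_continuous_image compact_imp_bounded by blast
  then obtain M where M: "M > 0" "\<And>p. p \<in> ?X \<Longrightarrow> \<bar>h p\<bar> \<le> M"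
    unfolding bounded_pos by auto
  have scale: "sqrt (g c z v v) = norm v * h (z, v /\<^sub>R norm v)" if "z \<in> B" "v \<noteq> 0" for z v
    using that assms(3) metric_scale[OF assms(1), of z "norm v" "v /\<^sub>R norm v"]
    by (auto simp: h_def real_sqrt_mult subset_iff)
  show ?thesis
  proof
    fix z v assume z: "z \<in> B"
    show "m * norm v \<le> sqrt (g c z v v)" 
    proof (cases "v = 0")
      case False
      then show ?thesis using m(2)[of "(z, v /\<^sub>R norm v)"] z
        by (simp add: scale mult.commute)
    qed (use metric_zero[OF assms(1)] z assms(3) in auto)
    show "sqrt (g c z v v) \<le> M * norm v"
    proof (cases "v = 0")
      case False
      then show ?thesis using M(2)[of "(z, v /\<^sub>R norm v)"] z
        by (simp add: scale mult.commute)
    qed (use metric_zero[OF assms(1)] z assms(3) in auto)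
  qed (use m M in auto)
qed

text \<open>The chart in the definition of the speed is an arbitrary one; the transformation law
of the metric and the chain rule for the transition map allow any chart to be used instead.\<close>

lemma speed_in_chart:
  assumes c: "c \<in> A" "\<gamma> s \<in> chart_dom c" and cont: "isCont \<gamma> s"
    and der: "((coord c \<circ> \<gamma>) has_vector_derivative v) (at s)"
  shows "speed A g \<gamma> s = sqrt (g c (coord c (\<gamma> s)) v v)"
proof -
  define c' where "c' = (SOME c. c \<in> A \<and> \<gamma> s \<in> chart_dom c)"
  have c': "c' \<in> A" "\<gamma> s \<in> chart_dom c'"
    using someI_ex[of "\<lambda>c. c \<in> A \<and> \<gamma> s \<in> chart_dom c"] c unfolding c'_def by blast+
  let ?T = "coord c' \<circ> chart_inv c"
  let ?D = "frechet_derivative ?T (at (coord c (\<gamma> s)))"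
  have "coord c (\<gamma> s) \<in> coord c ` (chart_dom c \<inter> chart_dom c')"
    using c(2) c'(2) by blast
  from C_infty_has_derivative[OF transition_C_infty[OF c(1) c'(1)] this]
  have "(?T has_derivative ?D) (at ((coord c \<circ> \<gamma>) s))"
    unfolding comp_apply[of "coord c" \<gamma> s] .
  then have "((?T \<circ> (coord c \<circ> \<gamma>)) has_vector_derivative ?D v) (at s)"
    by (rule vector_derivative_diff_chain_within[OF der has_derivative_at_withinI])
  moreover have "open (chart_dom c)" using open_chart_dom c by blast
  then have "eventually (\<lambda>r. \<gamma> r \<in> chart_dom c) (nhds s)"
    using topological_tendstoD[OF cont[unfolded isCont_def tendsto_at_iff_tendsto_nhds]] c(2) by blast
  then obtain O' where "open O'" "s \<in> O'" "\<And>r. r \<in> O' \<Longrightarrow> \<gamma> r \<in> chart_dom c"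
    unfolding eventually_nhds by blast
  ultimately have "((coord c' \<circ> \<gamma>) has_vector_derivative ?D v) (at s)"
    using c(1) by (elim has_vector_derivative_transform_within_open[of _ _ _ O']) auto
  then have "vector_derivative (coord c' \<circ> \<gamma>) (at s) = ?D v"
    by (rule vector_derivative_at)
  then have "speed A g \<gamma> s = sqrt (g c' (coord c' (\<gamma> s)) (?D v) (?D v))"
    by (simp add: speed_def Let_def c'_def[symmetric])
  then show ?thesis
    using metric_transform[OF c(1) c'(1), of "\<gamma> s"] c c' by simp
qed

end

section \<open>The Riemannian distance induces the topology of the manifold\<close>

text \<open>The derivative of a piecewise \<open>C\<^sup>1\<close> curve has a gauge integral by the fundamental theorem of calculus,
but it may be unbounded near the exceptional points.  If its norm has a finite Lebesgue integral, the two
integrals agree and the bound is the triangle inequality; otherwise the right-hand side is infinite.\<close>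

lemma has_integral_norm_le_nn_integral:
  fixes f :: "real \<Rightarrow> 'b::euclidean_space"
  assumes f: "(f has_integral I) S"
  shows "ennreal (norm I) \<le> (\<integral>\<^sup>+ s\<in>S. ennreal (norm (f s)) \<partial>lborel)"
proof -
  let ?f = "\<lambda>s. indicator S s *\<^sub>R f s"
  have eq: "(\<integral>\<^sup>+ s\<in>S. ennreal (norm (f s)) \<partial>lborel) = (\<integral>\<^sup>+ s. ennreal (norm (?f s)) \<partial>lebesgue)"
    unfolding nn_integral_completion by (intro nn_integral_cong) (simp add: indicator_def)
  have meas: "?f \<in> borel_measurable lebesgue"
    by (rule has_integral_implies_lebesgue_measurable[OF f])
  show ?thesis
  proof (cases "(\<integral>\<^sup>+ s. ennreal (norm (?f s)) \<partial>lebesgue) < \<infinity>")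
    case False
    then show ?thesis unfolding eq by (simp add: less_top[symmetric])
  next
    case True
    then have int: "integrable lebesgue ?f"
      using meas by (simp add: integrable_iff_bounded)
    then have "(f has_integral (LINT s:S|lebesgue. f s)) S"
      by (intro has_integral_set_lebesgue) (simp add: set_integrable_def)
    then have "I = integral\<^sup>L lebesgue ?f"
      using f has_integral_unique by (metis set_lebesgue_integral_def)
    then show ?thesis
      unfolding eq using integral_norm_bound_ennreal[OF int] by simp
  qed
qed

context riemannian
begin

text \<open>Up to the first time \<open>T\<close> at which the curve leaves the coordinate ball it stays in the chart, where its
speed is at least \<open>m\<close> times the Euclidean speed; and the coordinates at time \<open>T\<close> have distance at least \<open>\<rho>\<close>
from the centre.\<close>

lemma curve_length_lower_bound:
  assumes c: "c \<in> A" and x: "x \<in> chart_dom c" and \<rho>: "\<rho> > 0"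
    and B: "cball (coord c x) \<rho> \<subseteq> chart_img c"
    and m: "m > 0" "\<And>z v. z \<in> cball (coord c x) \<rho> \<Longrightarrow> m * norm v \<le> sqrt (g c z v v)"
    and \<gamma>: "piecewise_C1_curve A \<gamma>" "\<gamma> 0 = x" "\<gamma> 1 \<notin> chart_inv c ` ball (coord c x) \<rho>"
  shows "ennreal (m * \<rho>) \<le> curve_length A g \<gamma>"
proof -
  define z0 where "z0 = coord c x"
  define P where "P = chart_inv c ` ball z0 \<rho>"
  define Q where "Q = chart_inv c ` cball z0 \<rho>"
  define S where "S = {0..1} \<inter> \<gamma> -` (- P)"
  define T where "T = Inf S"
  define \<sigma> where "\<sigma> = coord c \<circ> \<gamma>"
  have ballB: "ball z0 \<rho> \<subseteq> chart_img c" "cball z0 \<rho> \<subseteq> chart_img c"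
    using B ball_subset_cball unfolding z0_def by blast+
  have "open P" unfolding P_def using open_chart_inv_image[OF c open_ball ballB(1)] .
  have "compact Q" unfolding Q_def using compact_chart_inv_image[OF c compact_cball ballB(2)] .
  have Qdom: "Q \<subseteq> chart_dom c" using ballB(2) chart_inv_in_dom[OF c] unfolding Q_def by blast
  have PQ: "P \<subseteq> Q" unfolding P_def Q_def using ball_subset_cball by blast
  have cont: "continuous_on {0..1} \<gamma>"
    using \<gamma>(1) by (simp add: piecewise_C1_curve_def path_def)
  have "x \<in> P"
    using \<rho> chart_inv_coord[OF c x] unfolding P_def z0_def
    by (metis centre_in_ball imageI)
  have "closed S"
    unfolding S_def by (rule continuous_closed_preimage[OF cont]) (use \<open>open P\<close> in auto)
  moreover have "1 \<in> S" using \<gamma>(3) by (simp add: S_def P_def z0_def)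
  moreover have "bdd_below S" unfolding S_def by (auto intro!: bdd_belowI[of _ 0])
  ultimately have "T \<in> S" unfolding T_def using closed_contains_Inf by blast
  then have T01: "0 \<le> T" "T \<le> 1" and TP: "\<gamma> T \<notin> P" by (auto simp: S_def)
  have "T \<noteq> 0" using TP \<gamma>(2) \<open>x \<in> P\<close> by auto
  then have "0 < T" using T01 by simp
  have before: "\<gamma> s \<in> P" if "0 \<le> s" "s < T" for s
  proof (rule ccontr)
    assume "\<gamma> s \<notin> P"
    then have "s \<in> S" using that T01 by (simp add: S_def)
    then have "T \<le> s" unfolding T_def using \<open>bdd_below S\<close> by (rule cInf_lower)
    then show False using that by simp
  qed
  have cl: "closure {0..<T} = {0..T}" using \<open>0 < T\<close> by simp
  have sub: "{0..T} \<subseteq> {0..1}" using T01 by auto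
  have "\<gamma> ` closure {0..<T} \<subseteq> Q"
  proof (rule image_closure_subset)
    show "continuous_on (closure {0..<T}) \<gamma>"
      unfolding cl using continuous_on_subset[OF cont sub] .
    show "closed Q" using \<open>compact Q\<close> by (rule compact_imp_closed)
    show "\<gamma> ` {0..<T} \<subseteq> Q" using before PQ by auto
  qed
  then have inQ: "\<gamma> s \<in> Q" if "s \<in> {0..T}" for s using that unfolding cl by blast
  have \<sigma>B: "\<sigma> s \<in> cball z0 \<rho>" if "s \<in> {0..T}" for s
  proof -
    obtain z where z: "z \<in> cball z0 \<rho>" "\<gamma> s = chart_inv c z"
      using inQ \<open>s \<in> {0..T}\<close> unfolding Q_def by blast
    then show ?thesis using coord_chart_inv[OF c] ballB(2) by (auto simp: \<sigma>_def)
  qed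
  have far: "\<rho> \<le> norm (\<sigma> T - \<sigma> 0)"
  proof (rule ccontr)
    assume "\<not> ?thesis"
    then have "\<sigma> T \<in> ball z0 \<rho>"
      by (simp add: \<sigma>_def \<gamma>(2) z0_def dist_norm norm_minus_commute)
    moreover have "\<gamma> T \<in> chart_dom c" using inQ[of T] T01 Qdom by auto
    then have "\<gamma> T = chart_inv c (\<sigma> T)" using chart_inv_coord[OF c] by (simp add: \<sigma>_def)
    ultimately show False using TP unfolding P_def by blast
  qed
  have "\<sigma> piecewise_C1_differentiable_on {0..T}"
    using \<gamma>(1) c T01 inQ Qdom unfolding piecewise_C1_curve_def \<sigma>_def by blast
  then obtain S0 D where S0: "continuous_on {0..T} \<sigma>" "finite S0"
    "\<And>s. s \<in> {0..T} - S0 \<Longrightarrow> (\<sigma> has_vector_derivative D s) (at s)"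
    unfolding piecewise_C1_differentiable_on_def C1_differentiable_on_def by metis
  have "(D has_integral (\<sigma> T - \<sigma> 0)) {0..T}"
    by (rule fundamental_theorem_of_calculus_interior_strong[OF S0(2) T01(1) S0(3) S0(1)]) auto
  then have "((\<lambda>s. m *\<^sub>R D s) has_integral m *\<^sub>R (\<sigma> T - \<sigma> 0)) {0..T}"
    by (rule has_integral_cmul)
  from has_integral_norm_le_nn_integral[OF this]
  have "ennreal (m * norm (\<sigma> T - \<sigma> 0)) \<le> (\<integral>\<^sup>+ s\<in>{0..T}. ennreal (m * norm (D s)) \<partial>lborel)"
    using m(1) by simp
  also have "\<dots> \<le> curve_length A g \<gamma>"
    unfolding curve_length_def
  proof (rule nn_integral_mono_AE)
    have "AE s in lborel. s \<notin> S0 \<union> {0, T}"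
      by (rule AE_not_in) (use S0(2) in \<open>auto intro!: finite_imp_null_set_lborel\<close>)
    then show "AE s in lborel. ennreal (m * norm (D s)) * indicator {0..T} s
        \<le> ennreal (speed A g \<gamma> s) * indicator {0..1} s"
    proof (rule eventually_mono)
      fix s assume s: "s \<notin> S0 \<union> {0, T}"
      show "ennreal (m * norm (D s)) * indicator {0..T} s
        \<le> ennreal (speed A g \<gamma> s) * indicator {0..1} s"
      proof (cases "s \<in> {0..T}")
        case True
        then have s': "0 < s" "s < 1" "s \<in> {0..T} - S0" using s T01 by auto
        have "isCont \<gamma> s"
          using cont s' continuous_on_interior[of "{0..1}" \<gamma> s] by simp
        then have "speed A g \<gamma> s = sqrt (g c (coord c (\<gamma> s)) (D s) (D s))"
          using S0(3)[OF s'(3)] inQ[OF True] Qdom unfolding \<sigma>_def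
          by (intro speed_in_chart c) auto
        moreover have "m * norm (D s) \<le> sqrt (g c (coord c (\<gamma> s)) (D s) (D s))"
          using m(2)[of "\<sigma> s" "D s"] \<sigma>B[OF True] by (simp add: \<sigma>_def z0_def)
        ultimately show ?thesis using True s' by (simp add: ennreal_leI)
      qed simp
    qed
  qed
  finally have "ennreal (m * norm (\<sigma> T - \<sigma> 0)) \<le> curve_length A g \<gamma>" .
  moreover have "ennreal (m * \<rho>) \<le> ennreal (m * norm (\<sigma> T - \<sigma> 0))"
    using far m(1) by (intro ennreal_leI mult_left_mono) auto
  ultimately show ?thesis by (rule order_trans[rotated])
qed

lemma chart_cball:
  assumes "c \<in> A" "x \<in> chart_dom c" "open U" "x \<in> U"
  obtains \<rho> where "\<rho> > 0" "cball (coord c x) \<rho> \<subseteq> coord c ` (U \<inter> chart_dom c)"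
  using open_contains_cball[of "coord c ` (U \<inter> chart_dom c)"] open_coord_image[OF assms(1,3)] assms
  by (metis IntI imageI)

lemma riemannian_dist_small_imp_near:
  assumes "open U" "x \<in> U"
  obtains \<epsilon> where "\<epsilon> > 0" "\<And>y. riemannian_dist A g x y < ennreal \<epsilon> \<Longrightarrow> y \<in> U"
proof -
  obtain c where c: "c \<in> A" "x \<in> chart_dom c" by (rule chart_cover)
  obtain \<rho> where \<rho>: "\<rho> > 0" "cball (coord c x) \<rho> \<subseteq> coord c ` (U \<inter> chart_dom c)"
    by (rule chart_cball[OF c assms])
  then have B: "cball (coord c x) \<rho> \<subseteq> chart_img c" by blast
  obtain m M where m: "m > 0" "\<And>z v. z \<in> cball (coord c x) \<rho> \<Longrightarrow> m * norm v \<le> sqrt (g c z v v)"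
    by (rule metric_bounds[OF c(1) compact_cball B]) blast
  show ?thesis
  proof
    show "m * \<rho> > 0" using m(1) \<rho>(1) by simp
    fix y assume d: "riemannian_dist A g x y < ennreal (m * \<rho>)"
    then obtain \<gamma> where \<gamma>: "piecewise_C1_curve A \<gamma>" "\<gamma> 0 = x" "\<gamma> 1 = y"
      "curve_length A g \<gamma> < ennreal (m * \<rho>)"
      unfolding riemannian_dist_def INF_less_iff by (auto simp: pathstart_def pathfinish_def)
    then have "y \<in> chart_inv c ` ball (coord c x) \<rho>"
      using curve_length_lower_bound[OF c \<rho>(1) B m \<gamma>(1,2)] by (meson not_le)
    then obtain z where z: "z \<in> cball (coord c x) \<rho>" "y = chart_inv c z"
      using ball_subset_cball by blast
    then obtain u where "u \<in> U" "u \<in> chart_dom c" "z = coord c u" using \<rho>(2) by blast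
    then show "y \<in> U" using z(2) chart_inv_coord[OF c(1)] by simp
  qed
qed

text \<open>The curve with the coordinates of a straight segment competes in the infimum that defines the distance.\<close>

lemma chart_segment:
  assumes c: "c \<in> A" and x: "x \<in> chart_dom c"
    and seg: "closed_segment (coord c x) z \<subseteq> chart_img c"
    and M: "0 \<le> M" "\<And>y v. y \<in> closed_segment (coord c x) z \<Longrightarrow> sqrt (g c y v v) \<le> M * norm v"
  shows "riemannian_dist A g x (chart_inv c z) \<le> ennreal (M * norm (z - coord c x))"
proof -
  define z0 where "z0 = coord c x"
  define l where "l r = z0 + r *\<^sub>R (z - z0)" for r :: real
  define \<gamma> where "\<gamma> = chart_inv c \<circ> l"
  have lseg: "l r \<in> closed_segment z0 z" if "r \<in> {0..1}" for r
    using that unfolding closed_segment_def l_def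
    by (auto intro!: exI[of _ r] simp: algebra_simps)
  have limg: "l r \<in> chart_img c" if "r \<in> {0..1}" for r
    using lseg[OF that] seg unfolding z0_def by blast
  have lcont: "continuous_on X l" for X unfolding l_def by (intro continuous_intros)
  have lder: "(l has_vector_derivative (z - z0)) (at r)" for r
    unfolding l_def by (auto intro!: derivative_eq_intros)
  have opn: "open (l -` chart_img c)"
    by (rule open_vimage[OF open_chart_img[OF c] lcont])
  have \<gamma>cont: "continuous_on (l -` chart_img c) \<gamma>"
    unfolding \<gamma>_def by (intro continuous_on_compose lcont continuous_on_subset[OF continuous_on_chart_inv[OF c]]) auto
  have "path \<gamma>"
    unfolding path_def using limg by (intro continuous_on_subset[OF \<gamma>cont]) auto
  have "piecewise_C1_curve A \<gamma>"
    unfolding piecewise_C1_curve_def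
  proof (intro conjI ballI allI impI \<open>path \<gamma>\<close>)
    fix c' s t assume c': "c' \<in> A" and st: "0 \<le> s \<and> s \<le> t \<and> t \<le> 1 \<and> \<gamma> ` {s..t} \<subseteq> chart_dom c'"
    define T where "T = coord c' \<circ> chart_inv c"
    define V where "V = coord c ` (chart_dom c \<inter> chart_dom c')"
    have T: "C_infty V T" unfolding T_def V_def by (rule transition_C_infty[OF c c'])
    have lV: "l r \<in> V" if "r \<in> {s..t}" for r
    proof -
      have "r \<in> {0..1}" "\<gamma> r \<in> chart_dom c'" using st that by auto
      then show ?thesis
        unfolding V_def in_transition_dom[OF c] using limg[of r] by (simp only: \<gamma>_def comp_apply)
    qed
    have eq: "coord c' \<circ> \<gamma> = T \<circ> l" by (simp add: T_def \<gamma>_def comp_assoc)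
    have der: "((T \<circ> l) has_vector_derivative iter_deriv [z - z0] T (l r)) (at r)" if "r \<in> {s..t}" for r
      using vector_derivative_diff_chain_within[OF lder[of r] has_derivative_at_withinI[OF C_infty_has_derivative[OF T lV[OF that]]]]
      by simp
    have "(T \<circ> l) C1_differentiable_on {s..t}"
      unfolding C1_differentiable_on_def
    proof (intro exI conjI ballI)
      show "((T \<circ> l) has_vector_derivative (iter_deriv [z - z0] T \<circ> l) r) (at r)" if "r \<in> {s..t}" for r
        using der[OF that] by (simp only: comp_apply[of _ l r])
      show "continuous_on {s..t} (iter_deriv [z - z0] T \<circ> l)"
        by (intro continuous_on_compose lcont continuous_on_subset[OF C_infty_continuous_on[OF T]])
           (use lV in blast)
    qed
    then show "(coord c' \<circ> \<gamma>) piecewise_C1_differentiable_on {s..t}"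
      unfolding eq by (rule C1_differentiable_imp_piecewise)
  qed
  moreover have "\<gamma> 0 = x" "\<gamma> 1 = chart_inv c z"
    using chart_inv_coord[OF c x] by (simp_all add: \<gamma>_def l_def z0_def)
  ultimately have "riemannian_dist A g x (chart_inv c z) \<le> curve_length A g \<gamma>"
    unfolding riemannian_dist_def by (intro INF_lower) (simp add: pathstart_def pathfinish_def)
  also have "\<dots> \<le> (\<integral>\<^sup>+ s\<in>{0..1::real}. ennreal (M * norm (z - z0)) \<partial>lborel)"
    unfolding curve_length_def
  proof (intro nn_integral_mono)
    fix r :: real
    show "ennreal (speed A g \<gamma> r) * indicator {0..1} r \<le> ennreal (M * norm (z - z0)) * indicator {0..1} r"
    proof (cases "r \<in> {0..1}")
      case True
      have "isCont \<gamma> r"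
        using \<gamma>cont opn limg[OF True] by (simp add: continuous_on_eq_continuous_at)
      moreover have "((coord c \<circ> \<gamma>) has_vector_derivative (z - z0)) (at r)"
        by (rule has_vector_derivative_transform_within_open[OF lder opn])
           (use limg[OF True] coord_chart_inv[OF c] in \<open>auto simp: \<gamma>_def\<close>)
      moreover have "\<gamma> r \<in> chart_dom c" using chart_inv_in_dom[OF c limg[OF True]] by (simp add: \<gamma>_def)
      ultimately have "speed A g \<gamma> r = sqrt (g c (coord c (\<gamma> r)) (z - z0) (z - z0))"
        by (intro speed_in_chart c)
      also have "coord c (\<gamma> r) = l r" using coord_chart_inv[OF c limg[OF True]] by (simp add: \<gamma>_def)
      also have "sqrt (g c (l r) (z - z0) (z - z0)) \<le> M * norm (z - z0)"
        by (rule M(2)) (use lseg[OF True] in \<open>simp only: z0_def\<close>)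
      finally show ?thesis using True by (simp add: ennreal_leI)
    qed simp
  qed
  also have "\<dots> = ennreal (M * norm (z - z0))"
    by (simp add: nn_integral_cmult_indicator)
  finally show ?thesis by (simp add: z0_def)
qed

lemma near_imp_riemannian_dist_small:
  assumes "\<epsilon> > 0"
  obtains U where "open U" "x \<in> U" "\<And>y. y \<in> U \<Longrightarrow> riemannian_dist A g x y < ennreal \<epsilon>"
proof -
  obtain c where c: "c \<in> A" "x \<in> chart_dom c" by (rule chart_cover)
  obtain \<rho> where \<rho>: "\<rho> > 0" "cball (coord c x) \<rho> \<subseteq> coord c ` (UNIV \<inter> chart_dom c)"
    by (rule chart_cball[OF c open_UNIV UNIV_I])
  then have B: "cball (coord c x) \<rho> \<subseteq> chart_img c" by simp
  obtain M where M: "0 \<le> M" "\<And>z v. z \<in> cball (coord c x) \<rho> \<Longrightarrow> sqrt (g c z v v) \<le> M * norm v"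
    by (rule metric_bounds[OF c(1) compact_cball B]) blast
  define r where "r = min \<rho> (\<epsilon> / (M + 1))"
  have r: "r > 0" "r \<le> \<rho>" "r \<le> \<epsilon> / (M + 1)" using \<rho> assms M by (auto simp: r_def)
  have rB: "ball (coord c x) r \<subseteq> cball (coord c x) \<rho>" using r(2) by auto
  show ?thesis
  proof
    show "open (chart_inv c ` ball (coord c x) r)"
      using rB B by (intro open_chart_inv_image c open_ball) blast
    show "x \<in> chart_inv c ` ball (coord c x) r"
      using r(1) chart_inv_coord[OF c] by (metis centre_in_ball imageI)
    fix y assume "y \<in> chart_inv c ` ball (coord c x) r"
    then obtain z where z: "z \<in> ball (coord c x) r" "y = chart_inv c z" by blast
    have seg: "closed_segment (coord c x) z \<subseteq> cball (coord c x) \<rho>"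
      using z(1) rB \<rho>(1) by (intro closed_segment_subset convex_cball) auto
    have "riemannian_dist A g x y \<le> ennreal (M * norm (z - coord c x))"
      unfolding z(2) using seg B M by (intro chart_segment c) blast+
    also have "\<dots> < ennreal \<epsilon>"
    proof (rule ennreal_lessI[OF assms])
      have "norm (z - coord c x) < \<epsilon> / (M + 1)"
        using z(1) r(3) by (simp add: dist_norm norm_minus_commute)
      then have "(M + 1) * norm (z - coord c x) < \<epsilon>" using M(1) by (simp add: field_simps)
      then show "M * norm (z - coord c x) < \<epsilon>" by (simp add: algebra_simps) (smt (verit) norm_ge_zero)
    qed
    finally show "riemannian_dist A g x y < ennreal \<epsilon>" .
  qed
qed

lemma parabolic_dist_small_imp_near:
  assumes "open U" "p \<in> U"
  obtains \<epsilon> where "\<epsilon> > 0" "\<And>q. parabolic_dist A g p q < \<epsilon> \<Longrightarrow> q \<in> U"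
proof -
  obtain U1 U2 where U: "open U1" "open U2" "p \<in> U1 \<times> U2" "U1 \<times> U2 \<subseteq> U"
    by (rule open_prod_elim[OF assms])
  have "fst p \<in> U1" "snd p \<in> U2" using U(3) by auto
  obtain \<epsilon>1 where \<epsilon>1: "\<epsilon>1 > 0" "\<And>y. riemannian_dist A g (fst p) y < ennreal \<epsilon>1 \<Longrightarrow> y \<in> U1"
    by (rule riemannian_dist_small_imp_near[OF U(1) \<open>fst p \<in> U1\<close>]) blast
  obtain \<epsilon>2 where \<epsilon>2: "\<epsilon>2 > 0" "\<And>t. dist t (snd p) < \<epsilon>2 \<Longrightarrow> t \<in> U2"
    using U(2) \<open>snd p \<in> U2\<close> unfolding open_dist by blast
  show ?thesis
  proof
    show "min (ennreal \<epsilon>1) (ennreal (sqrt \<epsilon>2)) > 0" using \<epsilon>1(1) \<epsilon>2(1) by (simp add: min_def)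
    fix q assume "parabolic_dist A g p q < min (ennreal \<epsilon>1) (ennreal (sqrt \<epsilon>2))"
    then have 1: "riemannian_dist A g (fst p) (fst q) < ennreal \<epsilon>1"
      and 2: "ennreal (sqrt \<bar>snd p - snd q\<bar>) < ennreal (sqrt \<epsilon>2)"
      unfolding parabolic_dist_def by auto
    from 2 have "dist (snd q) (snd p) < \<epsilon>2"
      by (simp add: ennreal_less_iff dist_real_def abs_minus_commute)
    then show "q \<in> U" using \<epsilon>1(2)[OF 1] \<epsilon>2(2) U(4) by (metis mem_Times_iff subsetD)
  qed
qed

lemma near_imp_parabolic_dist_small:
  assumes "\<epsilon> > 0"
  obtains U where "open U" "p \<in> U" "\<And>q. q \<in> U \<Longrightarrow> parabolic_dist A g p q < ennreal \<epsilon>"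
proof -
  obtain U1 where U1: "open U1" "fst p \<in> U1" "\<And>y. y \<in> U1 \<Longrightarrow> riemannian_dist A g (fst p) y < ennreal \<epsilon>"
    by (rule near_imp_riemannian_dist_small[OF assms]) blast
  show ?thesis
  proof
    show "open (U1 \<times> ball (snd p) (\<epsilon>\<^sup>2))" using U1(1) by (simp add: open_Times)
    show "p \<in> U1 \<times> ball (snd p) (\<epsilon>\<^sup>2)" using U1(2) assms by (simp add: mem_Times_iff)
    fix q assume q: "q \<in> U1 \<times> ball (snd p) (\<epsilon>\<^sup>2)"
    then have "sqrt \<bar>snd p - snd q\<bar> < \<epsilon>"
      using assms real_sqrt_less_mono[of "\<bar>snd p - snd q\<bar>" "\<epsilon>\<^sup>2"] by (auto simp: dist_real_def)
    then show "parabolic_dist A g p q < ennreal \<epsilon>"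
      unfolding parabolic_dist_def using U1(3) q assms by (auto intro: ennreal_lessI)
  qed
qed

section \<open>Kuratowski limits in topological terms\<close>

lemma kuratowski_limit_meets_open:
  assumes K: "kuratowski_converges Q (parabolic_dist A g) Zs Z"
    and "open U" "p \<in> Z" "p \<in> U"
  shows "\<forall>\<^sub>F n in sequentially. Zs n \<inter> U \<noteq> {}"
proof -
  obtain \<epsilon> where \<epsilon>: "\<epsilon> > 0" "\<And>q. parabolic_dist A g p q < \<epsilon> \<Longrightarrow> q \<in> U"
    by (rule parabolic_dist_small_imp_near[OF assms(2,4)]) blast
  have "p \<in> {x \<in> Q. limsup (\<lambda>n. INF z\<in>Zs n. parabolic_dist A g x z) = 0}"
    using K assms(3) unfolding kuratowski_converges_def by blast
  then have "limsup (\<lambda>n. INF z\<in>Zs n. parabolic_dist A g p z) < \<epsilon>"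
    using \<epsilon>(1) by simp
  then have "\<forall>\<^sub>F n in sequentially. (INF z\<in>Zs n. parabolic_dist A g p z) < \<epsilon>"
    by (rule Limsup_lessD)
  then show ?thesis
    by (rule eventually_mono) (use \<epsilon>(2) in \<open>auto simp: INF_less_iff\<close>)
qed

text \<open>Outside \<open>N \<times> [0, \<infinity>)\<close> the half-space of negative times does it.  Elsewhere the lower limit
of the distances from \<open>p\<close> to \<open>Zs n\<close> is positive, and any neighbourhood of smaller parabolic radius
is eventually avoided.\<close>

lemma kuratowski_limit_avoids_near:
  assumes K: "kuratowski_converges (UNIV \<times> {0..}) (parabolic_dist A g) Zs Z"
    and sub: "\<And>n. Zs n \<subseteq> UNIV \<times> {0..}" and "p \<notin> Z"
  obtains U where "open U" "p \<in> U" "\<forall>\<^sub>F n in sequentially. Zs n \<inter> U = {}"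
proof (cases "snd p < 0")
  case True
  show ?thesis
  proof
    show "open (UNIV \<times> {..<0} :: ('a \<times> real) set)" by (simp add: open_Times)
    show "p \<in> UNIV \<times> {..<0}" using True by (simp add: mem_Times_iff)
    have "Zs n \<inter> UNIV \<times> {..<0} = {}" for n using sub[of n] by auto
    then show "\<forall>\<^sub>F n in sequentially. Zs n \<inter> UNIV \<times> {..<0} = {}" by simp
  qed
next
  case False
  have "p \<notin> {x \<in> UNIV \<times> {0..}. liminf (\<lambda>n. INF z\<in>Zs n. parabolic_dist A g x z) = 0}"
    using K assms(3) unfolding kuratowski_converges_def by blast
  then have "0 < liminf (\<lambda>n. INF z\<in>Zs n. parabolic_dist A g p z)"
    using False by (simp add: mem_Times_iff zero_less_iff_neq_zero)
  then obtain \<delta> where \<delta>: "0 < \<delta>" "\<delta> < liminf (\<lambda>n. INF z\<in>Zs n. parabolic_dist A g p z)"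
    using dense by blast
  then have "\<delta> < top" by (metis top.extremum_strict top.not_eq_extremum)
  then have e: "0 < enn2real \<delta>" "ennreal (enn2real \<delta>) = \<delta>"
    using \<delta>(1) by (simp_all add: enn2real_positive_iff)
  obtain U where U: "open U" "p \<in> U" "\<And>q. q \<in> U \<Longrightarrow> parabolic_dist A g p q < ennreal (enn2real \<delta>)"
    by (rule near_imp_parabolic_dist_small[OF e(1)]) blast
  have "\<forall>\<^sub>F n in sequentially. \<delta> < (INF z\<in>Zs n. parabolic_dist A g p z)"
    using \<delta>(2) by (rule less_LiminfD)
  then have "\<forall>\<^sub>F n in sequentially. Zs n \<inter> U = {}"
  proof (rule eventually_mono)
    fix n assume n: "\<delta> < (INF z\<in>Zs n. parabolic_dist A g p z)"
    have False if "q \<in> Zs n" "q \<in> U" for q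
      using less_INF_D[OF n that(1)] U(3)[OF that(2)] unfolding e(2) by simp
    then show "Zs n \<inter> U = {}" by blast
  qed
  then show ?thesis using that U by blast
qed

lemma kuratowski_limit_avoids_compact:
  assumes K: "kuratowski_converges (UNIV \<times> {0..}) (parabolic_dist A g) Zs Z"
    and sub: "\<And>n. Zs n \<subseteq> UNIV \<times> {0..}" and P: "compact P" "P \<inter> Z = {}"
  shows "\<forall>\<^sub>F n in sequentially. Zs n \<inter> P = {}"
proof -
  define \<C> where "\<C> = {U. open U \<and> (\<forall>\<^sub>F n in sequentially. Zs n \<inter> U = {})}"
  have "P \<subseteq> \<Union>\<C>"
  proof
    fix p assume "p \<in> P"
    then have "p \<notin> Z" using P(2) by blast
    then obtain U where "open U" "p \<in> U" "\<forall>\<^sub>F n in sequentially. Zs n \<inter> U = {}"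
      by (rule kuratowski_limit_avoids_near[OF K sub])
    then show "p \<in> \<Union>\<C>" unfolding \<C>_def by blast
  qed
  moreover have "\<And>U. U \<in> \<C> \<Longrightarrow> open U" unfolding \<C>_def by blast
  ultimately obtain \<D> where \<D>: "\<D> \<subseteq> \<C>" "finite \<D>" "P \<subseteq> \<Union>\<D>"
    using compactE[OF P(1)] by metis
  have "\<forall>\<^sub>F n in sequentially. \<forall>U\<in>\<D>. Zs n \<inter> U = {}"
    using \<D>(1,2) by (intro eventually_ball_finite) (auto simp: \<C>_def)
  then show ?thesis by (rule eventually_mono) (use \<D>(3) in blast)
qed

text \<open>A neighbourhood that \<open>Zs n\<close> avoids for all large \<open>n\<close> contains no point of \<open>Z\<close>, since such a point would be
approached by points of \<open>Zs n\<close>.\<close>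

lemma kuratowski_limit_closed:
  assumes K: "kuratowski_converges (UNIV \<times> {0..}) (parabolic_dist A g) Zs Z"
    and sub: "\<And>n. Zs n \<subseteq> UNIV \<times> {0..}"
  shows "closed Z"
proof -
  have "\<exists>U. open U \<and> p \<in> U \<and> U \<subseteq> - Z" if "p \<in> - Z" for p
  proof -
    have "p \<notin> Z" using that by simp
    then obtain U where U: "open U" "p \<in> U" "\<forall>\<^sub>F n in sequentially. Zs n \<inter> U = {}"
      by (rule kuratowski_limit_avoids_near[OF K sub])
    have "q \<notin> Z" if "q \<in> U" for q
    proof
      assume "q \<in> Z"
      from kuratowski_limit_meets_open[OF K U(1) this that] U(3)
      have "\<forall>\<^sub>F n in sequentially. False" by eventually_elim simp
      then show False by simp
    qed
    then show ?thesis using U by blast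
  qed
  then have "open (- Z)" by (subst open_subopen) blast
  then show ?thesis by (simp add: closed_def)
qed

end

section \<open>The quantity Phi as a function of jets\<close>

lemma has_derivative_vec_lambda:
  fixes f :: "'i::finite \<Rightarrow> 'a::real_normed_vector \<Rightarrow> 'b::euclidean_space"
  assumes "\<And>i. (f i has_derivative f' i) F"
  shows "((\<lambda>x. \<chi> i. f i x) has_derivative (\<lambda>v. \<chi> i. f' i v)) F"
proof -
  have L: "bounded_linear (axis i :: 'b \<Rightarrow> 'b ^ 'i)" for i
    unfolding linear_linear by (rule linearI) (simp_all add: vec_eq_iff axis_def)
  have eq: "(\<chi> i. h i) = (\<Sum>i\<in>UNIV. axis i (h i))" for h :: "'i \<Rightarrow> 'b"
    by (simp add: vec_eq_iff axis_def if_distrib cong: if_cong)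
  show ?thesis
    unfolding eq by (intro has_derivative_sum bounded_linear.has_derivative[OF L] assms)
qed

text \<open>The determinant does not vanish on the segment from the identity to \<open>M\<close>, which consists of positive
definite matrices, and it is \<open>1\<close> at the identity.\<close>

lemma posdef_det_pos:
  fixes M :: "real ^ 'n ^ 'n"
  assumes "\<And>v. v \<noteq> 0 \<Longrightarrow> v \<bullet> (M *v v) > 0"
  shows "det M > 0"
proof -
  have nz: "det B \<noteq> 0" if B: "\<And>v. v \<noteq> 0 \<Longrightarrow> v \<bullet> (B *v v) > 0" for B :: "real ^ 'n ^ 'n"
  proof -
    have "\<forall>x. B *v x = 0 \<longrightarrow> x = 0" using B by (metis inner_zero_right less_irrefl)
    then show ?thesis
      using matrix_left_invertible_ker[of B] invertible_left_inverse[of B] invertible_det_nz[of B] by blast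
  qed
  define f where "f s = det (\<chi> i j. (1 - s) * mat 1 $ i $ j + s * M $ i $ j)" for s :: real
  have cont: "continuous_on {0..1} f"
    unfolding f_def det_def by (intro continuous_intros)
  have eq: "(\<chi> i j. (1 - s) * mat 1 $ i $ j + s * M $ i $ j) = (1 - s) *\<^sub>R mat 1 + s *\<^sub>R M" for s
    by (simp add: vec_eq_iff)
  have "f s \<noteq> 0" if "s \<in> {0..1}" for s
    unfolding f_def eq
  proof (rule nz)
    fix v :: "real ^ 'n" assume v: "v \<noteq> 0"
    have e: "v \<bullet> (((1 - s) *\<^sub>R mat 1 + s *\<^sub>R M) *v v) = (1 - s) * (v \<bullet> v) + s * (v \<bullet> (M *v v))"
      by (simp add: matrix_vector_mult_add_rdistrib scaleR_matrix_vector_assoc[symmetric] inner_add_right)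
    have "v \<bullet> v > 0" "v \<bullet> (M *v v) > 0" using v assms by simp_all
    then show "v \<bullet> (((1 - s) *\<^sub>R mat 1 + s *\<^sub>R M) *v v) > 0"
      unfolding e using that
      by (cases "s = 0") (auto intro!: add_nonneg_pos mult_nonneg_nonneg mult_pos_pos)
  qed
  moreover have "f 0 = 1" by (simp add: f_def det_I)
  moreover have "f 1 = det M" by (simp add: f_def)
  ultimately show ?thesis
    using IVT2'[of f 1 0 0] cont by (metis atLeastAtMost_iff linorder_not_le zero_le_one zero_less_one less_eq_real_def)
qed

text \<open>For a pair \<open>(M, p)\<close> of an invertible matrix and a covector this is the vector \<open>M\<^sup>-\<^sup>1 p\<close> by
Cramer's rule.  If \<open>M\<close> is the matrix of a metric and \<open>p\<close> the differential of a function,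
it is the gradient, and \<open>p \<bullet> raised (M, p)\<close> is the square of its length.\<close>

definition raised :: "(real ^ 'n::finite ^ 'n) \<times> (real ^ 'n) \<Rightarrow> real ^ 'n" where
  "raised q = (\<chi> k. det (\<chi> i j. if j = k then snd q $ i else fst q $ i $ j) / det (fst q))"

definition nondegenerate :: "((real ^ 'n::finite ^ 'n) \<times> (real ^ 'n)) set" where
  "nondegenerate = {q. det (fst q) > 0 \<and> snd q \<bullet> raised q > 0}"

text \<open>The components of \<open>\<surd>det G \<nu>\<close>, whose coordinate divergence occurs in the formula for the divergence of
the unit normal \<open>\<nu>\<close>, as functions of the metric matrix and the differential.  They are smooth on
\<open>nondegenerate\<close>, so the mean curvature is the derivative of a fixed smooth function along a
direction that is linear in the first derivatives of the metric and the second derivatives of the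
defining function.\<close>

definition flux :: "'n \<Rightarrow> (real ^ 'n::finite ^ 'n) \<times> (real ^ 'n) \<Rightarrow> real" where
  "flux i q = sqrt (det (fst q)) * raised q $ i / sqrt (snd q \<bullet> raised q)"

lemma C_upto_det:
  fixes B :: "'a::real_normed_vector \<Rightarrow> real ^ 'n ^ 'n"
  assumes "open W" "\<And>i j. C_upto k W (\<lambda>x. B x $ i $ j)"
  shows "C_upto k W (\<lambda>x. det (B x))"
  unfolding det_def by (intro C_upto_sum C_upto_mult C_upto_const C_upto_prod assms)

lemma bounded_linear_entries:
  "bounded_linear (\<lambda>q :: (real ^ 'n::finite ^ 'n) \<times> (real ^ 'n). fst q $ i $ j)"
  "bounded_linear (\<lambda>q :: (real ^ 'n::finite ^ 'n) \<times> (real ^ 'n). snd q $ i)"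
  by (rule bounded_linear_compose[OF bounded_linear_vec_nth
          bounded_linear_compose[OF bounded_linear_vec_nth bounded_linear_fst]])
     (rule bounded_linear_compose[OF bounded_linear_vec_nth bounded_linear_snd])

lemma C_upto_det_fst:
  "C_upto k UNIV (\<lambda>q :: (real ^ 'n::finite ^ 'n) \<times> (real ^ 'n). det (fst q))"
  by (intro C_upto_det C_upto_linear bounded_linear_entries open_UNIV)

lemma open_det_pos: "open {q :: (real ^ 'n::finite ^ 'n) \<times> (real ^ 'n). det (fst q) > 0}"
proof -
  have "C_infty UNIV (\<lambda>q :: (real ^ 'n::finite ^ 'n) \<times> (real ^ 'n). det (fst q))"
    by (simp add: C_infty_iff C_upto_det_fst)
  then have "continuous_on UNIV (\<lambda>q :: (real ^ 'n::finite ^ 'n) \<times> (real ^ 'n). det (fst q))"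
    by (rule C_infty_continuous_on0)
  then show ?thesis by (rule open_Collect_less[OF continuous_on_const])
qed

lemma C_upto_raised:
  "C_upto k {q :: (real ^ 'n::finite ^ 'n) \<times> (real ^ 'n). det (fst q) > 0} (\<lambda>q. raised q $ i)"
  (is "C_upto k ?D _")
proof -
  have num: "C_upto k ?D (\<lambda>q. det (\<chi> a j. if j = i then snd q $ a else fst q $ a $ j))"
  proof (intro C_upto_det open_det_pos)
    fix a j
    show "C_upto k ?D (\<lambda>q. (\<chi> a j. if j = i then snd q $ a else fst q $ a $ j) $ a $ j)"
      by (cases "j = i") (simp_all add: C_upto_linear bounded_linear_entries open_det_pos)
  qed
  have "C_upto k ?D (\<lambda>q. inverse (det (fst q)))"
    by (rule C_upto_compose[OF open_det_pos C_upto_subset[OF C_upto_det_fst] C_upto_inverse]) auto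
  from C_upto_mult[OF open_det_pos num this] show ?thesis
    by (simp add: raised_def divide_inverse)
qed

lemma C_upto_conorm:
  "C_upto k {q :: (real ^ 'n::finite ^ 'n) \<times> (real ^ 'n). det (fst q) > 0} (\<lambda>q. snd q \<bullet> raised q)"
  unfolding inner_vec_def inner_real_def
  by (intro C_upto_sum C_upto_mult C_upto_raised open_det_pos C_upto_linear bounded_linear_entries)

lemma open_nondegenerate: "open (nondegenerate :: ((real ^ 'n::finite ^ 'n) \<times> (real ^ 'n)) set)"
proof -
  let ?D = "{q :: (real ^ 'n ^ 'n) \<times> (real ^ 'n). det (fst q) > 0}"
  have "C_infty ?D (\<lambda>q. snd q \<bullet> raised q)" by (simp add: C_infty_iff C_upto_conorm)
  from continuous_open_preimage[OF C_infty_continuous_on0[OF this] open_det_pos, of "{0<..}"]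
  have "open (?D \<inter> (\<lambda>q. snd q \<bullet> raised q) -` {0<..})" by simp
  moreover have "?D \<inter> (\<lambda>q. snd q \<bullet> raised q) -` {0<..} = nondegenerate"
    by (auto simp: nondegenerate_def)
  ultimately show ?thesis by simp
qed

lemma C_infty_flux: "C_infty nondegenerate (flux i)"
  unfolding C_infty_iff
proof
  fix k
  let ?D = "{q :: (real ^ 'n::finite ^ 'n) \<times> (real ^ 'n). det (fst q) > 0}"
  have sub: "nondegenerate \<subseteq> ?D" by (auto simp: nondegenerate_def)
  have s: "C_upto k nondegenerate (\<lambda>q. sqrt (det (fst q)))"
    by (rule C_upto_compose[OF open_nondegenerate C_upto_subset[OF C_upto_det_fst] C_upto_sqrt])
       (auto simp: nondegenerate_def)
  have t: "C_upto k nondegenerate (\<lambda>q. sqrt (snd q \<bullet> raised q))"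
    by (rule C_upto_compose[OF open_nondegenerate C_upto_subset[OF C_upto_conorm sub] C_upto_sqrt])
       (auto simp: nondegenerate_def)
  have "C_upto k nondegenerate (\<lambda>q. inverse (sqrt (snd q \<bullet> raised q)))"
    by (rule C_upto_compose[OF open_nondegenerate t C_upto_inverse])
       (auto simp: nondegenerate_def)
  from C_upto_mult[OF open_nondegenerate C_upto_mult[OF open_nondegenerate s C_upto_subset[OF C_upto_raised sub]] this]
  show "C_upto k nondegenerate (flux i)"
    by (simp add: flux_def[abs_def] divide_inverse)
qed

lemma continuous_on_nondegenerate:
  "continuous_on nondegenerate (\<lambda>q :: (real ^ 'n::finite ^ 'n) \<times> (real ^ 'n). snd q \<bullet> raised q)"
  "continuous_on nondegenerate (\<lambda>q :: (real ^ 'n::finite ^ 'n) \<times> (real ^ 'n). det (fst q))"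
proof -
  have "C_infty {q. det (fst q) > 0} (\<lambda>q :: (real ^ 'n ^ 'n) \<times> (real ^ 'n). snd q \<bullet> raised q)"
    by (simp add: C_infty_iff C_upto_conorm)
  then show "continuous_on nondegenerate (\<lambda>q :: (real ^ 'n ^ 'n) \<times> (real ^ 'n). snd q \<bullet> raised q)"
    by (rule C_infty_continuous_on0[OF C_infty_subset]) (auto simp: nondegenerate_def)
  have "C_infty UNIV (\<lambda>q :: (real ^ 'n ^ 'n) \<times> (real ^ 'n). det (fst q))"
    by (simp add: C_infty_iff C_upto_det_fst)
  then show "continuous_on nondegenerate (\<lambda>q :: (real ^ 'n ^ 'n) \<times> (real ^ 'n). det (fst q))"
    by (rule C_infty_continuous_on0[OF C_infty_subset]) auto
qed

text \<open>The spatial differential of a function of position and time.\<close>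

definition covector :: "((real ^ 'n::finite) \<times> real \<Rightarrow> real) \<Rightarrow> (real ^ 'n) \<times> real \<Rightarrow> real ^ 'n" where
  "covector \<psi> q = (\<chi> j. iter_deriv [(axis j 1, 0)] \<psi> q)"

definition jet where
  "jet G \<psi> q = (metric_matrix G (fst q), covector \<psi> q)"

text \<open>The derivative of \<open>jet G \<psi>\<close> in the \<open>i\<close>-th spatial direction, written with iterated derivatives because
the convergence of metrics is stated for these.\<close>

definition djet where
  "djet G \<psi> q i = ((\<chi> a b. iter_deriv [axis i 1] (\<lambda>z. G z (axis a 1) (axis b 1)) (fst q)),
     (\<chi> j. iter_deriv [(axis i 1, 0), (axis j 1, 0)] \<psi> q))"

text \<open>The value of \<open>\<Phi>\<close> on the level sets of \<open>\<psi>\<close>.  The first summand is the normal velocity, the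
second one the divergence of the unit normal, which is minus the mean curvature \<open>H\<close>.\<close>

definition level_Phi ::
  "'n::finite coord_metric \<Rightarrow> ((real ^ 'n) \<times> real \<Rightarrow> real) \<Rightarrow> (real ^ 'n) \<times> real \<Rightarrow> real" where
  "level_Phi G \<psi> q =
     - (1 / sqrt (covector \<psi> q \<bullet> raised (jet G \<psi> q))) * iter_deriv [(0, 1)] \<psi> q
     + (\<Sum>i\<in>UNIV. frechet_derivative (flux i) (at (jet G \<psi> q)) (djet G \<psi> q i))
         / sqrt (det (metric_matrix G (fst q)))"

lemma frechet_tendsto:
  fixes h :: "'b::euclidean_space \<Rightarrow> real"
  assumes h: "C_infty U h" and "open U" "q \<in> U" and J: "(J \<longlongrightarrow> q) F" and d: "(d \<longlongrightarrow> e) F"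
  shows "((\<lambda>k. frechet_derivative h (at (J k)) (d k)) \<longlongrightarrow> frechet_derivative h (at q) e) F"
proof -
  have rep: "(\<Sum>b\<in>Basis. (v \<bullet> b) * iter_deriv [b] h y) = frechet_derivative h (at y) v" if "y \<in> U" for y v
  proof -
    have lin: "linear (frechet_derivative h (at y))"
      using linear_frechet_derivative[of h "at y"] C_infty_differentiable[OF h that, of "[]"] by simp
    have "frechet_derivative h (at y) v = frechet_derivative h (at y) (\<Sum>b\<in>Basis. (v \<bullet> b) *\<^sub>R b)"
      by (simp only: euclidean_representation)
    also have "\<dots> = (\<Sum>b\<in>Basis. (v \<bullet> b) * iter_deriv [b] h y)"
      by (simp only: linear_sum[OF lin] linear_scale[OF lin] real_scaleR_def iter_deriv.simps)
    finally show ?thesis ..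
  qed
  have "((\<lambda>k. iter_deriv [b] h (J k)) \<longlongrightarrow> iter_deriv [b] h q) F" for b
  proof -
    have "isCont (iter_deriv [b] h) q"
      using C_infty_continuous_on[OF h, of "[b]"] assms(2,3) continuous_on_eq_continuous_at by blast
    then show ?thesis using J by (rule isCont_tendsto_compose)
  qed
  then have "((\<lambda>k. \<Sum>b\<in>Basis. (d k \<bullet> b) * iter_deriv [b] h (J k)) \<longlongrightarrow> (\<Sum>b\<in>Basis. (e \<bullet> b) * iter_deriv [b] h q)) F"
    by (intro tendsto_intros d)
  moreover have "\<forall>\<^sub>F k in F. (\<Sum>b\<in>Basis. (d k \<bullet> b) * iter_deriv [b] h (J k)) = frechet_derivative h (at (J k)) (d k)"
    using topological_tendstoD[OF J assms(2,3)] by (rule eventually_mono) (rule rep)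
  note tendsto_cong[OF this]
  ultimately have "((\<lambda>k. frechet_derivative h (at (J k)) (d k)) \<longlongrightarrow> (\<Sum>b\<in>Basis. (e \<bullet> b) * iter_deriv [b] h q)) F"
    by (rule iffD1[rotated])
  then show ?thesis using rep[OF assms(3)] by simp
qed

text \<open>Position, metric and the first derivatives of the metric may vary simultaneously.  With a constant
metric this gives continuity of \<open>\<Phi>\<close>, and along the sequence \<open>gs\<close> it gives the passage to the limit.\<close>

lemma level_Phi_tendsto:
  fixes \<psi> :: "(real ^ 'n::finite) \<times> real \<Rightarrow> real"
  assumes \<psi>: "C_infty W \<psi>" "open W" "q \<in> W" and J: "jet G \<psi> q \<in> nondegenerate"
    and p: "(p \<longlongrightarrow> q) F"
    and G0: "\<And>a b. ((\<lambda>k. H k (fst (p k)) (axis a 1) (axis b 1)) \<longlongrightarrow> G (fst q) (axis a 1) (axis b 1)) F"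
    and G1: "\<And>i a b. ((\<lambda>k. iter_deriv [axis i 1] (\<lambda>z. H k z (axis a 1) (axis b 1)) (fst (p k)))
       \<longlongrightarrow> iter_deriv [axis i 1] (\<lambda>z. G z (axis a 1) (axis b 1)) (fst q)) F"
  shows "((\<lambda>k. level_Phi (H k) \<psi> (p k)) \<longlongrightarrow> level_Phi G \<psi> q) F"
proof -
  have D: "((\<lambda>k. iter_deriv vs \<psi> (p k)) \<longlongrightarrow> iter_deriv vs \<psi> q) F" for vs
  proof -
    have "isCont (iter_deriv vs \<psi>) q"
      using C_infty_continuous_on[OF \<psi>(1), of vs] \<psi>(2,3) continuous_on_eq_continuous_at by blast
    then show ?thesis using p by (rule isCont_tendsto_compose)
  qed
  have M: "((\<lambda>k. metric_matrix (H k) (fst (p k))) \<longlongrightarrow> metric_matrix G (fst q)) F"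
    unfolding metric_matrix_def by (intro tendsto_vec_lambda G0)
  have cov: "((\<lambda>k. covector \<psi> (p k)) \<longlongrightarrow> covector \<psi> q) F"
    unfolding covector_def by (intro tendsto_vec_lambda D)
  have Jt: "((\<lambda>k. jet (H k) \<psi> (p k)) \<longlongrightarrow> jet G \<psi> q) F"
    unfolding jet_def by (intro tendsto_Pair M cov)
  have dJ: "((\<lambda>k. djet (H k) \<psi> (p k) i) \<longlongrightarrow> djet G \<psi> q i) F" for i
    unfolding djet_def by (intro tendsto_Pair tendsto_vec_lambda D G1)
  have c: "((\<lambda>k. covector \<psi> (p k) \<bullet> raised (jet (H k) \<psi> (p k))) \<longlongrightarrow> covector \<psi> q \<bullet> raised (jet G \<psi> q)) F"
  proof -
    have "isCont (\<lambda>q. snd q \<bullet> raised q) (jet G \<psi> q)"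
      using continuous_on_nondegenerate(1) J open_nondegenerate continuous_on_eq_continuous_at by blast
    from isCont_tendsto_compose[OF this Jt] show ?thesis by (simp add: jet_def)
  qed
  have dt: "((\<lambda>k. det (metric_matrix (H k) (fst (p k)))) \<longlongrightarrow> det (metric_matrix G (fst q))) F"
  proof -
    have "isCont (\<lambda>q. det (fst q)) (jet G \<psi> q)"
      using continuous_on_nondegenerate(2) J open_nondegenerate continuous_on_eq_continuous_at by blast
    from isCont_tendsto_compose[OF this Jt] show ?thesis by (simp add: jet_def)
  qed
  have pos: "covector \<psi> q \<bullet> raised (jet G \<psi> q) > 0" "det (metric_matrix G (fst q)) > 0"
    using J by (simp_all add: nondegenerate_def jet_def)
  show ?thesis
    unfolding level_Phi_def
    by (intro tendsto_intros c dt D frechet_tendsto[OF C_infty_flux open_nondegenerate J Jt dJ])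
       (use pos in auto)
qed

context riemannian
begin

lemma metric_inner:
  assumes "c \<in> A" "z \<in> chart_img c"
  shows "g c z v w = v \<bullet> (metric_matrix (g c) z *v w)"
  by (simp add: bilinear_metric_matrix[where G = "g c", OF metric_bilinear[OF assms]]
      matrix_vector_mult_def inner_vec_def sum_distrib_left mult_ac)

text \<open>Cramer's rule for the linear system that defines the gradient.\<close>

lemma rgrad_eq_raised:
  assumes c: "c \<in> A" and z: "z \<in> chart_img c" and u: "u differentiable (at z)"
  defines "q \<equiv> (metric_matrix (g c) z, \<chi> j. frechet_derivative u (at z) (axis j 1))"
  shows "rgrad (g c) u z = raised q" "det (fst q) > 0"
    "g c z (raised q) (raised q) = snd q \<bullet> raised q"
    "snd q \<noteq> 0 \<Longrightarrow> q \<in> nondegenerate"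
    "rgrad (g c) u z \<noteq> 0 \<longleftrightarrow> snd q \<noteq> 0"
proof -
  let ?M = "metric_matrix (g c) z" and ?p = "snd q"
  show det: "det (fst q) > 0"
    unfolding q_def fst_conv
    by (rule posdef_det_pos) (use metric_pos[OF c z] metric_inner[OF c z] in simp)
  have lin: "linear (frechet_derivative u (at z))" using u by (rule linear_frechet_derivative)
  have Du: "frechet_derivative u (at z) v = v \<bullet> ?p" for v
    by (subst linear_axis_expansion[OF lin]) (simp add: q_def inner_vec_def)
  have "det ?M \<noteq> 0" using det by (simp add: q_def)
  then have solve: "?M *v w = ?p \<longleftrightarrow> w = raised q" for w
    unfolding raised_def q_def fst_conv snd_conv by (rule cramer)
  have iff: "(\<forall>v. g c z w v = frechet_derivative u (at z) v) \<longleftrightarrow> w = raised q" for w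
  proof -
    have "(\<forall>v. g c z w v = frechet_derivative u (at z) v) \<longleftrightarrow> (\<forall>v. v \<bullet> (?M *v w) = v \<bullet> ?p)"
      using metric_sym[OF c z, of w] metric_inner[OF c z] Du by simp
    also have "\<dots> \<longleftrightarrow> ?M *v w = ?p" by (simp add: vector_eq_ldot)
    finally show ?thesis using solve by simp
  qed
  show 1: "rgrad (g c) u z = raised q" unfolding rgrad_def iff by simp
  have "?M *v raised q = ?p" using solve by simp
  then show 2: "g c z (raised q) (raised q) = ?p \<bullet> raised q"
    by (simp add: metric_inner[OF c z] inner_commute)
  have 0: "raised q = 0 \<longleftrightarrow> ?p = 0"
    using solve[of 0] by auto
  show "?p \<noteq> 0 \<Longrightarrow> q \<in> nondegenerate"
    using det 2 metric_pos[OF c z, of "raised q"] 0 by (simp add: nondegenerate_def)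
  show "rgrad (g c) u z \<noteq> 0 \<longleftrightarrow> ?p \<noteq> 0" using 1 0 by simp
qed

lemma metric_matrix_has_derivative:
  assumes c: "c \<in> A" and z: "z \<in> chart_img c"
  shows "(metric_matrix (g c) has_derivative
     (\<lambda>v. \<chi> a b. frechet_derivative (\<lambda>z. g c z (axis a 1) (axis b 1)) (at z) v)) (at z)"
  unfolding metric_matrix_def[abs_def]
  by (intro has_derivative_vec_lambda C_infty_has_derivative[OF metric_C_infty[OF c] z])

text \<open>The defining function \<open>f\<close> is known only up to the time \<open>b\<close>, and its time derivative there is one-sided.
It agrees with that of any smooth extension \<open>\<psi>\<close> to an open set, so \<open>\<Phi>\<close> can be computed from \<open>\<psi>\<close>.\<close>

lemma barrier_Phi_eq_level_Phi:
  assumes c: "c \<in> A" and x: "x \<in> chart_dom c" and z: "z = coord c x" and ab: "a < b"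
    and \<psi>: "C_infty W \<psi>" "open W" "(z, b) \<in> W"
    and f: "\<And>y s. (y, s) \<in> W \<Longrightarrow> y \<in> chart_img c \<Longrightarrow> s \<in> {a..b} \<Longrightarrow> f (chart_inv c y) s = \<psi> (y, s)"
    and nz: "covector \<psi> (z, b) \<noteq> 0"
  shows "barrier_Phi g c a b f x b = level_Phi (g c) \<psi> (z, b)"
proof -
  define u where "u = in_chart c f b"
  define J where "J y = jet (g c) \<psi> (y, b)" for y
  define V where "V = {y \<in> chart_img c. (y, b) \<in> W \<and> covector \<psi> (y, b) \<noteq> 0}"
  have zimg: "z \<in> chart_img c" using x z by simp
  have contb: "continuous_on X (\<lambda>y. (y, b))" for X :: "(real ^ 'n) set" by (intro continuous_intros)
  have openW: "open ((\<lambda>y. (y, b)) -` W)" by (rule open_vimage[OF \<psi>(2) contb])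
  have "continuous_on ((\<lambda>y. (y, b)) -` W) (\<lambda>y. covector \<psi> (y, b))"
    unfolding covector_def
    by (intro continuous_on_vec_lambda continuous_on_compose2[OF C_infty_continuous_on[OF \<psi>(1)] contb]) auto
  then have "open ((\<lambda>y. (y, b)) -` W \<inter> (\<lambda>y. covector \<psi> (y, b)) -` (- {0}))"
    by (rule continuous_open_preimage[OF _ openW open_Compl[OF closed_singleton]])
  then have "open (chart_img c \<inter> ((\<lambda>y. (y, b)) -` W \<inter> (\<lambda>y. covector \<psi> (y, b)) -` (- {0})))"
    using open_chart_img[OF c] by (rule open_Int[rotated])
  moreover have "V = chart_img c \<inter> ((\<lambda>y. (y, b)) -` W \<inter> (\<lambda>y. covector \<psi> (y, b)) -` (- {0}))"
    by (auto simp: V_def)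
  ultimately have openV: "open V" by simp
  have zV: "z \<in> V" using zimg \<psi>(3) nz by (simp add: V_def)
  have slice: "((\<lambda>y. iter_deriv vs \<psi> (y, b)) has_derivative
      (\<lambda>v. frechet_derivative (iter_deriv vs \<psi>) (at (y, b)) (v, 0))) (at y)" if "y \<in> V" for y vs
    using C_infty_slice_has_derivative[OF C_infty_iter_deriv[OF \<psi>(1)]] that by (simp add: V_def)
  have du: "(u has_derivative (\<lambda>v. frechet_derivative \<psi> (at (y, b)) (v, 0))) (at y)" if "y \<in> V" for y
  proof (rule has_derivative_transform_within_open[OF _ openV that])
    show "((\<lambda>y. \<psi> (y, b)) has_derivative (\<lambda>v. frechet_derivative \<psi> (at (y, b)) (v, 0))) (at y)"
      using slice[OF that, of "[]"] by simp
    show "\<psi> (y', b) = u y'" if "y' \<in> V" for y'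
      using that f[of y' b] ab by (simp add: u_def in_chart_def V_def)
  qed
  have J: "J y = (metric_matrix (g c) y, \<chi> j. frechet_derivative u (at y) (axis j 1))" if "y \<in> V" for y
    using frechet_derivative_at[OF du[OF that], symmetric] by (simp add: J_def jet_def covector_def)
  have Jsnd: "snd (J y) \<noteq> 0" if "y \<in> V" for y using that by (simp add: J_def jet_def V_def)
  have grad: "rgrad (g c) u y = raised (J y)" "g c y (raised (J y)) (raised (J y)) = snd (J y) \<bullet> raised (J y)"
      "J y \<in> nondegenerate" if "y \<in> V" for y
  proof -
    have "y \<in> chart_img c" "u differentiable (at y)" using that du[OF that] by (auto simp: V_def differentiable_def)
    from rgrad_eq_raised[OF c this, folded J[OF that]] Jsnd[OF that]
    show "rgrad (g c) u y = raised (J y)" "g c y (raised (J y)) (raised (J y)) = snd (J y) \<bullet> raised (J y)"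
      "J y \<in> nondegenerate" by auto
  qed
  \<comment> \<open>The identity holds in a whole neighbourhood of \<open>z\<close> and may be differentiated there.\<close>
  have flux: "vol_density (g c) y * unit_normal (g c) u y $ i = flux i (J y)" if "y \<in> V" for y i
    using grad(1,2)[OF that]
    by (simp add: vol_density_def unit_normal_def rnorm_def flux_def divide_inverse J_def jet_def metric_matrix_def)
  have dJ: "(J has_derivative (\<lambda>v. (\<chi> a b. frechet_derivative (\<lambda>z. g c z (axis a 1) (axis b 1)) (at z) v,
      \<chi> j. frechet_derivative (iter_deriv [(axis j 1, 0)] \<psi>) (at (z, b)) (v, 0)))) (at z)"
    unfolding J_def[abs_def] jet_def fst_conv covector_def
    by (intro has_derivative_Pair metric_matrix_has_derivative[OF c zimg] has_derivative_vec_lambda slice[OF zV])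
  have dflux: "frechet_derivative (\<lambda>y. vol_density (g c) y * unit_normal (g c) u y $ i) (at z) (axis i 1)
      = frechet_derivative (flux i) (at (J z)) (djet (g c) \<psi> (z, b) i)" for i
  proof -
    have "((\<lambda>y. flux i (J y)) has_derivative (\<lambda>v. frechet_derivative (flux i) (at (J z))
       (\<chi> a b. frechet_derivative (\<lambda>z. g c z (axis a 1) (axis b 1)) (at z) v,
      \<chi> j. frechet_derivative (iter_deriv [(axis j 1, 0)] \<psi>) (at (z, b)) (v, 0)))) (at z)"
      by (rule has_derivative_compose[OF dJ C_infty_has_derivative[OF C_infty_flux grad(3)[OF zV]]])
    then have "((\<lambda>y. vol_density (g c) y * unit_normal (g c) u y $ i) has_derivative (\<lambda>v. frechet_derivative (flux i) (at (J z))
       (\<chi> a b. frechet_derivative (\<lambda>z. g c z (axis a 1) (axis b 1)) (at z) v,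
      \<chi> j. frechet_derivative (iter_deriv [(axis j 1, 0)] \<psi>) (at (z, b)) (v, 0)))) (at z)"
      by (rule has_derivative_transform_within_open[OF _ openV zV]) (simp add: flux)
    from frechet_derivative_at[OF this, symmetric] show ?thesis
      by (simp add: djet_def)
  qed
  have H: "barrier_H g c f x b = - ((\<Sum>i\<in>UNIV. frechet_derivative (flux i) (at (J z)) (djet (g c) \<psi> (z, b) i))
       / sqrt (det (metric_matrix (g c) z)))"
    unfolding barrier_H_def rdiv_def u_def[symmetric] z[symmetric] dflux
    by (simp add: vol_density_def metric_matrix_def)
  have "((\<lambda>s. (z, s)) has_derivative (\<lambda>r. (0, r))) (at b)"
    by (auto intro!: derivative_eq_intros)
  from has_derivative_compose[OF this C_infty_has_derivative[OF \<psi>(1,3)]]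
  have "((\<lambda>s. \<psi> (z, s)) has_derivative (\<lambda>r. frechet_derivative \<psi> (at (z, b)) (0, r))) (at b)" .
  note dt = this
  have lin: "frechet_derivative \<psi> (at (z, b)) (0, r) = r *\<^sub>R iter_deriv [(0, 1)] \<psi> (z, b)" for r
    using linear_scale[OF linear_frechet_derivative[OF C_infty_differentiable[OF \<psi>(1,3), of "[]"]], of r "(0, 1)"]
    by simp
  have hv: "((\<lambda>s. \<psi> (z, s)) has_derivative (\<lambda>r. r *\<^sub>R iter_deriv [(0, 1)] \<psi> (z, b))) (at b within {a..b})"
    by (rule has_derivative_at_withinI[OF has_derivative_eq_rhs[OF dt ext[OF lin]]])
  have ev: "\<forall>\<^sub>F s in at b within {a..b}. f x s = \<psi> (z, s)"
  proof -
    have "continuous_on UNIV (\<lambda>s. (z, s))" by (intro continuous_intros)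
    then have "open ((\<lambda>s. (z, s)) -` W)" by (rule open_vimage[OF \<psi>(2)])
    then have "\<forall>\<^sub>F s in at b within {a..b}. s \<in> (\<lambda>s. (z, s)) -` W"
      using \<psi>(3) by (intro eventually_at_topological[THEN iffD2]) auto
    moreover have "\<forall>\<^sub>F s in at b within {a..b}. s \<in> {a..b}"
      by (simp add: eventually_at_filter)
    ultimately show ?thesis
    proof eventually_elim
      case (elim s)
      then show ?case using f[of z s] zimg chart_inv_coord[OF c x] by (simp add: z)
    qed
  qed
  have fxb: "f x b = \<psi> (z, b)" using f[OF \<psi>(3) zimg] ab chart_inv_coord[OF c x] by (simp add: z)
  have "(f x has_vector_derivative iter_deriv [(0, 1)] \<psi> (z, b)) (at b within {a..b})"
    unfolding has_vector_derivative_def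
    by (rule has_derivative_transform_eventually[OF hv])
       (use ev fxb ab in \<open>auto elim: eventually_mono\<close>)
  then have vd: "vector_derivative (f x) (at b within {a..b}) = iter_deriv [(0, 1)] \<psi> (z, b)"
    using ab by (intro vector_derivative_within_closed_interval) auto
  have v: "barrier_v g c a b f x b = - (1 / sqrt (covector \<psi> (z, b) \<bullet> raised (jet (g c) \<psi> (z, b)))) * iter_deriv [(0, 1)] \<psi> (z, b)"
    unfolding barrier_v_def vd u_def[symmetric] z[symmetric] rnorm_def grad(1)[OF zV] grad(2)[OF zV]
    by (simp add: J_def jet_def)
  show ?thesis
    unfolding barrier_Phi_def H v level_Phi_def by (simp add: J_def)
qed

text \<open>Any covector is the differential of a linear function, so this is a case of \<open>rgrad_eq_raised\<close>.\<close>

lemma jet_nondegenerate: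
  assumes c: "c \<in> A" and z: "fst q \<in> chart_img c" and nz: "covector \<psi> q \<noteq> 0"
  shows "jet (g c) \<psi> q \<in> nondegenerate"
proof -
  define u where "u y = y \<bullet> covector \<psi> q" for y :: "real ^ 'n"
  have d: "(u has_derivative u) (at (fst q))"
    unfolding u_def by (auto intro!: derivative_eq_intros)
  have "u differentiable (at (fst q))" using d by (auto simp: differentiable_def)
  from rgrad_eq_raised(4)[OF c z this]
  show ?thesis
    using frechet_derivative_at[OF d, symmetric] nz
    by (simp add: jet_def u_def inner_axis' vec_nth_inverse)
qed

lemma level_Phi_isCont:
  assumes c: "c \<in> A" and z: "fst q \<in> chart_img c" and \<psi>: "C_infty W \<psi>" "open W" "q \<in> W"
    and nz: "covector \<psi> q \<noteq> 0"
  shows "isCont (level_Phi (g c) \<psi>) q"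
proof -
  have D: "((\<lambda>k. iter_deriv vs (\<lambda>z. g c z v w) (fst k)) \<longlongrightarrow> iter_deriv vs (\<lambda>z. g c z v w) (fst q)) (at q)" for vs v w
  proof -
    have "isCont (iter_deriv vs (\<lambda>z. g c z v w)) (fst q)"
      using C_infty_continuous_on[OF metric_C_infty[OF c], of vs] open_chart_img[OF c] z
        continuous_on_eq_continuous_at by blast
    then show ?thesis by (rule isCont_tendsto_compose) (intro tendsto_intros)
  qed
  show ?thesis
    unfolding isCont_def
    by (rule level_Phi_tendsto[OF \<psi> jet_nondegenerate[OF c z nz] tendsto_ident_at])
       (use D[of "[]"] in simp, rule D)
qed

lemma level_Phi_tendsto_metrics:
  assumes conv: "metrics_converge_smoothly A gs g" and c: "c \<in> A" and z: "fst q \<in> chart_img c"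
    and \<psi>: "C_infty W \<psi>" "open W" "q \<in> W" and nz: "covector \<psi> q \<noteq> 0"
    and r: "filterlim r sequentially sequentially" and p: "p \<longlonglongrightarrow> q"
  shows "(\<lambda>k. level_Phi (gs (r k) c) \<psi> (p k)) \<longlonglongrightarrow> level_Phi (g c) \<psi> q"
proof -
  obtain \<rho> where \<rho>: "\<rho> > 0" "cball (fst q) \<rho> \<subseteq> chart_img c"
    using open_contains_cball[of "chart_img c"] open_chart_img[OF c] z by blast
  have fp: "(\<lambda>k. fst (p k)) \<longlonglongrightarrow> fst q" using p by (rule tendsto_fst)
  have "\<forall>\<^sub>F k in sequentially. fst (p k) \<in> ball (fst q) \<rho>"
    using topological_tendstoD[OF fp open_ball] \<rho>(1) by simp
  then have near: "\<forall>\<^sub>F k in sequentially. fst (p k) \<in> cball (fst q) \<rho>"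
    by (rule eventually_mono) auto
  have D: "(\<lambda>k. iter_deriv vs (\<lambda>z. gs (r k) c z v w) (fst (p k))) \<longlonglongrightarrow> iter_deriv vs (\<lambda>z. g c z v w) (fst q)" for vs v w
  proof -
    let ?h = "iter_deriv vs (\<lambda>z. g c z v w)"
    have "isCont ?h (fst q)"
      using C_infty_continuous_on[OF metric_C_infty[OF c], of vs] open_chart_img[OF c] z
        continuous_on_eq_continuous_at by blast
    then have 1: "(\<lambda>k. ?h (fst (p k))) \<longlonglongrightarrow> ?h (fst q)" using fp by (rule isCont_tendsto_compose)
    have u: "uniform_limit (cball (fst q) \<rho>) (\<lambda>n. iter_deriv vs (\<lambda>z. gs n c z v w)) ?h sequentially"
      using conv c \<rho>(2) compact_cball unfolding metrics_converge_smoothly_def by blast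
    have 2: "(\<lambda>k. iter_deriv vs (\<lambda>z. gs (r k) c z v w) (fst (p k)) - ?h (fst (p k))) \<longlonglongrightarrow> 0"
    proof (rule tendstoI)
      fix e :: real assume "e > 0"
      from eventually_compose_filterlim[OF uniform_limitD[OF u this] r] near
      show "\<forall>\<^sub>F k in sequentially. dist (iter_deriv vs (\<lambda>z. gs (r k) c z v w) (fst (p k)) - ?h (fst (p k))) 0 < e"
        by eventually_elim (simp add: dist_norm)
    qed
    from tendsto_add[OF 2 1] show ?thesis by simp
  qed
  show ?thesis
    by (rule level_Phi_tendsto[OF \<psi> jet_nondegenerate[OF c z nz] p, where H = "\<lambda>k. gs (r k) c"])
       (use D[of "[]"] in simp, rule D)
qed

end

section \<open>Compact barriers from level sets in a chart\<close>

text \<open>The sublevel set \<open>{\<psi> \<le> 0}\<close> in a chart becomes a globally defined compact barrier \<open>K\<close>: since \<open>\<psi> \<ge> \<theta>\<close>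
near the edge of \<open>V\<close>, the truncation \<open>E\<close> of \<open>\<psi>\<close> extends smoothly by the constant \<open>1\<close>.  Where
\<open>\<psi> < \<theta>/2\<close> nothing is changed, so \<open>\<Phi>\<close> can be computed from \<open>\<psi>\<close>.\<close>

locale local_level_set = manifold A
  for A :: "('a::{t2_space, second_countable_topology}, 'n::finite) chart set" +
  fixes c :: "('a, 'n) chart" and V C :: "(real ^ 'n) set" and a b \<theta> :: real
    and W :: "((real ^ 'n) \<times> real) set" and \<psi> :: "(real ^ 'n) \<times> real \<Rightarrow> real" and E :: "real \<Rightarrow> real"
  assumes c: "c \<in> A" and V: "open V" "V \<subseteq> chart_img c" and C: "compact C" "C \<subseteq> V"
    and W: "open W" "V \<times> {a..b} \<subseteq> W" and \<psi>: "C_infty W \<psi>"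
    and \<theta>: "\<theta> > 0" "\<And>z t. z \<in> V - C \<Longrightarrow> t \<in> {a..b} \<Longrightarrow> \<theta> \<le> \<psi> (z, t)"
    and grad: "\<And>z t. z \<in> V \<Longrightarrow> t \<in> {a..b} \<Longrightarrow> \<psi> (z, t) = 0 \<Longrightarrow> covector \<psi> (z, t) \<noteq> 0"
    and E: "C_infty UNIV E" "\<And>s. s \<le> \<theta>/2 \<Longrightarrow> E s = s" "\<And>s. \<theta> \<le> s \<Longrightarrow> E s = 1"
      "\<And>s. E s \<le> 0 \<longleftrightarrow> s \<le> 0"
begin

definition f :: "'a \<Rightarrow> real \<Rightarrow> real" where
  "f x t = (if x \<in> chart_inv c ` V then E (\<psi> (coord c x, t)) else 1)"

definition K :: "real \<Rightarrow> 'a set" where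
  "K t = {x. f x t \<le> 0}"

lemma f_chart: "z \<in> V \<Longrightarrow> f (chart_inv c z) t = E (\<psi> (z, t))"
  using coord_chart_inv[OF c] V(2) by (auto simp: f_def)

lemma mem_V_iff: "x \<in> chart_inv c ` V \<longleftrightarrow> x \<in> chart_dom c \<and> coord c x \<in> V"
proof
  assume "x \<in> chart_inv c ` V"
  then show "x \<in> chart_dom c \<and> coord c x \<in> V"
    using V(2) chart_inv_in_dom[OF c] coord_chart_inv[OF c] by (metis (no_types, lifting) imageE subsetD)
next
  assume "x \<in> chart_dom c \<and> coord c x \<in> V"
  then show "x \<in> chart_inv c ` V" using chart_inv_coord[OF c] by (metis image_eqI)
qed

lemma E_zero: "E s = 0 \<longleftrightarrow> s = 0"
  using E(2)[of s] E(4)[of s] \<theta>(1) by (metis half_gt_zero less_eq_real_def order_refl order_trans linorder_not_le)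

lemma \<psi>_continuous: "continuous_on (V \<times> {a..b}) \<psi>"
  by (rule continuous_on_subset[OF C_infty_continuous_on0[OF \<psi>] W(2)])

lemma K_chart:
  assumes "t \<in> {a..b}"
  shows "K t = chart_inv c ` {z \<in> C. \<psi> (z, t) \<le> 0}"
proof (intro equalityI subsetI)
  fix x assume x: "x \<in> K t"
  then have "x \<in> chart_inv c ` V" by (auto simp: K_def f_def split: if_splits)
  then obtain z where z: "z \<in> V" "x = chart_inv c z" by blast
  then have "\<psi> (z, t) \<le> 0" using x f_chart[OF z(1)] E(4) by (simp add: K_def)
  moreover then have "z \<in> C" using \<theta>(1) \<theta>(2)[of z t] z(1) assms by force
  ultimately show "x \<in> chart_inv c ` {z \<in> C. \<psi> (z, t) \<le> 0}" using z(2) by blast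
next
  fix x assume "x \<in> chart_inv c ` {z \<in> C. \<psi> (z, t) \<le> 0}"
  then obtain z where z: "z \<in> C" "\<psi> (z, t) \<le> 0" "x = chart_inv c z" by blast
  then have "z \<in> V" using C(2) by blast
  then show "x \<in> K t" using z f_chart E(4) by (simp add: K_def)
qed

text \<open>The end time \<open>d\<close> is variable here and below, because the barrier will be stopped at the first time at
which it touches a given flow.\<close>

lemma compact_K: "d \<le> b \<Longrightarrow> compact (\<Union>t\<in>{a..d}. K t)"
proof -
  assume d: "d \<le> b"
  define X where "X = (C \<times> {a..d}) \<inter> \<psi> -` {..0}"
  have sub: "C \<times> {a..d} \<subseteq> V \<times> {a..b}" using C(2) d by auto
  have cp: "compact (C \<times> {a..d})" using C(1) by (simp add: compact_Times)
  have "compact X" unfolding X_def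
    by (rule compact_closed_preimage[OF cp continuous_on_subset[OF \<psi>_continuous sub]]) simp
  moreover have "continuous_on X (\<lambda>q. chart_inv c (fst q))"
    by (rule continuous_on_compose2[OF continuous_on_chart_inv[OF c] continuous_on_fst[OF continuous_on_id]])
       (use C(2) V(2) in \<open>auto simp: X_def\<close>)
  ultimately have "compact ((\<lambda>q. chart_inv c (fst q)) ` X)"
    by (rule compact_continuous_image[rotated])
  moreover have "(\<Union>t\<in>{a..d}. K t) = (\<lambda>q. chart_inv c (fst q)) ` X"
  proof -
    have "K t = chart_inv c ` {z \<in> C. \<psi> (z, t) \<le> 0}" if "t \<in> {a..d}" for t
      using K_chart[of t] that d by auto
    then have "(\<Union>t\<in>{a..d}. K t) = (\<Union>t\<in>{a..d}. chart_inv c ` {z \<in> C. \<psi> (z, t) \<le> 0})" by auto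
    also have "\<dots> = (\<lambda>q. chart_inv c (fst q)) ` X" unfolding X_def by force
    finally show ?thesis .
  qed
  ultimately show ?thesis by simp
qed

text \<open>In another chart, \<open>f\<close> is near a point of \<open>V\<close> the composite of \<open>E \<circ> \<psi>\<close> with a transition map.  The
other points have a neighbourhood outside the compact set that corresponds to \<open>C\<close>, hence closed, and there
\<open>f = 1\<close>.\<close>

lemma f_smooth:
  assumes c': "c' \<in> A" and d: "d \<le> b"
  shows "smooth_on (chart_img c' \<times> {a..d}) (\<lambda>(z, t). in_chart c' f t z)"
  unfolding smooth_on_def
proof
  fix q assume "q \<in> chart_img c' \<times> {a..d}"
  then obtain z t where q: "q = (z, t)" "z \<in> chart_img c'" "t \<in> {a..d}" by blast
  have t: "t \<in> {a..b}" using q d by auto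
  let ?R = "\<lambda>W F. open W \<and> q \<in> W \<and> (\<forall>vs. \<forall>y\<in>W. iter_deriv vs F differentiable (at y)) \<and>
     (\<forall>y\<in>W \<inter> (chart_img c' \<times> {a..d}). F y = (case y of (z, t) \<Rightarrow> in_chart c' f t z))"
  show "\<exists>W F. ?R W F"
  proof (cases "chart_inv c' z \<in> chart_inv c ` V")
    case True
    define O' where "O' = coord c' ` (chart_dom c' \<inter> chart_dom c)"
    define \<tau> where "\<tau> = coord c \<circ> chart_inv c'"
    have \<tau>: "C_infty O' \<tau>" unfolding O'_def \<tau>_def by (rule transition_C_infty[OF c' c])
    have oO: "open O'" unfolding O'_def by (rule open_transition_dom[OF c' c])
    define m where "m p = (\<tau> (fst p), snd p)" for p :: "(real ^ 'n) \<times> real"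
    have m: "C_infty (O' \<times> UNIV) m"
      unfolding C_infty_iff m_def
    proof
      fix k
      have oU: "open (O' \<times> (UNIV :: real set))" using oO by (simp add: open_Times)
      have "C_upto k (O' \<times> (UNIV :: real set)) (\<lambda>p. \<tau> (fst p))"
      proof (rule C_upto_componentwise[OF oU])
        fix e :: "real ^ 'n"
        have "C_upto k O' (\<lambda>y. \<tau> y \<bullet> e)"
          using \<tau> by (intro C_upto_linear_comp[OF bounded_linear_inner_left oO]) (simp add: C_infty_iff)
        then show "C_upto k (O' \<times> (UNIV :: real set)) (\<lambda>p. \<tau> (fst p) \<bullet> e)"
          by (rule C_upto_compose[OF oU C_upto_linear[OF bounded_linear_fst oU], where g = "\<lambda>y. \<tau> y \<bullet> e" and U = O']) auto
      qed
      then show "C_upto k (O' \<times> (UNIV :: real set)) (\<lambda>p. (\<tau> (fst p), snd p))"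
        by (rule C_upto_Pair[OF oU _ C_upto_linear[OF bounded_linear_snd oU]])
    qed
    define W' where "W' = (O' \<times> UNIV) \<inter> m -` (W \<inter> V \<times> UNIV)"
    have oW: "open W'" unfolding W'_def
      by (rule continuous_open_preimage[OF C_infty_continuous_on0[OF m]])
         (use oO W(1) V(1) in \<open>auto intro!: open_Times open_Int\<close>)
    have "C_infty W' (\<lambda>p. E (\<psi> (m p)))"
      unfolding C_infty_iff
    proof
      fix k
      have "C_upto k W' m" using m by (auto simp: C_infty_iff W'_def intro: C_upto_subset)
      then have "C_upto k W' (\<lambda>p. \<psi> (m p))"
        by (rule C_upto_compose[OF oW, where U = W]) (use \<psi> in \<open>auto simp: C_infty_iff W'_def\<close>)
      then show "C_upto k W' (\<lambda>p. E (\<psi> (m p)))"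
        by (rule C_upto_compose[OF oW, where U = UNIV]) (use E(1) in \<open>auto simp: C_infty_iff\<close>)
    qed
    moreover have "q \<in> W'"
    proof -
      have "chart_inv c' z \<in> chart_dom c" "coord c (chart_inv c' z) \<in> V" using True mem_V_iff by blast+
      moreover have "z \<in> O'" unfolding O'_def in_transition_dom[OF c'] using calculation q by blast
      ultimately show ?thesis using W(2) t by (auto simp: W'_def m_def q \<tau>_def)
    qed
    moreover have "E (\<psi> (m p)) = (case p of (z, t) \<Rightarrow> in_chart c' f t z)" if "p \<in> W'" for p
    proof -
      obtain y s where p: "p = (y, s)" by (cases p)
      have y: "y \<in> O'" "\<tau> y \<in> V" using that by (auto simp: W'_def m_def p)
      then have "chart_inv c' y \<in> chart_dom c" unfolding O'_def in_transition_dom[OF c'] by blast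
      then have "chart_inv c' y \<in> chart_inv c ` V" using y(2) mem_V_iff by (simp add: \<tau>_def)
      then show ?thesis by (simp add: p in_chart_def f_def m_def \<tau>_def)
    qed
    ultimately have "?R W' (\<lambda>p. E (\<psi> (m p)))" using oW by (auto simp: C_infty_def)
    then show ?thesis by blast
  next
    case False
    define W' where "W' = coord c' ` ((- (chart_inv c ` C)) \<inter> chart_dom c') \<times> (UNIV :: real set)"
    have "compact (chart_inv c ` C)" using C V(2) by (intro compact_chart_inv_image c) auto
    then have "open (- (chart_inv c ` C))" by (simp add: compact_imp_closed open_Compl)
    then have oW: "open W'" unfolding W'_def using open_coord_image[OF c'] by (simp add: open_Times)
    moreover have "q \<in> W'"
    proof -
      have "chart_inv c' z \<in> (- (chart_inv c ` C)) \<inter> chart_dom c'"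
        using False C(2) q chart_inv_in_dom[OF c'] by blast
      then have "coord c' (chart_inv c' z) \<in> coord c' ` ((- (chart_inv c ` C)) \<inter> chart_dom c')" by blast
      then show ?thesis using coord_chart_inv[OF c' q(2)] by (simp add: W'_def q)
    qed
    moreover have "\<forall>vs. \<forall>y\<in>W'. iter_deriv vs (\<lambda>_. 1 :: real) differentiable (at y)"
      using C_upto_const[OF oW] unfolding C_upto_def by blast
    moreover have "1 = (case p of (z, t) \<Rightarrow> in_chart c' f t z)" if pW: "p \<in> W' \<inter> (chart_img c' \<times> {a..d})" for p
    proof -
      obtain y s where p: "p = (y, s)" by (cases p)
      obtain x where x: "x \<in> - (chart_inv c ` C)" "x \<in> chart_dom c'" "y = coord c' x"
        using pW unfolding W'_def p by blast
      have s: "s \<in> {a..b}" using pW d by (auto simp: p)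
      have "chart_inv c' y = x" using x chart_inv_coord[OF c'] by simp
      moreover have "f x s = 1"
      proof (cases "x \<in> chart_inv c ` V")
        case True
        then obtain w where w: "w \<in> V" "x = chart_inv c w" by blast
        then have "w \<in> V - C" using x(1) by blast
        from \<theta>(2)[OF this s] show ?thesis using f_chart[OF w(1)] w(2) E(3) by simp
      qed (simp add: f_def)
      ultimately show ?thesis by (simp add: p in_chart_def)
    qed
    ultimately have "?R W' (\<lambda>_. 1)" by auto
    then show ?thesis by blast
  qed
qed

text \<open>By the chain rule the differential of \<open>f\<close> in another chart is that of \<open>\<psi>\<close>, composed with the derivative of the
transition map \<open>\<tau>\<close>; the latter is invertible, with inverse the derivative of the reverse transition
map \<open>\<sigma>\<close>.\<close>

lemma f_gradient:
  assumes h: "riemannian_metric A h" and c': "c' \<in> A" and x: "x \<in> chart_dom c'" and t: "t \<in> {a..b}"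
    and f0: "f x t = 0"
  shows "rgrad (h c') (in_chart c' f t) (coord c' x) \<noteq> 0"
proof -
  interpret h: riemannian A h by unfold_locales (rule h)
  have xV: "x \<in> chart_inv c ` V" using f0 by (auto simp: f_def split: if_splits)
  then have xc: "x \<in> chart_dom c" "coord c x \<in> V" using mem_V_iff by blast+
  define z where "z = coord c x"
  define z' where "z' = coord c' x"
  have \<psi>0: "\<psi> (z, t) = 0" using f0 xV by (simp add: f_def E_zero z_def)
  have zW: "(z, t) \<in> W" using W(2) xc(2) t by (auto simp: z_def)
  obtain j where j: "iter_deriv [(axis j 1, 0)] \<psi> (z, t) \<noteq> 0"
    using grad[OF _ t \<psi>0] xc(2) by (auto simp: z_def covector_def vec_eq_iff)
  define \<tau> where "\<tau> = coord c \<circ> chart_inv c'"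
  define \<sigma> where "\<sigma> = coord c' \<circ> chart_inv c"
  define O' where "O' = coord c' ` (chart_dom c' \<inter> chart_dom c)"
  define P where "P = coord c ` (chart_dom c \<inter> chart_dom c')"
  have \<tau>: "C_infty O' \<tau>" unfolding O'_def \<tau>_def by (rule transition_C_infty[OF c' c])
  have \<sigma>: "C_infty P \<sigma>" unfolding P_def \<sigma>_def by (rule transition_C_infty[OF c c'])
  have oO: "open O'" "open P"
    unfolding O'_def P_def by (rule open_transition_dom[OF c' c], rule open_transition_dom[OF c c'])
  have zO: "z' \<in> O'" "z \<in> P" using x xc by (auto simp: z_def z'_def O'_def P_def)
  have \<tau>z: "\<tau> z' = z" and \<sigma>z: "\<sigma> z = z'"
    using chart_inv_coord[OF c'] chart_inv_coord[OF c] x xc by (simp_all add: \<tau>_def \<sigma>_def z_def z'_def)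
  have "((\<lambda>y. \<tau> (\<sigma> y)) has_derivative (\<lambda>v. frechet_derivative \<tau> (at z') (frechet_derivative \<sigma> (at z) v))) (at z)"
    using has_derivative_compose[OF C_infty_has_derivative[OF \<sigma> zO(2)], of \<tau> "frechet_derivative \<tau> (at z')"]
      C_infty_has_derivative[OF \<tau> zO(1)] by (simp add: \<sigma>z)
  moreover have "\<tau> (\<sigma> y) = y" if yP: "y \<in> P" for y
  proof -
    obtain w where w: "w \<in> chart_dom c" "w \<in> chart_dom c'" "y = coord c w" using yP unfolding P_def by blast
    then show ?thesis using chart_inv_coord[OF c'] chart_inv_coord[OF c] by (simp add: \<tau>_def \<sigma>_def)
  qed
  ultimately have "((\<lambda>y. y) has_derivative (\<lambda>v. frechet_derivative \<tau> (at z') (frechet_derivative \<sigma> (at z) v))) (at z)"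
    by (rule has_derivative_transform_within_open[OF _ oO(2) zO(2)])
  then have inv: "frechet_derivative \<tau> (at z') (frechet_derivative \<sigma> (at z) v) = v" for v
    using has_derivative_unique[OF _ has_derivative_ident] by metis
  define u where "u = in_chart c' f t"
  define m where "m y = (\<tau> y, t)" for y
  define W' where "W' = O' \<inter> m -` (W \<inter> V \<times> UNIV)"
  have mcont: "continuous_on O' m"
    unfolding m_def by (intro continuous_intros C_infty_continuous_on0[OF \<tau>])
  have oW: "open W'"
    unfolding W'_def by (rule continuous_open_preimage[OF mcont oO(1)])
       (use W(1) V(1) in \<open>auto intro!: open_Times open_Int\<close>)
  have zW': "z' \<in> W'" using zO zW xc(2) by (simp add: W'_def m_def \<tau>z z_def[symmetric])
  have "continuous_on W' (\<lambda>y. \<psi> (m y))"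
    by (rule continuous_on_compose2[OF C_infty_continuous_on0[OF \<psi>] continuous_on_subset[OF mcont]])
       (auto simp: W'_def)
  then have oN: "open (W' \<inter> (\<lambda>y. \<psi> (m y)) -` {..<\<theta>/2})"
    by (rule continuous_open_preimage[OF _ oW]) simp
  have zN: "z' \<in> W' \<inter> (\<lambda>y. \<psi> (m y)) -` {..<\<theta>/2}"
    using zW' \<psi>0 \<theta>(1) by (simp add: m_def \<tau>z)
  have "(m has_derivative (\<lambda>v. (frechet_derivative \<tau> (at z') v, 0))) (at z')"
    unfolding m_def by (intro has_derivative_Pair C_infty_has_derivative[OF \<tau> zO(1)] has_derivative_const)
  from has_derivative_compose[OF this, of \<psi> "frechet_derivative \<psi> (at (z, t))"]
  have "((\<lambda>y. \<psi> (m y)) has_derivative (\<lambda>v. frechet_derivative \<psi> (at (z, t)) (frechet_derivative \<tau> (at z') v, 0))) (at z')"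
    using C_infty_has_derivative[OF \<psi> zW] by (simp add: m_def \<tau>z)
  then have du: "(u has_derivative (\<lambda>v. frechet_derivative \<psi> (at (z, t)) (frechet_derivative \<tau> (at z') v, 0))) (at z')"
  proof (rule has_derivative_transform_within_open[OF _ oN zN])
    fix y assume y: "y \<in> W' \<inter> (\<lambda>y. \<psi> (m y)) -` {..<\<theta>/2}"
    then have "y \<in> O'" "\<tau> y \<in> V" by (auto simp: W'_def m_def)
    then have "chart_inv c' y \<in> chart_dom c" unfolding O'_def in_transition_dom[OF c'] by blast
    then have "chart_inv c' y \<in> chart_inv c ` V" using \<open>\<tau> y \<in> V\<close> mem_V_iff by (simp add: \<tau>_def)
    then show "\<psi> (m y) = u y"
      using y E(2)[of "\<psi> (m y)"] by (simp add: u_def in_chart_def f_def m_def \<tau>_def)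
  qed
  have udiff: "u differentiable (at z')" using du by (auto simp: differentiable_def)
  have z'img: "z' \<in> chart_img c'" using x by (simp add: z'_def)
  have ne: "frechet_derivative u (at z') (frechet_derivative \<sigma> (at z) (axis j 1)) \<noteq> 0"
    unfolding frechet_derivative_at[OF du, symmetric] inv using j by simp
  have "(\<chi> j. frechet_derivative u (at z') (axis j 1)) \<noteq> 0"
  proof
    assume 0: "(\<chi> j. frechet_derivative u (at z') (axis j 1)) = 0"
    have 0: "frechet_derivative u (at z') (axis j 1) = 0" for j
      using arg_cong[OF 0, of "\<lambda>v. v $ j"] by simp
    have lin: "linear (frechet_derivative u (at z'))" using udiff by (rule linear_frechet_derivative)
    have "frechet_derivative u (at z') v = 0" for v
      by (subst linear_axis_expansion[OF lin]) (simp add: 0)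
    then show False using ne by blast
  qed
  then show ?thesis
    using h.rgrad_eq_raised(5)[OF c' z'img udiff] unfolding u_def z'_def by simp
qed

lemma smooth_barrier_K:
  assumes "riemannian_metric A h" "a < d" "d \<le> b"
  shows "smooth_barrier A h a d f K" "compact_barrier a d K"
proof -
  show "smooth_barrier A h a d f K"
    unfolding smooth_barrier_def
    using assms f_smooth f_gradient[OF assms(1)] by (auto simp: K_def)
  show "compact_barrier a d K"
    unfolding compact_barrier_def by (rule compact_K[OF assms(3)])
qed

lemma K_interior:
  assumes "z \<in> V" "t \<in> {a..b}" "\<psi> (z, t) < 0"
  shows "chart_inv c z \<in> interior (K t)"
proof -
  have "continuous_on V (\<lambda>y. \<psi> (y, t))"
    by (rule continuous_on_compose2[OF \<psi>_continuous]) (use assms(2) in \<open>auto intro!: continuous_intros\<close>)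
  then have "open (V \<inter> (\<lambda>y. \<psi> (y, t)) -` {..<0})"
    by (rule continuous_open_preimage[OF _ V(1)]) simp
  then have "open (chart_inv c ` (V \<inter> (\<lambda>y. \<psi> (y, t)) -` {..<0}))"
    using V(2) by (intro open_chart_inv_image c) auto
  moreover have "chart_inv c z \<in> chart_inv c ` (V \<inter> (\<lambda>y. \<psi> (y, t)) -` {..<0})"
    using assms by auto
  moreover have "chart_inv c ` (V \<inter> (\<lambda>y. \<psi> (y, t)) -` {..<0}) \<subseteq> K t"
    using f_chart E(4) by (auto simp: K_def)
  ultimately show ?thesis by (rule interiorI)
qed

lemma barrier_Phi_K:
  assumes h: "riemannian_metric A h" and z: "z \<in> V" "\<psi> (z, d) = 0" and d: "a < d" "d \<le> b"
  shows "barrier_Phi h c a d f (chart_inv c z) d = level_Phi (h c) \<psi> (z, d)"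
proof -
  interpret h: riemannian A h by unfold_locales (rule h)
  have oWV: "open (W \<inter> V \<times> UNIV)" using W(1) V(1) by (intro open_Int open_Times) auto
  define W' where "W' = (W \<inter> V \<times> UNIV) \<inter> \<psi> -` {..<\<theta>/2}"
  have "continuous_on (W \<inter> V \<times> UNIV) \<psi>"
    by (rule continuous_on_subset[OF C_infty_continuous_on0[OF \<psi>]]) auto
  then have oW: "open W'"
    unfolding W'_def by (rule continuous_open_preimage[OF _ oWV]) simp
  have zi: "z \<in> chart_img c" using z V(2) by blast
  show ?thesis
  proof (rule h.barrier_Phi_eq_level_Phi[OF c _ _ d(1) _ oW])
    show "chart_inv c z \<in> chart_dom c" using chart_inv_in_dom[OF c zi] .
    show "z = coord c (chart_inv c z)" using coord_chart_inv[OF c zi] by simp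
    show "C_infty W' \<psi>" by (rule C_infty_subset[OF \<psi>]) (auto simp: W'_def)
    show "(z, d) \<in> W'" using W(2) z d \<theta>(1) by (auto simp: W'_def)
    show "covector \<psi> (z, d) \<noteq> 0" using grad z d by simp
    show "f (chart_inv c y) s = \<psi> (y, s)" if "(y, s) \<in> W'" for y s
      using that f_chart[of y s] E(2)[of "\<psi> (y, s)"] by (auto simp: W'_def)
  qed
qed

end

section \<open>First contact and passage to the limit\<close>

locale limit_flow = riemannian A g
  for A :: "('a::{t2_space, second_countable_topology}, 'n::finite) chart set"
    and g :: "('a, 'n) metric_field" +
  fixes gs :: "nat \<Rightarrow> ('a, 'n) metric_field" and Zs :: "nat \<Rightarrow> ('a \<times> real) set"
    and Z :: "('a \<times> real) set"
  assumes metrics: "\<And>n. riemannian_metric A (gs n)"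
    and conv: "metrics_converge_smoothly A gs g"
    and flows: "\<And>n. weak_set_flow A (gs n) (Zs n)"
    and kuratowski: "kuratowski_converges (UNIV \<times> {0..}) (parabolic_dist A g) Zs Z"
begin

lemma Zs_subset: "Zs n \<subseteq> UNIV \<times> {0..}" and Zs_closed: "closed (Zs n)"
  using flows[of n] by (simp_all add: weak_set_flow_def)

lemma Z_subset: "Z \<subseteq> UNIV \<times> {0..}"
  using kuratowski unfolding kuratowski_converges_def by blast

lemma Z_closed: "closed Z"
  by (rule kuratowski_limit_closed[OF kuratowski Zs_subset])

end

text \<open>A strict barrier for the limit \<open>Z\<close>: it misses \<open>Z\<close> at the start, and \<open>\<Phi>\<close> is negative at its boundary
points in \<open>Z\<close>.\<close>

locale limit_flow_barrier = limit_flow A g gs Zs Z + local_level_set A c V C a b \<theta> W \<psi> E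
  for A :: "('a::{t2_space, second_countable_topology}, 'n::finite) chart set"
    and g gs Zs Z c V C a b \<theta> W \<psi> E +
  assumes ab: "0 \<le> a" "a < b"
    and start: "\<And>z. z \<in> V \<Longrightarrow> \<psi> (z, a) \<le> 0 \<Longrightarrow> (chart_inv c z, a) \<notin> Z"
    and strict: "\<And>z t. z \<in> V \<Longrightarrow> t \<in> {a..b} \<Longrightarrow> \<psi> (z, t) = 0 \<Longrightarrow> (chart_inv c z, t) \<in> Z \<Longrightarrow>
      level_Phi (g c) \<psi> (z, t) < 0"
begin

definition event :: "(real ^ 'n) \<times> real \<Rightarrow> 'a \<times> real" where
  "event q = (chart_inv c (fst q), snd q)"

lemma event_continuous: "continuous_on (C \<times> X) event"
  unfolding event_def
  by (intro continuous_on_Pair continuous_on_snd continuous_on_id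
      continuous_on_compose2[OF continuous_on_chart_inv[OF c] continuous_on_fst[OF continuous_on_id]])
     (use C(2) V(2) in auto)

lemma C_sub: "C \<times> {a..b} \<subseteq> V \<times> {a..b}" using C(2) by auto

lemma C_compact: "compact (C \<times> {a..b})" using C(1) by (simp add: compact_Times)

text \<open>The set \<open>X\<close> of contacts is compact.  The weak set flow property is used for the barrier up to the smallest contact time
\<open>d\<close>; it excludes contact in the interior, so \<open>\<psi> = 0\<close> at a contact at time \<open>d\<close>.\<close>

lemma first_contact:
  assumes disj: "\<And>z. z \<in> C \<Longrightarrow> \<psi> (z, a) \<le> 0 \<Longrightarrow> event (z, a) \<notin> Zs n"
    and meet: "z0 \<in> V" "t0 \<in> {a..b}" "\<psi> (z0, t0) \<le> 0" "event (z0, t0) \<in> Zs n"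
  obtains q where "q \<in> C \<times> {a..b}" "\<psi> q = 0" "event q \<in> Zs n" "level_Phi (gs n c) \<psi> q \<ge> 0"
proof -
  define X where "X = (C \<times> {a..b}) \<inter> (\<lambda>q. (\<psi> q, event q)) -` ({..0} \<times> Zs n)"
  have cX: "compact X" unfolding X_def
    by (rule compact_closed_preimage[OF C_compact])
       (intro continuous_on_Pair continuous_on_subset[OF \<psi>_continuous C_sub] event_continuous,
        simp add: closed_Times Zs_closed)
  have "z0 \<in> C" using \<theta>(1) \<theta>(2)[of z0 t0] meet by force
  then have "(z0, t0) \<in> X" using meet by (simp add: X_def)
  then have "X \<noteq> {}" by blast
  from continuous_attains_inf[OF cX this continuous_on_snd[OF continuous_on_id]]
  obtain q where q: "q \<in> X" "\<And>q'. q' \<in> X \<Longrightarrow> snd q \<le> snd q'" by auto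
  obtain z d where qd: "q = (z, d)" by (cases q)
  have z: "z \<in> C" "d \<in> {a..b}" "\<psi> (z, d) \<le> 0" "event (z, d) \<in> Zs n" using q(1) by (auto simp: X_def qd)
  have zV: "z \<in> V" using z(1) C(2) by blast
  have "d \<noteq> a" using disj[of z] z by auto
  then have d: "a < d" "d \<le> b" using z(2) by auto
  have noK: "K t \<inter> time_slice (Zs n) t = {}" if t: "t \<in> {a..<d}" for t
  proof (rule ccontr)
    assume "K t \<inter> time_slice (Zs n) t \<noteq> {}"
    then obtain x where x: "x \<in> K t" "(x, t) \<in> Zs n" by (auto simp: time_slice_def)
    have tb: "t \<in> {a..b}" using t d by auto
    obtain w where w: "w \<in> C" "\<psi> (w, t) \<le> 0" "x = chart_inv c w"
      using x(1) unfolding K_chart[OF tb] by blast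
    then have "(w, t) \<in> X" using x(2) tb by (simp add: X_def event_def)
    from q(2)[OF this] show False using t by (simp add: qd)
  qed
  have zK: "chart_inv c z \<in> K d \<inter> time_slice (Zs n) d"
    using z K_chart[OF z(2)] by (auto simp: time_slice_def event_def)
  have wsf: "\<And>a b f K p. 0 \<le> a \<and> smooth_barrier A (gs n) a b f K \<and> compact_barrier a b K \<and>
        (\<forall>t\<in>{a..<b}. K t \<inter> time_slice (Zs n) t = {}) \<and> p \<in> K b \<inter> time_slice (Zs n) b \<Longrightarrow>
          p \<in> frontier (K b) \<and> (\<forall>c\<in>A. p \<in> chart_dom c \<longrightarrow> barrier_Phi (gs n) c a b f p b \<ge> 0)"
    using flows[of n] unfolding weak_set_flow_def by blast
  have "chart_inv c z \<in> frontier (K d) \<and>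
      (\<forall>c'\<in>A. chart_inv c z \<in> chart_dom c' \<longrightarrow> barrier_Phi (gs n) c' a d f (chart_inv c z) d \<ge> 0)"
    by (rule wsf) (use ab(1) smooth_barrier_K[OF metrics d] noK zK in blast)
  then have fr: "chart_inv c z \<in> frontier (K d)" and
      Ph: "chart_inv c z \<in> chart_dom c \<Longrightarrow> barrier_Phi (gs n) c a d f (chart_inv c z) d \<ge> 0"
    using c by blast+
  have \<psi>0: "\<psi> (z, d) = 0"
  proof (rule ccontr)
    assume "\<psi> (z, d) \<noteq> 0"
    then have "chart_inv c z \<in> interior (K d)" using K_interior[OF zV z(2)] z(3) by simp
    then show False using fr by (simp add: frontier_def)
  qed
  have "chart_inv c z \<in> chart_dom c" using zV V(2) chart_inv_in_dom[OF c] by blast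
  then have "level_Phi (gs n c) \<psi> (z, d) \<ge> 0"
    using Ph barrier_Phi_K[OF metrics zV \<psi>0 d] by simp
  then show ?thesis using that[of q] z \<psi>0 by (simp add: qd)
qed

text \<open>If \<open>Z\<close> contained a point of \<open>{\<psi> < 0}\<close>, then for all large \<open>n\<close> the flow \<open>Zs n\<close> would enter the open set \<open>U\<close> and miss the
compact initial set \<open>S\<close>, so it would have a first contact with \<open>\<Phi> \<ge> 0\<close>.  A subsequential limit \<open>l\<close> of these
contacts lies in \<open>Z\<close> and contradicts the strictness of the barrier.\<close>

lemma limit_avoids_interior:
  assumes z0: "z0 \<in> V" and t0: "a < t0" "t0 < b" and neg: "\<psi> (z0, t0) < 0"
  shows "(chart_inv c z0, t0) \<notin> Z"
proof
  assume inZ: "(chart_inv c z0, t0) \<in> Z"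
  define S where "S = (\<lambda>z. event (z, a)) ` {z \<in> C. \<psi> (z, a) \<le> 0}"
  have "compact S"
  proof -
    have cs: "continuous_on C (\<lambda>z. (z, a))" by (intro continuous_intros)
    have im: "(\<lambda>z. (z, a)) ` C \<subseteq> C \<times> {a..b}" using ab by auto
    have "continuous_on C (\<lambda>z. \<psi> (z, a))"
      by (rule continuous_on_compose2[OF continuous_on_subset[OF \<psi>_continuous C_sub] cs im])
    from compact_closed_preimage[OF C(1) this, of "{..0}"]
    have "compact {z \<in> C. \<psi> (z, a) \<le> 0}" by (simp add: vimage_def Int_def)
    moreover have "continuous_on {z \<in> C. \<psi> (z, a) \<le> 0} (\<lambda>z. event (z, a))"
      by (rule continuous_on_subset[OF continuous_on_compose2[OF event_continuous cs im]]) auto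
    ultimately show ?thesis unfolding S_def by (rule compact_continuous_image[rotated])
  qed
  moreover have "S \<inter> Z = {}" using start C(2) by (auto simp: S_def event_def)
  ultimately have ev1: "\<forall>\<^sub>F n in sequentially. Zs n \<inter> S = {}"
    by (rule kuratowski_limit_avoids_compact[OF kuratowski Zs_subset])
  define U where "U = event ` ((V \<times> {a<..<b}) \<inter> \<psi> -` {..<0})"
  have "open U"
  proof -
    have oc: "open (chart_inv c ` V)" by (rule open_chart_inv_image[OF c V])
    define h where "h p = (coord c (fst p), snd p)" for p :: "'a \<times> real"
    have h: "continuous_on (chart_inv c ` V \<times> {a<..<b}) h"
      unfolding h_def
      by (intro continuous_on_Pair continuous_on_snd continuous_on_id
          continuous_on_compose2[OF continuous_on_coord[OF c] continuous_on_fst[OF continuous_on_id]])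
         (use mem_V_iff in auto)
    have him: "h ` (chart_inv c ` V \<times> {a<..<b}) \<subseteq> V \<times> {a..b}"
    proof (rule image_subsetI)
      fix p assume "p \<in> chart_inv c ` V \<times> {a<..<b}"
      then have "fst p \<in> chart_inv c ` V" "snd p \<in> {a<..<b}" by auto
      then show "h p \<in> V \<times> {a..b}" unfolding mem_V_iff by (simp add: h_def)
    qed
    have "continuous_on (chart_inv c ` V \<times> {a<..<b}) (\<lambda>p. \<psi> (h p))"
      by (rule continuous_on_compose2[OF \<psi>_continuous h him])
    from continuous_open_preimage[OF this, of "{..<0}"]
    have "open ((chart_inv c ` V \<times> {a<..<b}) \<inter> (\<lambda>p. \<psi> (h p)) -` {..<0})"
      using oc by (simp add: open_Times)
    moreover have "(chart_inv c ` V \<times> {a<..<b}) \<inter> (\<lambda>p. \<psi> (h p)) -` {..<0} = U"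
    proof -
      have hP: "h (event q) = q" if "fst q \<in> V" for q
        using that V(2) coord_chart_inv[OF c] by (auto simp: h_def event_def subset_iff)
      have "(chart_inv c ` V \<times> {a<..<b}) = event ` (V \<times> {a<..<b})"
        by (force simp: event_def)
      then show ?thesis unfolding U_def using hP by force
    qed
    ultimately show ?thesis by simp
  qed
  moreover have "(chart_inv c z0, t0) \<in> U"
    unfolding U_def using z0 t0 neg by (intro image_eqI[of _ _ "(z0, t0)"]) (auto simp: event_def)
  ultimately have ev2: "\<forall>\<^sub>F n in sequentially. Zs n \<inter> U \<noteq> {}"
    by (rule kuratowski_limit_meets_open[OF kuratowski _ inZ])
  define R where "R n q \<longleftrightarrow> q \<in> C \<times> {a..b} \<and> \<psi> q = 0 \<and> event q \<in> Zs n \<and> level_Phi (gs n c) \<psi> q \<ge> 0" for n q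
  have "\<forall>\<^sub>F n in sequentially. \<exists>q. R n q"
    using ev1 ev2
  proof eventually_elim
    case (elim n)
    then obtain q where q: "q \<in> V \<times> {a<..<b}" "\<psi> q < 0" "event q \<in> Zs n" unfolding U_def by blast
    have "event (z, a) \<notin> Zs n" if "z \<in> C" "\<psi> (z, a) \<le> 0" for z
      using elim(1) that unfolding S_def by blast
    then obtain q' where "q' \<in> C \<times> {a..b}" "\<psi> q' = 0" "event q' \<in> Zs n" "level_Phi (gs n c) \<psi> q' \<ge> 0"
      by (rule first_contact[of n "fst q" "snd q"]) (use q in auto)
    then show ?case unfolding R_def by blast
  qed
  then obtain N where N: "\<And>n. n \<ge> N \<Longrightarrow> \<exists>q. R n q" unfolding eventually_sequentially by blast
  define s where "s k = (SOME q. R (k + N) q)" for k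
  have s: "R (k + N) (s k)" for k unfolding s_def using someI_ex[OF N[of "k + N"]] by simp
  have "\<forall>k. s k \<in> C \<times> {a..b}" using s by (simp add: R_def)
  then obtain l r where l: "l \<in> C \<times> {a..b}" and r: "strict_mono r" and lim: "(s \<circ> r) \<longlonglongrightarrow> l"
    using C_compact unfolding compact_def by metis
  have "\<psi> l = 0"
  proof -
    have "(\<lambda>k. \<psi> ((s \<circ> r) k)) \<longlonglongrightarrow> \<psi> l"
      by (rule continuous_on_tendsto_compose[OF continuous_on_subset[OF \<psi>_continuous C_sub] lim l])
         (use s in \<open>simp add: R_def\<close>)
    moreover have "(\<lambda>k. \<psi> ((s \<circ> r) k)) = (\<lambda>k. 0)" using s by (simp add: R_def)
    ultimately show ?thesis using LIMSEQ_unique tendsto_const by metis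
  qed
  have fl: "filterlim (\<lambda>k. r k + N) sequentially sequentially"
    using filterlim_subseq[OF r] filterlim_compose[OF filterlim_add_const_nat_at_top] by blast
  have "event l \<in> Z"
  proof (rule ccontr)
    assume "event l \<notin> Z"
    then obtain O' where O': "open O'" "event l \<in> O'" "\<forall>\<^sub>F n in sequentially. Zs n \<inter> O' = {}"
      by (rule kuratowski_limit_avoids_near[OF kuratowski Zs_subset])
    have "(\<lambda>k. event ((s \<circ> r) k)) \<longlonglongrightarrow> event l"
      by (rule continuous_on_tendsto_compose[OF event_continuous lim l]) (use s in \<open>simp add: R_def\<close>)
    from topological_tendstoD[OF this O'(1,2)] eventually_compose_filterlim[OF O'(3) fl]
    have "\<forall>\<^sub>F k in sequentially. False"
    proof eventually_elim
      case (elim k)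
      have "event (s (r k)) \<in> Zs (r k + N)" using s[of "r k"] by (simp add: R_def)
      then show ?case using elim by auto
    qed
    then show False by simp
  qed
  have lV: "fst l \<in> V" "snd l \<in> {a..b}" using l C(2) by (auto simp: mem_Times_iff)
  have lW: "l \<in> W" using W(2) lV by (metis mem_Times_iff subsetD)
  have nz: "covector \<psi> l \<noteq> 0" using grad[OF lV] \<open>\<psi> l = 0\<close> by simp
  have img: "fst l \<in> chart_img c" using lV(1) V(2) by blast
  have "(\<lambda>k. level_Phi (gs (r k + N) c) \<psi> ((s \<circ> r) k)) \<longlonglongrightarrow> level_Phi (g c) \<psi> l"
    by (rule level_Phi_tendsto_metrics[OF conv c img \<psi> W(1) lW nz fl lim])
  then have "0 \<le> level_Phi (g c) \<psi> l"
    by (rule LIMSEQ_le_const) (use s in \<open>auto simp: R_def\<close>)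
  moreover have "level_Phi (g c) \<psi> l < 0"
    using strict[OF lV] \<open>\<psi> l = 0\<close> \<open>event l \<in> Z\<close> by (simp add: event_def)
  ultimately show False by simp
qed

end

section \<open>Points of the limit have a past\<close>

lemma C_infty_affine_time: "C_infty (UNIV :: ((real ^ 'n::finite) \<times> real) set) (\<lambda>q. d * snd q + k)"
  unfolding C_infty_iff
  by (intro allI C_upto_add C_upto_mult C_upto_const C_upto_linear bounded_linear_snd open_UNIV)

text \<open>Adding a function of time alone changes only the velocity term.  With \<open>d > 0\<close> the region shrinks
faster; with \<open>d = 0\<close> the height of the level set is shifted.\<close>

lemma
  fixes \<psi> :: "(real ^ 'n::finite) \<times> real \<Rightarrow> real"
  assumes W: "open W" "C_infty W \<psi>" "q \<in> W"
  shows covector_add_affine_time: "covector (\<lambda>q. \<psi> q + (d * snd q + k)) q = covector \<psi> q"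
    and level_Phi_add_affine_time: "level_Phi G (\<lambda>q. \<psi> q + (d * snd q + k)) q =
      level_Phi G \<psi> q - d / sqrt (covector \<psi> q \<bullet> raised (jet G \<psi> q))"
proof -
  let ?l = "\<lambda>q :: (real ^ 'n) \<times> real. d * snd q + k"
  have "(?l has_derivative (\<lambda>v. d * snd v)) (at y)" for y
    by (auto intro!: derivative_eq_intros)
  note fd = frechet_derivative_at[OF this, symmetric]
  have 1: "iter_deriv [v] ?l = (\<lambda>_. d * snd v)" for v by (simp add: fd)
  have 2: "iter_deriv [v, w] ?l = (\<lambda>_. 0)" for v w
    by (subst iter_deriv.simps) (simp add: 1 fun_eq_iff del: iter_deriv.simps)
  have add: "iter_deriv vs (\<lambda>q. \<psi> q + ?l q) q = iter_deriv vs \<psi> q + iter_deriv vs ?l q" for vs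
    by (rule iter_deriv_add[OF W(1,2) C_infty_subset[OF C_infty_affine_time] W(3)]) simp
  show cov: "covector (\<lambda>q. \<psi> q + ?l q) q = covector \<psi> q"
    unfolding covector_def add 1 by simp
  then have J: "jet G (\<lambda>q. \<psi> q + ?l q) q = jet G \<psi> q" unfolding jet_def by simp
  have dJ: "djet G (\<lambda>q. \<psi> q + ?l q) q i = djet G \<psi> q i" for i
    unfolding djet_def add 2 by simp
  show "level_Phi G (\<lambda>q. \<psi> q + ?l q) q =
      level_Phi G \<psi> q - d / sqrt (covector \<psi> q \<bullet> raised (jet G \<psi> q))"
    unfolding level_Phi_def cov J dJ add 1 by (simp add: add_divide_distrib)
qed

lemma radial_square_has_derivative:
  "((\<lambda>q :: (real ^ 'n::finite) \<times> real. (fst q - z0) \<bullet> (fst q - z0)) has_derivative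
     (\<lambda>v. 2 * ((fst q - z0) \<bullet> fst v))) (at q)"
  by (auto intro!: derivative_eq_intros simp: inner_commute)

lemma C_infty_radial_square:
  "C_infty UNIV (\<lambda>q :: (real ^ 'n::finite) \<times> real. (fst q - z0) \<bullet> (fst q - z0))"
  unfolding C_infty_iff inner_vec_def inner_real_def
proof
  fix k
  have "C_upto k UNIV (\<lambda>q :: (real ^ 'n) \<times> real. (fst q - z0) $ i)" for i
    unfolding vector_minus_component
    by (intro C_upto_diff C_upto_const C_upto_linear open_UNIV
        bounded_linear_compose[OF bounded_linear_vec_nth bounded_linear_fst])
  then show "C_upto k UNIV (\<lambda>q :: (real ^ 'n) \<times> real. \<Sum>i\<in>UNIV. (fst q - z0) $ i * (fst q - z0) $ i)"
    by (intro C_upto_sum C_upto_mult open_UNIV)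
qed

lemma covector_radial_square:
  "covector (\<lambda>q :: (real ^ 'n::finite) \<times> real. (fst q - z0) \<bullet> (fst q - z0)) q = 2 *\<^sub>R (fst q - z0)"
  using frechet_derivative_at[OF radial_square_has_derivative[of z0 q], symmetric]
  by (simp add: covector_def vec_eq_iff inner_axis)

context limit_flow
begin

lemma compact_annulus_slab:
  "compact ({z :: real ^ 'n. r \<le> norm (z - z0) \<and> norm (z - z0) \<le> s} \<times> {t..t' :: real})"
proof -
  have "{z :: real ^ 'n. r \<le> norm (z - z0) \<and> norm (z - z0) \<le> s} = cball z0 s - ball z0 r"
    by (auto simp: dist_norm norm_minus_commute)
  then show ?thesis by (simp add: compact_Times compact_diff)
qed

text \<open>Were there no points of \<open>Z\<close> near \<open>x0\<close> shortly before time \<open>b\<close>, a coordinate ball around \<open>x0\<close> could be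
started at time \<open>b - \<tau>\<close> without touching \<open>Z\<close>.  The square of its radius is \<open>\<rho>\<^sup>2\<close> at the start and decreases at the
constant rate \<open>d\<close>.  For a large rate, \<open>\<Phi> < 0\<close> on all spheres of radius between \<open>\<rho>/2\<close> and
\<open>\<rho>\<close>, and for small \<open>\<tau>\<close> the ball still has radius at least \<open>\<rho>/2\<close> at time \<open>b + \<tau>\<close>.  It contains \<open>x0\<close> at time
\<open>b\<close>, which contradicts \<open>limit_avoids_interior\<close>.\<close>

lemma limit_has_past:
  assumes Z: "(x0, b) \<in> Z" and b: "0 < b" and U: "open U" "x0 \<in> U" and \<delta>: "0 < \<delta>"
  obtains x t where "x \<in> U" "b - \<delta> < t" "t < b" "(x, t) \<in> Z"
proof (rule ccontr)
  assume "\<not> thesis"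
  then have none: "\<And>x t. x \<in> U \<Longrightarrow> b - \<delta> < t \<Longrightarrow> t < b \<Longrightarrow> (x, t) \<notin> Z" using that by blast
  obtain c where c: "c \<in> A" "x0 \<in> chart_dom c" by (rule chart_cover)
  define z0 where "z0 = coord c x0"
  obtain \<rho>' where \<rho>': "\<rho>' > 0" "cball z0 \<rho>' \<subseteq> coord c ` (U \<inter> chart_dom c)"
    unfolding z0_def by (rule chart_cball[OF c U])
  define \<rho> where "\<rho> = \<rho>' / 2"
  have \<rho>: "\<rho> > 0" "ball z0 (2 * \<rho>) \<subseteq> coord c ` (U \<inter> chart_dom c)"
    using \<rho>' ball_subset_cball[of z0 \<rho>'] by (auto simp: \<rho>_def)
  have VU: "chart_inv c z \<in> U" "z \<in> chart_img c" if "z \<in> ball z0 (2 * \<rho>)" for z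
    using \<rho>(2) that chart_inv_coord[OF c(1)] by force+
  define \<phi> where "\<phi> q = (fst q - z0) \<bullet> (fst q - z0)" for q :: "(real ^ 'n) \<times> real"
  have \<phi>: "C_infty W \<phi>" for W
    using C_infty_subset[OF C_infty_radial_square] unfolding \<phi>_def[abs_def] by blast
  have cov\<phi>: "covector \<phi> q = 2 *\<^sub>R (fst q - z0)" for q
    unfolding \<phi>_def[abs_def] by (rule covector_radial_square)
  have \<phi>n: "\<phi> q = (norm (fst q - z0))\<^sup>2" for q by (simp add: \<phi>_def power2_norm_eq_inner)
  define N where "N q = sqrt (covector \<phi> q \<bullet> raised (jet (g c) \<phi> q))" for q
  \<comment> \<open>The spheres that occur during the evolution; \<open>\<tau> \<le> 1\<close> below.\<close>
  define X where "X = {z :: real ^ 'n. \<rho>/2 \<le> norm (z - z0) \<and> norm (z - z0) \<le> \<rho>} \<times> {b - 1..b + 1}"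
  have "compact X" unfolding X_def by (rule compact_annulus_slab)
  have X: "fst q \<in> chart_img c" "covector \<phi> q \<noteq> 0" "jet (g c) \<phi> q \<in> nondegenerate" if "q \<in> X" for q
  proof -
    have "\<rho>/2 \<le> norm (fst q - z0)" "norm (fst q - z0) \<le> \<rho>" using that by (auto simp: X_def)
    then have "fst q \<in> ball z0 (2 * \<rho>)" "fst q \<noteq> z0" using \<rho>(1) by (auto simp: dist_norm norm_minus_commute)
    then show "fst q \<in> chart_img c" "covector \<phi> q \<noteq> 0" using VU(2) cov\<phi> by auto
    then show "jet (g c) \<phi> q \<in> nondegenerate" by (rule jet_nondegenerate[OF c(1)])
  qed
  have Npos: "N q > 0" if "q \<in> X" for q
    using X(3)[OF that] by (simp add: N_def nondegenerate_def jet_def)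
  have "continuous_on X (\<lambda>q. level_Phi (g c) \<phi> q * N q)"
  proof (rule continuous_at_imp_continuous_on, rule ballI)
    fix q assume q: "q \<in> X"
    have 1: "isCont (level_Phi (g c) \<phi>) q"
      by (rule level_Phi_isCont[OF c(1) X(1)[OF q] \<phi> open_UNIV UNIV_I X(2)[OF q]])
    have "isCont (metric_matrix (g c)) (fst q)"
      using has_derivative_continuous[OF metric_matrix_has_derivative[OF c(1) X(1)[OF q]]] .
    then have m: "isCont (\<lambda>q. metric_matrix (g c) (fst q)) q"
      by (rule isCont_o2[rotated]) (rule continuous_fst[OF continuous_ident])
    have "isCont (jet (g c) \<phi>) q"
      unfolding jet_def[abs_def] cov\<phi> by (intro continuous_intros m)
    moreover have "isCont (\<lambda>q. snd q \<bullet> raised q) (jet (g c) \<phi> q)"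
      using continuous_on_nondegenerate(1) X(3)[OF q] open_nondegenerate continuous_on_eq_continuous_at by blast
    ultimately have "isCont (\<lambda>q. snd (jet (g c) \<phi> q) \<bullet> raised (jet (g c) \<phi> q)) q"
      by (rule isCont_o2)
    then have "isCont N q" unfolding N_def[abs_def] by (simp add: jet_def continuous_intros)
    with 1 show "isCont (\<lambda>q. level_Phi (g c) \<phi> q * N q) q" by (rule continuous_mult)
  qed
  then have "bounded ((\<lambda>q. level_Phi (g c) \<phi> q * N q) ` X)"
    using \<open>compact X\<close> compact_continuous_image compact_imp_bounded by blast
  \<comment> \<open>Shrinking at rate \<open>d\<close> adds \<open>- d / N\<close> to \<open>\<Phi>\<close>, so a rate above all values of \<open>\<Phi> N\<close> suffices.\<close>
  then obtain B where B: "B > 0" "\<And>q. q \<in> X \<Longrightarrow> \<bar>level_Phi (g c) \<phi> q * N q\<bar> \<le> B"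
    unfolding bounded_pos by auto
  define d where "d = B + 1"
  have d: "d > 0" using B by (simp add: d_def)
  define \<tau> where "\<tau> = min (min (\<delta>/2) b) (min 1 (3 * \<rho>\<^sup>2 / (8 * d)))"
  have \<tau>: "\<tau> > 0" "\<tau> < \<delta>" "\<tau> \<le> b" "\<tau> \<le> 1" using \<delta> b \<rho>(1) d by (auto simp: \<tau>_def)
  have \<tau>d: "8 * (d * \<tau>) \<le> 3 * \<rho>\<^sup>2"
  proof -
    have "\<tau> \<le> 3 * \<rho>\<^sup>2 / (8 * d)" by (simp add: \<tau>_def)
    then show ?thesis using d by (simp add: field_simps)
  qed
  \<comment> \<open>This makes \<open>\<psi> = |z - z0|\<^sup>2 - (\<rho>\<^sup>2 - d (t - (b - \<tau>)))\<close>.\<close>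
  define k where "k = - d * (b - \<tau>) - \<rho>\<^sup>2"
  define \<psi> where "\<psi> q = \<phi> q + (d * snd q + k)" for q
  have \<psi>t: "\<psi> (z, t) = (norm (z - z0))\<^sup>2 + d * (t - (b - \<tau>)) - \<rho>\<^sup>2" for z t
    by (simp add: \<psi>_def \<phi>n k_def algebra_simps)
  have dt: "0 \<le> d * (t - (b - \<tau>))" "d * (t - (b - \<tau>)) \<le> 3/4 * \<rho>\<^sup>2" if "t \<in> {b - \<tau>..b + \<tau>}" for t
  proof -
    show "0 \<le> d * (t - (b - \<tau>))" using that d by simp
    have "d * (t - (b - \<tau>)) \<le> d * (2 * \<tau>)" using that d by (intro mult_left_mono) auto
    then show "d * (t - (b - \<tau>)) \<le> 3/4 * \<rho>\<^sup>2" using \<tau>d by simp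
  qed
  have zero: "(z, t) \<in> X" if t: "t \<in> {b - \<tau>..b + \<tau>}" and "\<psi> (z, t) = 0" for z t
  proof -
    have "(norm (z - z0))\<^sup>2 \<le> \<rho>\<^sup>2" "(\<rho>/2)\<^sup>2 \<le> (norm (z - z0))\<^sup>2"
      using that(2) dt[OF t] unfolding \<psi>t by (auto simp: power2_eq_square)
    then have "norm (z - z0) \<le> \<rho>" "\<rho>/2 \<le> norm (z - z0)"
      using \<rho>(1) by (auto simp: power2_le_iff_abs_le abs_le_square_iff[symmetric])
    then show ?thesis using t \<tau> by (auto simp: X_def)
  qed
  obtain E where E: "C_infty UNIV E" "\<And>s. s \<le> \<rho>\<^sup>2/2 \<Longrightarrow> E s = s" "\<And>s. \<rho>\<^sup>2 \<le> s \<Longrightarrow> E s = 1"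
    "\<And>s. E s \<le> 0 \<longleftrightarrow> s \<le> 0"
    using smooth_truncation[of "\<rho>\<^sup>2"] \<rho>(1) by (metis zero_less_power)
  interpret B: limit_flow_barrier A g gs Zs Z c "ball z0 (2 * \<rho>)" "cball z0 (3/2 * \<rho>)" "b - \<tau>" "b + \<tau>"
      "\<rho>\<^sup>2" UNIV \<psi> E
  proof unfold_locales
    show "c \<in> A" by (rule c)
    show "open (ball z0 (2 * \<rho>))" "compact (cball z0 (3/2 * \<rho>))" "open UNIV"
      "ball z0 (2 * \<rho>) \<times> {b - \<tau>..b + \<tau>} \<subseteq> UNIV" by simp_all
    show "ball z0 (2 * \<rho>) \<subseteq> chart_img c" using VU(2) by blast
    show "cball z0 (3/2 * \<rho>) \<subseteq> ball z0 (2 * \<rho>)" using \<rho>(1) by auto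
    show "C_infty UNIV \<psi>" unfolding \<psi>_def[abs_def]
      by (rule C_infty_add[OF open_UNIV \<phi> C_infty_affine_time])
    show "\<rho>\<^sup>2 > 0" using \<rho>(1) by simp
    show "\<rho>\<^sup>2 \<le> \<psi> (z, t)" if "z \<in> ball z0 (2 * \<rho>) - cball z0 (3/2 * \<rho>)" "t \<in> {b - \<tau>..b + \<tau>}" for z t
    proof -
      have "3/2 * \<rho> \<le> norm (z - z0)" using that(1) by (auto simp: dist_norm norm_minus_commute)
      then have "(3/2 * \<rho>)\<^sup>2 \<le> (norm (z - z0))\<^sup>2" using \<rho>(1) by (intro power_mono) auto
      moreover have "2 * \<rho>\<^sup>2 \<le> (3/2 * \<rho>)\<^sup>2" by (simp add: power2_eq_square)
      ultimately show ?thesis using dt(1)[OF that(2)] unfolding \<psi>t by linarith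
    qed
    show "covector \<psi> (z, t) \<noteq> 0" if "t \<in> {b - \<tau>..b + \<tau>}" "\<psi> (z, t) = 0" for z t
      using X(2)[OF zero[OF that]] unfolding \<psi>_def[abs_def]
      by (subst covector_add_affine_time[OF open_UNIV \<phi> UNIV_I])
    show "E s = s" if "s \<le> \<rho>\<^sup>2/2" for s using E(2) that .
    show "E s = 1" if "\<rho>\<^sup>2 \<le> s" for s using E(3) that .
    show "C_infty UNIV E" "\<And>s. E s \<le> 0 \<longleftrightarrow> s \<le> 0" by (rule E)+
    show "0 \<le> b - \<tau>" "b - \<tau> < b + \<tau>" using \<tau> by auto
    show "(chart_inv c z, b - \<tau>) \<notin> Z" if "z \<in> ball z0 (2 * \<rho>)" for z
      using none VU(1)[OF that] \<tau> by simp
    show "level_Phi (g c) \<psi> (z, t) < 0" if "t \<in> {b - \<tau>..b + \<tau>}" "\<psi> (z, t) = 0" for z t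
    proof -
      let ?q = "(z, t)"
      have q: "?q \<in> X" using zero that .
      have "level_Phi (g c) \<psi> ?q = level_Phi (g c) \<phi> ?q - d / N ?q"
        unfolding \<psi>_def[abs_def] N_def by (rule level_Phi_add_affine_time[OF open_UNIV \<phi> UNIV_I])
      moreover have "level_Phi (g c) \<phi> ?q * N ?q < d" using B(2)[OF q] by (simp add: d_def)
      then have "level_Phi (g c) \<phi> ?q < d / N ?q" using Npos[OF q] by (simp add: pos_less_divide_eq)
      ultimately show ?thesis by simp
    qed
  qed
  have "\<psi> (z0, b) < 0" using dt(2)[of b] \<tau> \<rho>(1) unfolding \<psi>t by (simp add: power2_eq_square)
      (smt (verit) mult_pos_pos)
  then have "(chart_inv c z0, b) \<notin> Z"
    using \<tau> \<rho>(1) by (intro B.limit_avoids_interior) auto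
  then show False using Z chart_inv_coord[OF c] by (simp add: z0_def)
qed

section \<open>Strict touching is impossible\<close>

text \<open>Here \<open>F\<close> is a local defining function of a barrier, extended beyond the contact time \<open>b\<close>.  The
barrier \<open>F + M |z - z\<^sub>0|\<^sup>4 - \<kappa>\<close> on a short time interval around \<open>b\<close> satisfies the assumptions of
\<open>limit_avoids_interior\<close>.  Each of them is first established at time \<open>b\<close> for \<open>\<kappa> = 0\<close>
and then holds for nearby times and small \<open>\<kappa>\<close> by compactness, with the constants \<open>\<epsilon>1\<close>,
\<open>\<epsilon>2\<close>, \<open>\<epsilon>3\<close> and, at the start, \<open>\<epsilon>4\<close>.

The least obvious one is the gradient condition.  On \<open>F + M |y|\<^sup>4 = 0\<close>, where
\<open>y = z - z\<^sub>0\<close>, a vanishing gradient means \<open>\<nabla>F = - 4 M |y|\<^sup>2 y\<close>, hence \<open>|\<nabla>F| = 4 M |y|\<^sup>3\<close> and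
\<open>y \<bullet> \<nabla>F - F = - 3 M |y|\<^sup>4\<close>.  But near \<open>z\<^sub>0\<close> the gradient is close to
\<open>\<nu> \<noteq> 0\<close> while \<open>y \<bullet> \<nabla>F - F\<close> is small compared with \<open>|\<nu>| |y|\<close>.\<close>

lemma strict_touching_impossible:
  assumes c: "c \<in> A" and W: "open W" "W \<subseteq> chart_img c \<times> UNIV" "(z0, b) \<in> W"
    and F: "C_infty W F" and ab: "0 \<le> a" "a < b"
    and before: "\<And>z t. (z, t) \<in> W \<Longrightarrow> a \<le> t \<Longrightarrow> t < b \<Longrightarrow> F (z, t) \<le> 0 \<Longrightarrow> (chart_inv c z, t) \<notin> Z"
    and interior: "\<And>z. (z, b) \<in> W \<Longrightarrow> F (z, b) < 0 \<Longrightarrow> (chart_inv c z, b) \<notin> Z"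
    and F0: "F (z0, b) = 0" "covector F (z0, b) \<noteq> 0"
    and Z: "(chart_inv c z0, b) \<in> Z" and neg: "level_Phi (g c) F (z0, b) < 0"
  shows False
proof -
  define \<nu> where "\<nu> = covector F (z0, b)"
  define u where "u z = F (z, b)" for z
  define p where "p z = covector F (z, b)" for z
  \<comment> \<open>With errors below \<open>|\<nu>|/8\<close>, \<open>4 M |y|\<^sup>3 \<ge> 7 e\<close> and \<open>3 M |y|\<^sup>3 \<le> 2 e\<close>, which exclude each other.\<close>
  define e where "e = norm \<nu> / 8"
  have e: "e > 0" using F0(2) by (simp add: e_def \<nu>_def)
  obtain U1 U2 where U: "open U1" "open U2" "z0 \<in> U1" "b \<in> U2" "U1 \<times> U2 \<subseteq> W"
    using open_prod_elim[OF W(1,3)] by (metis SigmaE2)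
  have sliceF: "(u has_derivative (\<lambda>v. v \<bullet> \<nu>)) (at z0)"
  proof -
    have d: "(u has_derivative (\<lambda>v. frechet_derivative F (at (z0, b)) (v, 0))) (at z0)"
      unfolding u_def[abs_def] by (rule C_infty_slice_has_derivative[OF F W(3)])
    have lin: "linear (\<lambda>v. frechet_derivative F (at (z0, b)) (v, 0))"
      using has_derivative_linear[OF d] .
    have "frechet_derivative F (at (z0, b)) (v, 0) = v \<bullet> \<nu>" for v
      by (subst linear_axis_expansion[OF lin]) (simp add: \<nu>_def covector_def inner_vec_def)
    then have "(\<lambda>v. frechet_derivative F (at (z0, b)) (v, 0)) = (\<lambda>v. v \<bullet> \<nu>)" by (rule ext)
    with d show ?thesis by simp
  qed
  obtain r1 where r1: "r1 > 0" "\<And>z. norm (z - z0) < r1 \<Longrightarrow>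
      norm (u z - u z0 - (z - z0) \<bullet> \<nu>) \<le> e * norm (z - z0)"
    using sliceF e unfolding has_derivative_at_alt by blast
  have covF: "continuous_on W (covector F)"
    unfolding covector_def[abs_def] by (intro continuous_on_vec_lambda C_infty_continuous_on[OF F])
  have "isCont p z0"
  proof -
    have "isCont (covector F) (z0, b)" using covF W(1,3) continuous_on_eq_continuous_at by blast
    moreover have "isCont (\<lambda>z. (z, b)) z0" by (intro continuous_intros)
    ultimately show ?thesis unfolding p_def[abs_def] using isCont_o2 by blast
  qed
  then obtain r2 where r2: "r2 > 0" "\<And>z. dist z z0 < r2 \<Longrightarrow> dist (p z) \<nu> < e"
    using e unfolding continuous_at_eps_delta by (metis p_def \<nu>_def)
  obtain r3 where r3: "r3 > 0" "cball z0 r3 \<subseteq> U1" using U open_contains_cball by blast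
  obtain \<delta>' where \<delta>': "\<delta>' > 0" "cball b \<delta>' \<subseteq> U2" using U open_contains_cball by blast
  define r where "r = min (min (r1/2) (r2/2)) r3"
  define \<delta> where "\<delta> = min \<delta>' (b - a)"
  have r: "r > 0" "r < r1" "r < r2" "r \<le> r3" using r1 r2 r3 by (auto simp: r_def)
  have \<delta>: "\<delta> > 0" "\<delta> \<le> \<delta>'" "\<delta> \<le> b - a" using \<delta>' ab by (auto simp: \<delta>_def)
  define X where "X = cball z0 r \<times> {b - \<delta>..b + \<delta>}"
  have XW: "X \<subseteq> W"
  proof
    fix q assume "q \<in> X"
    then have "fst q \<in> cball z0 r3" "snd q \<in> cball b \<delta>'" using r(4) \<delta>(2) by (auto simp: X_def dist_real_def)
    then show "q \<in> W" using r3(2) \<delta>'(2) U(5) by (metis mem_Times_iff subsetD)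
  qed
  have XI: "(z, t) \<in> X" if "norm (z - z0) \<le> r" "\<bar>t - b\<bar> \<le> \<delta>" for z t
    using that by (auto simp: X_def dist_norm norm_minus_commute)
  have Ximg: "cball z0 r \<subseteq> chart_img c"
  proof
    fix z assume "z \<in> cball z0 r"
    then have "(z, b) \<in> X" using \<delta>(1) by (simp add: X_def)
    then show "z \<in> chart_img c" using XW W(2) by blast
  qed
  have cX: "compact X" by (simp add: X_def compact_Times)
  have lower: "7 * e \<le> norm (p z)" and radial: "(z - z0) \<bullet> p z - u z \<ge> - 2 * e * norm (z - z0)"
    if "norm (z - z0) \<le> r" for z
  proof -
    have 1: "norm (p z - \<nu>) < e" using r2(2)[of z] that r(3) by (simp add: dist_norm)
    have "norm \<nu> \<le> norm (p z) + norm (p z - \<nu>)" using norm_triangle_sub[of \<nu> "p z"] by (simp add: norm_minus_commute)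
    moreover have "norm \<nu> = 8 * e" by (simp add: e_def)
    ultimately show "7 * e \<le> norm (p z)" using 1 by linarith
    have 2: "\<bar>u z - (z - z0) \<bullet> \<nu>\<bar> \<le> e * norm (z - z0)"
      using r1(2)[of z] that r(2) F0(1) by (simp add: u_def)
    have "\<bar>(z - z0) \<bullet> (p z - \<nu>)\<bar> \<le> norm (z - z0) * norm (p z - \<nu>)" by (rule Cauchy_Schwarz_ineq2)
    also have "\<dots> \<le> norm (z - z0) * e" using 1 by (intro mult_left_mono) auto
    finally have "(z - z0) \<bullet> p z - (z - z0) \<bullet> \<nu> \<ge> - (e * norm (z - z0))"
      by (simp add: inner_diff_right mult.commute)
    then show "(z - z0) \<bullet> p z - u z \<ge> - 2 * e * norm (z - z0)" using 2 by simp
  qed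
  have cF: "continuous_on X F" by (rule continuous_on_subset[OF C_infty_continuous_on0[OF F] XW])
  then have "bounded (F ` X)" using cX compact_continuous_image compact_imp_bounded by blast
  then obtain B where B: "B > 0" "\<And>q. q \<in> X \<Longrightarrow> \<bar>F q\<bar> \<le> B" unfolding bounded_pos by auto
  \<comment> \<open>The quartic term exceeds \<open>|F|\<close> as soon as \<open>|y| \<ge> r/2\<close>.\<close>
  define M where "M = 16 * (B + 1) / r ^ 4"
  have M: "M > 0" using B r by (simp add: M_def)
  define \<phi> where "\<phi> q = (fst q - z0) \<bullet> (fst q - z0)" for q :: "(real ^ 'n) \<times> real"
  define Q where "Q q = M * (\<phi> q * \<phi> q)" for q
  have \<phi>n: "\<phi> q = (norm (fst q - z0))\<^sup>2" for q by (simp add: \<phi>_def power2_norm_eq_inner)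
  have \<phi>k: "C_upto k UNIV \<phi>" for k
    using C_infty_radial_square[of z0] unfolding \<phi>_def[abs_def] C_infty_iff by blast
  have Qs: "C_infty UNIV Q"
    unfolding C_infty_iff Q_def[abs_def] by (intro allI C_upto_mult C_upto_const \<phi>k open_UNIV)
  have QW: "C_infty W Q" by (rule C_infty_subset[OF Qs]) simp
  have dQ: "(Q has_derivative (\<lambda>v. 4 * M * \<phi> q * ((fst q - z0) \<bullet> fst v))) (at q)" for q
  proof -
    have d: "(\<phi> has_derivative (\<lambda>v. 2 * ((fst q - z0) \<bullet> fst v))) (at q)"
      unfolding \<phi>_def[abs_def] by (rule radial_square_has_derivative)
    show ?thesis unfolding Q_def[abs_def]
      by (rule has_derivative_eq_rhs[OF has_derivative_mult_right[OF has_derivative_mult[OF d d]]])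
         (simp add: fun_eq_iff)
  qed
  have Q1: "iter_deriv [v] Q q = 4 * M * \<phi> q * ((fst q - z0) \<bullet> fst v)" for v q
    using frechet_derivative_at[OF dQ, symmetric] by simp
  have Q2: "iter_deriv [w, v] Q (z0, t) = 0" for w v t
  proof -
    have "((\<lambda>q. 4 * M * \<phi> q * ((fst q - z0) \<bullet> fst v)) has_derivative (\<lambda>_. 0)) (at (z0, t))"
      unfolding \<phi>_def
      by (auto intro!: derivative_eq_intros radial_square_has_derivative)
    then have "(iter_deriv [v] Q has_derivative (\<lambda>_. 0)) (at (z0, t))"
      unfolding Q1[abs_def] .
    from frechet_derivative_at[OF this, symmetric] show ?thesis by simp
  qed
  define \<psi> where "\<psi> q = F q + Q q" for q
  have \<psi>: "C_infty W \<psi>" unfolding \<psi>_def[abs_def] by (rule C_infty_add[OF W(1) F QW])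
  have add: "iter_deriv vs \<psi> q = iter_deriv vs F q + iter_deriv vs Q q" if "q \<in> W" for vs q
    unfolding \<psi>_def[abs_def] by (rule iter_deriv_add[OF W(1) F QW that])
  have cov\<psi>: "covector \<psi> q = covector F q + (4 * M * \<phi> q) *\<^sub>R (fst q - z0)" if "q \<in> W" for q
    unfolding covector_def add[OF that] Q1 by (simp add: vec_eq_iff inner_axis)
  have \<phi>0: "\<phi> (z0, b) = 0" by (simp add: \<phi>_def)
  have Phi0: "level_Phi (g c) \<psi> (z0, b) = level_Phi (g c) F (z0, b)"
  proof -
    have cv: "covector \<psi> (z0, b) = covector F (z0, b)" by (simp add: cov\<psi>[OF W(3)])
    then have J: "jet (g c) \<psi> (z0, b) = jet (g c) F (z0, b)" by (simp add: jet_def)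
    have dJ: "djet (g c) \<psi> (z0, b) i = djet (g c) F (z0, b) i" for i
      unfolding djet_def add[OF W(3)] Q2 by simp
    have "iter_deriv [(0, 1)] \<psi> (z0, b) = iter_deriv [(0, 1)] F (z0, b)"
      unfolding add[OF W(3)] Q1 by simp
    then show ?thesis unfolding level_Phi_def cv J dJ by simp
  qed
  have nz0: "covector \<psi> (z0, b) \<noteq> 0" using F0(2) by (simp add: cov\<psi>[OF W(3)])
  have img0: "fst (z0, b) \<in> chart_img c" using W(2,3) by auto
  have "isCont (level_Phi (g c) \<psi>) (z0, b)"
    by (rule level_Phi_isCont[OF c img0 \<psi> W(1,3) nz0])
  then have "(level_Phi (g c) \<psi> \<longlongrightarrow> level_Phi (g c) \<psi> (z0, b)) (nhds (z0, b))"
    unfolding isCont_def tendsto_at_iff_tendsto_nhds .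
  from order_tendstoD(2)[OF this, of 0] neg Phi0
  have "\<forall>\<^sub>F q in nhds (z0, b). level_Phi (g c) \<psi> q < 0" by simp
  then obtain O' where O': "open O'" "(z0, b) \<in> O'" "\<And>q. q \<in> O' \<Longrightarrow> level_Phi (g c) \<psi> q < 0"
    unfolding eventually_nhds by blast
  have c\<psi>: "continuous_on X \<psi>" by (rule continuous_on_subset[OF C_infty_continuous_on0[OF \<psi>] XW])
  have covcont: "continuous_on X (covector \<psi>)"
    unfolding covector_def[abs_def]
    by (intro continuous_on_vec_lambda continuous_on_subset[OF C_infty_continuous_on[OF \<psi>] XW])
  have tcont: "continuous_on Y (\<lambda>q. \<bar>snd q - b\<bar>)" for Y :: "((real ^ 'n) \<times> real) set"
    by (intro continuous_intros)
  have Qn: "Q q = M * norm (fst q - z0) ^ 4" for q by (simp add: Q_def \<phi>n power_add[symmetric])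
  define X1 where "X1 = {z :: real ^ 'n. r/2 \<le> norm (z - z0) \<and> norm (z - z0) \<le> r} \<times> {b - \<delta>..b + \<delta>}"
  have X1X: "X1 \<subseteq> X" by (auto simp: X1_def X_def dist_norm norm_minus_commute)
  \<comment> \<open>Near time \<open>b\<close> the sublevel set stays inside the ball of radius \<open>r/2\<close>.\<close>
  obtain \<epsilon>1 where \<epsilon>1: "\<epsilon>1 > 0" "\<And>q. q \<in> X1 \<Longrightarrow> \<epsilon>1 \<le> max \<bar>snd q - b\<bar> (\<psi> q)"
  proof (rule compact_positive_bound[of X1 "\<lambda>q. max \<bar>snd q - b\<bar> (\<psi> q)"])
    show "compact X1" unfolding X1_def by (rule compact_annulus_slab)
    show "continuous_on X1 (\<lambda>q. max \<bar>snd q - b\<bar> (\<psi> q))"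
      by (intro continuous_on_max tcont continuous_on_subset[OF c\<psi> X1X])
    show "max \<bar>snd q - b\<bar> (\<psi> q) > 0" if q: "q \<in> X1" for q
    proof -
      have "r/2 \<le> norm (fst q - z0)" using q by (auto simp: X1_def)
      then have "(r/2) ^ 4 \<le> norm (fst q - z0) ^ 4" using r(1) by (intro power_mono) auto
      then have "M * (r/2) ^ 4 \<le> Q q" unfolding Qn using M by (intro mult_left_mono) auto
      moreover have "M * (r/2) ^ 4 = B + 1" using r(1) by (simp add: M_def power_divide)
      ultimately have "\<psi> q > 0" using B(2)[of q] q X1X by (auto simp: \<psi>_def)
      then show ?thesis by simp
    qed
  qed blast
  \<comment> \<open>Near time \<open>b\<close> the gradient does not vanish on level sets at heights close to \<open>0\<close>.\<close>
  obtain \<epsilon>2 where \<epsilon>2: "\<epsilon>2 > 0" "\<And>q. q \<in> X \<Longrightarrow> \<epsilon>2 \<le> max \<bar>snd q - b\<bar> (max \<bar>\<psi> q\<bar> (norm (covector \<psi> q)))"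
  proof (rule compact_positive_bound[of X "\<lambda>q. max \<bar>snd q - b\<bar> (max \<bar>\<psi> q\<bar> (norm (covector \<psi> q)))"])
    show "compact X" by (rule cX)
    show "continuous_on X (\<lambda>q. max \<bar>snd q - b\<bar> (max \<bar>\<psi> q\<bar> (norm (covector \<psi> q))))"
      by (intro continuous_on_max tcont continuous_on_rabs continuous_on_norm c\<psi> covcont)
    show "max \<bar>snd q - b\<bar> (max \<bar>\<psi> q\<bar> (norm (covector \<psi> q))) > 0" if q: "q \<in> X" for q
    proof (rule ccontr)
      assume "\<not> ?thesis"
      then have n: "snd q = b" "\<psi> q = 0" "covector \<psi> q = 0"
        by (simp_all add: less_max_iff_disj)
      define z where "z = fst q"
      define y where "y = norm (z - z0)"
      have qz: "q = (z, b)" using n(1) by (simp add: z_def prod_eq_iff)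
      have y: "y \<le> r" "y \<ge> 0" using q by (auto simp: qz X_def y_def dist_norm norm_minus_commute)
      have "covector \<psi> q = p z + (4 * M * y\<^sup>2) *\<^sub>R (z - z0)"
        using cov\<psi>[of q] q XW by (auto simp: qz p_def \<phi>n y_def)
      then have pz: "p z = - ((4 * M * y\<^sup>2) *\<^sub>R (z - z0))" using n(3) by (simp add: eq_neg_iff_add_eq_0)
      have uz: "u z = - (M * y ^ 4)" using n(2) by (simp add: qz \<psi>_def u_def Qn y_def)
      have "norm (p z) = 4 * M * y ^ 3"
        unfolding pz using M by (simp add: y_def power2_eq_square power3_eq_cube)
      then have l: "7 * e \<le> 4 * M * y ^ 3" using lower[of z] y(1) by (simp add: y_def)
      have "(z - z0) \<bullet> p z = - (4 * M * y ^ 4)"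
        unfolding pz by (simp add: y_def power2_norm_eq_inner[symmetric] power_add[symmetric])
      then have "3 * M * y ^ 4 \<le> 2 * e * y" using radial[of z] y(1) uz by (simp add: y_def)
      moreover have "y > 0" using l e y(2) by (cases "y = 0") auto
      moreover have "3 * M * y ^ 4 = (3 * M * y ^ 3) * y" by (simp add: power_Suc2 eval_nat_numeral)
      ultimately have "3 * M * y ^ 3 \<le> 2 * e" by simp
      then show False using l e by linarith
    qed
  qed blast
  have P: "continuous_on X (\<lambda>q. (chart_inv c (fst q), snd q))"
    by (intro continuous_on_Pair continuous_on_snd continuous_on_id
        continuous_on_compose2[OF continuous_on_chart_inv[OF c] continuous_on_fst[OF continuous_on_id]])
       (use Ximg in \<open>auto simp: X_def\<close>)
  define X3 where "X3 = (X \<inter> (\<lambda>q. (chart_inv c (fst q), snd q)) -` Z) \<inter> - O'"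
  have X3X: "X3 \<subseteq> X" by (auto simp: X3_def)
  \<comment> \<open>Near time \<open>b\<close> the points of \<open>Z\<close> with \<open>\<psi>\<close> close to \<open>0\<close> or negative lie in \<open>O'\<close>, where \<open>\<Phi> < 0\<close>.\<close>
  obtain \<epsilon>3 where \<epsilon>3: "\<epsilon>3 > 0" "\<And>q. q \<in> X3 \<Longrightarrow> \<epsilon>3 \<le> max \<bar>snd q - b\<bar> (\<psi> q)"
  proof (rule compact_positive_bound[of X3 "\<lambda>q. max \<bar>snd q - b\<bar> (\<psi> q)"])
    show "compact X3" unfolding X3_def
      by (rule compact_Int_closed[OF compact_closed_preimage[OF cX P Z_closed] closed_Compl[OF O'(1)]])
    show "continuous_on X3 (\<lambda>q. max \<bar>snd q - b\<bar> (\<psi> q))"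
      by (intro continuous_on_max tcont continuous_on_subset[OF c\<psi> X3X])
    show "max \<bar>snd q - b\<bar> (\<psi> q) > 0" if q: "q \<in> X3" for q
    proof (rule ccontr)
      assume "\<not> ?thesis"
      then have n: "snd q = b" "\<psi> q \<le> 0" by auto
      define z where "z = fst q"
      have qz: "q = (z, b)" using n(1) by (simp add: z_def prod_eq_iff)
      have "(z, b) \<in> W" using q X3X XW qz by auto
      moreover have "(chart_inv c z, b) \<in> Z" using q by (simp add: X3_def qz)
      ultimately have "F (z, b) \<ge> 0" using interior[of z] by (meson not_le)
      moreover have "Q q \<ge> 0" using M by (simp add: Qn)
      ultimately have "Q q = 0" using n(2) by (simp add: \<psi>_def qz)
      then have "z = z0" using M by (simp add: Qn qz)
      then show False using q O'(2) by (simp add: X3_def qz)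
    qed
  qed blast
  define \<epsilon> where "\<epsilon> = min (min \<epsilon>1 \<epsilon>2) (min \<epsilon>3 \<delta>)"
  have \<epsilon>: "\<epsilon> > 0" "\<epsilon> \<le> \<epsilon>1" "\<epsilon> \<le> \<epsilon>2" "\<epsilon> \<le> \<epsilon>3" "\<epsilon> \<le> \<delta>"
    using \<epsilon>1(1) \<epsilon>2(1) \<epsilon>3(1) \<delta>(1) by (auto simp: \<epsilon>_def)
  define a' where "a' = b - \<epsilon>/2"
  define b' where "b' = b + \<epsilon>/2"
  have a': "0 \<le> a'" "a \<le> a'" "a' < b" "b < b'" using \<epsilon> \<delta> ab by (auto simp: a'_def b'_def)
  have near: "\<bar>t - b\<bar> \<le> \<epsilon>/2" if "t \<in> {a'..b'}" for t
    using that unfolding a'_def b'_def atLeastAtMost_iff by linarith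
  have inX: "(z, t) \<in> X" if "z \<in> ball z0 r" "t \<in> {a'..b'}" for z t
    using near[OF that(2)] that(1) \<epsilon> by (intro XI) (auto simp: dist_norm norm_minus_commute)
  have slicecont: "continuous_on Y (\<lambda>z. (z, a'))" for Y :: "(real ^ 'n) set" by (intro continuous_intros)
  have sliceX: "(\<lambda>z. (z, a')) ` cball z0 r \<subseteq> X" using \<epsilon> by (auto simp: X_def a'_def)
  define X4 where "X4 = cball z0 r \<inter> (\<lambda>z. (chart_inv c z, a')) -` Z"
  \<comment> \<open>At the starting time \<open>a'\<close>, before \<open>b\<close>, the original barrier misses \<open>Z\<close>; this bounds \<open>\<kappa>\<close>.\<close>
  obtain \<epsilon>4 where \<epsilon>4: "\<epsilon>4 > 0" "\<And>z. z \<in> X4 \<Longrightarrow> \<epsilon>4 \<le> \<psi> (z, a')"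
  proof (rule compact_positive_bound[of X4 "\<lambda>z. \<psi> (z, a')"])
    have "continuous_on (cball z0 r) (\<lambda>z. (chart_inv c z, a'))"
      using continuous_on_compose2[OF P slicecont sliceX] by simp
    then show "compact X4" unfolding X4_def
      by (rule compact_closed_preimage[OF compact_cball _ Z_closed])
    have "continuous_on (cball z0 r) (\<lambda>z. \<psi> (z, a'))"
      by (rule continuous_on_compose2[OF c\<psi> slicecont sliceX])
    then show "continuous_on X4 (\<lambda>z. \<psi> (z, a'))"
      by (rule continuous_on_subset) (auto simp: X4_def)
    show "\<psi> (z, a') > 0" if z: "z \<in> X4" for z
    proof (rule ccontr)
      assume "\<not> ?thesis"
      moreover have "Q (z, a') \<ge> 0" using M by (simp add: Qn)
      ultimately have "F (z, a') \<le> 0" by (simp add: \<psi>_def)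
      moreover have "z \<in> cball z0 r" using z by (simp add: X4_def)
      then have "(z, a') \<in> W" using sliceX XW by blast
      ultimately show False using before[of z a'] a' z by (simp add: X4_def)
    qed
  qed blast
  define \<kappa> where "\<kappa> = min (\<epsilon>/2) (\<epsilon>4/2)"
  have \<kappa>: "\<kappa> > 0" "\<kappa> \<le> \<epsilon>/2" "\<kappa> < \<epsilon>4" using \<epsilon>(1) \<epsilon>4(1) by (auto simp: \<kappa>_def)
  define \<psi>' where "\<psi>' q = \<psi> q + (0 * snd q + - \<kappa>)" for q
  have \<psi>'v: "\<psi>' q = \<psi> q - \<kappa>" for q by (simp add: \<psi>'_def)
  obtain E where E: "C_infty UNIV E" "\<And>s. s \<le> (\<epsilon>/2)/2 \<Longrightarrow> E s = s" "\<And>s. \<epsilon>/2 \<le> s \<Longrightarrow> E s = 1"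
    "\<And>s. E s \<le> 0 \<longleftrightarrow> s \<le> 0"
    using smooth_truncation[of "\<epsilon>/2"] \<epsilon>(1) by (metis half_gt_zero)
  interpret B: limit_flow_barrier A g gs Zs Z c "ball z0 r" "cball z0 (r/2)" a' b' "\<epsilon>/2" W \<psi>' E
  proof unfold_locales
    show "c \<in> A" by (rule c)
    show "open (ball z0 r)" "compact (cball z0 (r/2))" by simp_all
    show "open W" by (rule W)
    show "ball z0 r \<subseteq> chart_img c" using Ximg ball_subset_cball by blast
    show "cball z0 (r/2) \<subseteq> ball z0 r" using r(1) by auto
    show "ball z0 r \<times> {a'..b'} \<subseteq> W" using inX XW by blast
    show "C_infty W \<psi>'" unfolding \<psi>'_def[abs_def]
      by (rule C_infty_add[OF W(1) \<psi> C_infty_subset[OF C_infty_affine_time]]) simp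
    show "\<epsilon>/2 > 0" using \<epsilon>(1) by simp
    show "\<epsilon>/2 \<le> \<psi>' (z, t)" if z: "z \<in> ball z0 r - cball z0 (r/2)" and t: "t \<in> {a'..b'}" for z t
    proof -
      have "(z, t) \<in> X1"
        using z t \<epsilon> by (auto simp: X1_def dist_norm norm_minus_commute a'_def b'_def)
      from \<epsilon>1(2)[OF this] have "\<epsilon>1 \<le> \<bar>t - b\<bar> \<or> \<epsilon>1 \<le> \<psi> (z, t)" by (simp add: le_max_iff_disj)
      then show ?thesis using near[OF t] \<epsilon>(1,2) \<kappa>(2) unfolding \<psi>'v by linarith
    qed
    show "covector \<psi>' (z, t) \<noteq> 0" if z: "z \<in> ball z0 r" and t: "t \<in> {a'..b'}" and 0: "\<psi>' (z, t) = 0" for z t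
    proof -
      have "covector \<psi>' (z, t) = covector \<psi> (z, t)" unfolding \<psi>'_def[abs_def]
        using inX[OF z t] XW by (intro covector_add_affine_time[OF W(1) \<psi>]) blast
      moreover have "\<epsilon>2 \<le> norm (covector \<psi> (z, t))"
      proof -
        have "\<psi> (z, t) = \<kappa>" using 0 by (simp add: \<psi>'v)
        then have "\<epsilon>2 \<le> \<bar>t - b\<bar> \<or> \<epsilon>2 \<le> \<kappa> \<or> \<epsilon>2 \<le> norm (covector \<psi> (z, t))"
          using \<epsilon>2(2)[OF inX[OF z t]] \<kappa>(1) by (simp add: le_max_iff_disj)
        then show ?thesis using near[OF t] \<epsilon>(1,3) \<kappa>(2) by linarith
      qed
      ultimately show ?thesis using \<epsilon>2(1) by auto
    qed
    show "E s = s" if "s \<le> (\<epsilon>/2)/2" for s using E(2) that .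
    show "E s = 1" if "\<epsilon>/2 \<le> s" for s using E(3) that .
    show "C_infty UNIV E" "\<And>s. E s \<le> 0 \<longleftrightarrow> s \<le> 0" by (rule E)+
    show "0 \<le> a'" "a' < b'" using a' by auto
    show "(chart_inv c z, a') \<notin> Z" if z: "z \<in> ball z0 r" and s: "\<psi>' (z, a') \<le> 0" for z
    proof
      assume "(chart_inv c z, a') \<in> Z"
      then have "z \<in> X4" using z by (simp add: X4_def)
      from \<epsilon>4(2)[OF this] show False using s \<kappa> by (simp add: \<psi>'v)
    qed
    show "level_Phi (g c) \<psi>' (z, t) < 0"
      if z: "z \<in> ball z0 r" and t: "t \<in> {a'..b'}" and 0: "\<psi>' (z, t) = 0" and zt: "(chart_inv c z, t) \<in> Z" for z t
    proof -
      have "(z, t) \<in> O'"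
      proof (rule ccontr)
        assume "(z, t) \<notin> O'"
        then have "(z, t) \<in> X3" using inX[OF z t] zt by (simp add: X3_def)
        from \<epsilon>3(2)[OF this] have "\<epsilon>3 \<le> \<bar>t - b\<bar> \<or> \<epsilon>3 \<le> \<psi> (z, t)" by (simp add: le_max_iff_disj)
        moreover have "\<psi> (z, t) = \<kappa>" using 0 by (simp add: \<psi>'v)
        ultimately show False using near[OF t] \<epsilon>(1,4) \<kappa>(2) by linarith
      qed
      moreover have "level_Phi (g c) \<psi>' (z, t) = level_Phi (g c) \<psi> (z, t)"
        unfolding \<psi>'_def[abs_def]
        using inX[OF z t] XW by (subst level_Phi_add_affine_time[OF W(1) \<psi>]) auto
      ultimately show ?thesis using O'(3) by simp
    qed
  qed
  have "\<psi>' (z0, b) < 0" using F0(1) \<kappa>(1) by (simp add: \<psi>'v \<psi>_def Qn)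
  then have "(chart_inv c z0, b) \<notin> Z"
    using a' r(1) by (intro B.limit_avoids_interior) auto
  then show False using Z by simp
qed

section \<open>Limits of weak set flows\<close>

lemma barrier_local_extension:
  assumes K: "smooth_barrier A g a b f K" and c: "c \<in> A" and x: "x \<in> chart_dom c" and t: "t \<in> {a..b}"
  obtains W F where "open W" "(coord c x, t) \<in> W" "W \<subseteq> chart_img c \<times> UNIV" "C_infty W F"
    "\<And>y s. (y, s) \<in> W \<Longrightarrow> s \<in> {a..b} \<Longrightarrow> f (chart_inv c y) s = F (y, s)"
proof -
  have sm: "smooth_on (chart_img c \<times> {a..b}) (\<lambda>(z, t). in_chart c f t z)"
    using K c unfolding smooth_barrier_def by blast
  have "(coord c x, t) \<in> chart_img c \<times> {a..b}" using x t by blast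
  from bspec[OF sm[unfolded smooth_on_def] this]
  obtain W F where W: "open W \<and> (coord c x, t) \<in> W \<and> (\<forall>vs. \<forall>y\<in>W. iter_deriv vs F differentiable (at y)) \<and>
    (\<forall>y\<in>W \<inter> chart_img c \<times> {a..b}. F y = (case y of (z, t) \<Rightarrow> in_chart c f t z))"
    by (elim exE)
  show ?thesis
  proof (rule that[of "W \<inter> chart_img c \<times> UNIV" F])
    show "open (W \<inter> chart_img c \<times> UNIV)" using W open_chart_img[OF c] by (intro open_Int open_Times) auto
    show "(coord c x, t) \<in> W \<inter> chart_img c \<times> UNIV" using W x by blast
    show "C_infty (W \<inter> chart_img c \<times> UNIV) F" using W by (auto simp: C_infty_def)
    fix y s assume "(y, s) \<in> W \<inter> chart_img c \<times> UNIV" "s \<in> {a..b}"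
    then have "(y, s) \<in> W \<inter> chart_img c \<times> {a..b}" by blast
    then have "F (y, s) = in_chart c f s y" using W by (metis (no_types, lifting) case_prod_conv)
    then show "f (chart_inv c y) s = F (y, s)" by (simp add: in_chart_def)
  qed blast
qed

text \<open>A contact point \<open>p\<close> at time \<open>b\<close> cannot have \<open>f p b < 0\<close>: the barrier would contain a neighbourhood of \<open>p\<close>
for a while before \<open>b\<close>, whereas \<open>Z\<close> has points there by \<open>limit_has_past\<close>.  So \<open>f p b = 0\<close>, and \<open>p\<close> is
a boundary point, because \<open>f\<close> would otherwise have a local maximum there, with vanishing gradient.
Finally \<open>\<Phi> < 0\<close> in some chart is excluded by \<open>strict_touching_impossible\<close> in the same chart.\<close>

lemma limit_is_weak_set_flow: "weak_set_flow A g Z"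
proof -
  have "p \<in> frontier (K b) \<and> (\<forall>c\<in>A. p \<in> chart_dom c \<longrightarrow> barrier_Phi g c a b f p b \<ge> 0)"
    if a: "0 \<le> a" and K: "smooth_barrier A g a b f K"
      and disj: "\<And>t. t \<in> {a..<b} \<Longrightarrow> K t \<inter> time_slice Z t = {}"
      and p: "p \<in> K b \<inter> time_slice Z b" for a b f K p
  proof -
    have ab: "a < b" and Kf: "\<And>t. t \<in> {a..b} \<Longrightarrow> K t = {x. f x t \<le> 0}"
      and grad: "\<And>c x t. c \<in> A \<Longrightarrow> x \<in> chart_dom c \<Longrightarrow> t \<in> {a..b} \<Longrightarrow> f x t = 0 \<Longrightarrow>
        rgrad (g c) (in_chart c f t) (coord c x) \<noteq> 0"
      using K unfolding smooth_barrier_def by blast+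
    have bb: "b \<in> {a..b}" using ab by simp
    have past: "(x, t) \<notin> Z" if "t \<in> {a..<b}" "f x t \<le> 0" for x t
      using disj[OF that(1)] Kf[of t] that by (auto simp: time_slice_def)
    have inner: "(x, b) \<notin> Z" if fx: "f x b < 0" for x
    proof
      assume xZ: "(x, b) \<in> Z"
      obtain c where c: "c \<in> A" "x \<in> chart_dom c" by (rule chart_cover)
      obtain W F where W: "open W" "(coord c x, b) \<in> W" "W \<subseteq> chart_img c \<times> UNIV" "C_infty W F"
        "\<And>y s. (y, s) \<in> W \<Longrightarrow> s \<in> {a..b} \<Longrightarrow> f (chart_inv c y) s = F (y, s)"
        by (rule barrier_local_extension[OF K c bb]) blast
      have "open (W \<inter> F -` {..<0})"
        by (rule continuous_open_preimage[OF C_infty_continuous_on0[OF W(4)] W(1)]) simp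
      moreover have "(coord c x, b) \<in> W \<inter> F -` {..<0}"
        using W(2) W(5)[OF W(2) bb] fx chart_inv_coord[OF c] by simp
      ultimately obtain U1 U2 where U: "open U1" "open U2" "(coord c x, b) \<in> U1 \<times> U2" "U1 \<times> U2 \<subseteq> W \<inter> F -` {..<0}"
        by (rule open_prod_elim)
      have "b \<in> U2" using U(3) by simp
      then obtain \<delta> where \<delta>: "\<delta> > 0" "cball b \<delta> \<subseteq> U2" using U(2) open_contains_cball by blast
      have U1: "U1 \<subseteq> chart_img c" using U(4) W(3) \<open>b \<in> U2\<close> by blast
      have "open (chart_inv c ` U1)" by (rule open_chart_inv_image[OF c(1) U(1) U1])
      moreover have "x \<in> chart_inv c ` U1" using U(3) chart_inv_coord[OF c] by (metis SigmaE2 image_eqI)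
      moreover have "min \<delta> (b - a) > 0" "0 < b" using \<delta>(1) ab a by auto
      ultimately obtain x' t where x': "x' \<in> chart_inv c ` U1" "b - min \<delta> (b - a) < t" "t < b" "(x', t) \<in> Z"
        using limit_has_past[OF xZ] by metis
      have t: "t \<in> {a..<b}" "t \<in> U2" using x'(2,3) \<delta>(2) by (auto simp: subset_iff dist_real_def)
      obtain y where y: "y \<in> U1" "x' = chart_inv c y" using x'(1) by blast
      have "(y, t) \<in> W \<inter> F -` {..<0}" using U(4) y(1) t(2) by blast
      then have "f x' t < 0" using W(5)[of y t] t(1) y(2) by simp
      then show False using past[OF t(1)] x'(4) by (metis less_imp_le)
    qed
    have pZ: "(p, b) \<in> Z" and pK: "f p b \<le> 0" using p Kf[OF bb] by (auto simp: time_slice_def)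
    then have f0: "f p b = 0" using inner[of p] by force
    have local: "\<exists>W F. open W \<and> (coord c p, b) \<in> W \<and> W \<subseteq> chart_img c \<times> UNIV \<and> C_infty W F \<and>
        (\<forall>y s. (y, s) \<in> W \<longrightarrow> s \<in> {a..b} \<longrightarrow> f (chart_inv c y) s = F (y, s)) \<and>
        F (coord c p, b) = 0 \<and> covector F (coord c p, b) \<noteq> 0" if c: "c \<in> A" "p \<in> chart_dom c" for c
    proof -
      obtain W F where W: "open W" "(coord c p, b) \<in> W" "W \<subseteq> chart_img c \<times> UNIV" "C_infty W F"
        "\<And>y s. (y, s) \<in> W \<Longrightarrow> s \<in> {a..b} \<Longrightarrow> f (chart_inv c y) s = F (y, s)"
        by (rule barrier_local_extension[OF K c bb]) blast
      let ?z = "coord c p" and ?u = "in_chart c f b"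
      have "continuous_on UNIV (\<lambda>y :: real ^ 'n. (y, b))" by (intro continuous_intros)
      then have oV: "open ((\<lambda>y. (y, b)) -` W)" by (rule open_vimage[OF W(1)])
      have zV: "?z \<in> (\<lambda>y. (y, b)) -` W" using W(2) by simp
      from C_infty_slice_has_derivative[OF W(4,2)]
      have du: "(?u has_derivative (\<lambda>v. frechet_derivative F (at (?z, b)) (v, 0))) (at ?z)"
        by (rule has_derivative_transform_within_open[OF _ oV zV]) (use W(5) bb in \<open>simp add: in_chart_def\<close>)
      then have ud: "?u differentiable (at ?z)" by (auto simp: differentiable_def)
      have "rgrad (g c) ?u ?z \<noteq> 0" by (rule grad[OF c bb f0])
      then have "(\<chi> j. frechet_derivative ?u (at ?z) (axis j 1)) \<noteq> 0"
        using rgrad_eq_raised(5)[OF c(1) _ ud] c(2) by simp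
      moreover have "covector F (?z, b) = (\<chi> j. frechet_derivative ?u (at ?z) (axis j 1))"
        unfolding frechet_derivative_at[OF du, symmetric] covector_def by simp
      ultimately have "covector F (?z, b) \<noteq> 0" by simp
      moreover have "F (?z, b) = 0" using W(5)[OF W(2) bb] f0 chart_inv_coord[OF c] by simp
      ultimately show ?thesis using W by blast
    qed
    have "p \<notin> interior (K b)"
    proof
      assume "p \<in> interior (K b)"
      then obtain U where U: "open U" "p \<in> U" "U \<subseteq> K b" unfolding interior_def by blast
      obtain c where c: "c \<in> A" "p \<in> chart_dom c" by (rule chart_cover)
      obtain W F where W: "open W" "(coord c p, b) \<in> W" "W \<subseteq> chart_img c \<times> UNIV" "C_infty W F"
        "\<And>y s. (y, s) \<in> W \<Longrightarrow> s \<in> {a..b} \<Longrightarrow> f (chart_inv c y) s = F (y, s)"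
        and F0: "F (coord c p, b) = 0" "covector F (coord c p, b) \<noteq> 0"
        using local[OF c] by blast
      let ?z = "coord c p"
      have cb: "continuous_on UNIV (\<lambda>y :: real ^ 'n. (y, b))" by (intro continuous_intros)
      have oS: "open ((\<lambda>y. (y, b)) -` W \<inter> coord c ` (U \<inter> chart_dom c))"
        by (intro open_Int open_vimage[OF W(1) cb] open_coord_image c U)
      have zS: "?z \<in> (\<lambda>y. (y, b)) -` W \<inter> coord c ` (U \<inter> chart_dom c)" using W(2) U(2) c(2) by blast
      note d = C_infty_slice_has_derivative[OF W(4,2)]
      have "F (y, b) \<le> F (?z, b)" if y: "y \<in> (\<lambda>y. (y, b)) -` W \<inter> coord c ` (U \<inter> chart_dom c)" for y
      proof -
        obtain x where x: "x \<in> U" "x \<in> chart_dom c" "y = coord c x" using y by blast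
        have "f x b \<le> 0" using x(1) U(3) Kf[OF bb] by blast
        then show ?thesis using W(5)[of y b] y bb x chart_inv_coord[OF c(1)] F0(1) by auto
      qed
      then have "(\<lambda>v. frechet_derivative F (at (?z, b)) (v, 0)) = (\<lambda>v. 0)"
        by (intro differential_zero_maxmin[OF zS oS d]) blast
      then have "covector F (?z, b) = 0" unfolding covector_def by (simp add: fun_eq_iff vec_eq_iff)
      then show False using F0(2) by simp
    qed
    then have fr: "p \<in> frontier (K b)" using p closure_subset by (auto simp: frontier_def)
    have "barrier_Phi g c a b f p b \<ge> 0" if c: "c \<in> A" "p \<in> chart_dom c" for c
    proof (rule ccontr)
      assume neg: "\<not> ?thesis"
      obtain W F where W: "open W" "(coord c p, b) \<in> W" "W \<subseteq> chart_img c \<times> UNIV" "C_infty W F"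
        "\<And>y s. (y, s) \<in> W \<Longrightarrow> s \<in> {a..b} \<Longrightarrow> f (chart_inv c y) s = F (y, s)"
        and F0: "F (coord c p, b) = 0" "covector F (coord c p, b) \<noteq> 0"
        using local[OF c] by blast
      have "barrier_Phi g c a b f p b = level_Phi (g c) F (coord c p, b)"
        by (rule barrier_Phi_eq_level_Phi[OF c refl ab W(4,1,2) W(5) F0(2)])
      then have neg: "level_Phi (g c) F (coord c p, b) < 0" using neg by simp
      have zZ: "(chart_inv c (coord c p), b) \<in> Z" using pZ chart_inv_coord[OF c] by simp
      show False
      proof (rule strict_touching_impossible[OF c(1) W(1,3,2,4) a ab _ _ F0 zZ neg])
        show "(chart_inv c z, t) \<notin> Z" if "(z, t) \<in> W" "a \<le> t" "t < b" "F (z, t) \<le> 0" for z t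
          using past[of t "chart_inv c z"] W(5)[of z t] that by simp
        show "(chart_inv c z, b) \<notin> Z" if "(z, b) \<in> W" "F (z, b) < 0" for z
          using inner[of "chart_inv c z"] W(5)[of z b] that bb by simp
      qed
    qed
    with fr show ?thesis by blast
  qed
  then show ?thesis
    unfolding weak_set_flow_def using Z_closed Z_subset by blast
qed

end

theorem theorem24:
  fixes A :: "('a::{t2_space, second_countable_topology}, 'n::finite) chart set"
    and gs :: "nat \<Rightarrow> ('a, 'n) metric_field"
    and g :: "('a, 'n) metric_field"
    and Zs :: "nat \<Rightarrow> ('a \<times> real) set"
    and Z :: "('a \<times> real) set"
  assumes "smooth_atlas A"
    and "\<And>n. riemannian_metric A (gs n)"
    and "riemannian_metric A g"
    and "metrics_converge_smoothly A gs g"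
    and "\<And>n. weak_set_flow A (gs n) (Zs n)"
    and "kuratowski_converges (UNIV \<times> {0..}) (parabolic_dist A g) Zs Z"
  shows "weak_set_flow A g Z"
proof -
  interpret limit_flow A g gs Zs Z
    by unfold_locales (rule assms)+
  show ?thesis by (rule limit_is_weak_set_flow)
qed

end
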